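(* Let $G_I$ be the simply connected real Lie group whose Lie algebra $\mathfrak g_I$ has a basis $e_0,e_1,e_2$ with $[e_0,e_1]=0$, $[e_2,e_0]=e_0$, $[e_2,e_1]=e_1$. For $c>1$ let $G_c$ be the simply connected real Lie group whose Lie algebra $\mathfrak g_c$ has a basis $e_0,e_1,e_2$ with $[e_0,e_1]=0$, $[e_2,e_0]=e_1$, $[e_2,e_1]=-c\,e_0+2e_1$. For $\nu>0$ let $g_\nu$ be the left invariant metric on $G_I$ with matrix $\operatorname{diag}(1,1,\nu)$ in the basis $e_0,e_1,e_2$ of $\mathfrak g_I$, and let $g_{c,\nu}$ be the left invariant metric on $G_c$ with matrix $$\begin{pmatrix}1&1&0\\1&c&0\\0&0&\nu\end{pmatrix}$$ in the basis $e_0,e_1,e_2$ of $\mathfrak g_c$. Then for all $\nu>0$ and $c>1$, $(G_I,g_\nu)$ and $(G_c,g_{c,\nu})$ are both isometric to the $3$-dimensional real hyperbolic space of constant curvature $-\frac1\nu$ (so they are isometric to each other), but $G_I$ and $G_c$ are not isomorphic as Lie groups.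
   Context: A left invariant metric on a Lie group is given by an inner product on its Lie algebra of left invariant vector fields; its matrix in the basis $e_0,e_1,e_2$ is the Gram matrix of that inner product. *)

theory Defs
  imports "HOL-Analysis.Analysis" "HOL-Algebra.Group"
begin

section \<open>Smooth manifolds\<close>

text \<open>Continuous differentiability of order \<open>n\<close> and smoothness on an open set \<open>S\<close> of a Euclidean space.\<close>

primrec Ck_on :: "nat \<Rightarrow> ('e::euclidean_space \<Rightarrow> 'f::real_normed_vector) \<Rightarrow> 'e set \<Rightarrow> bool" where
  "Ck_on 0 f S \<longleftrightarrow> continuous_on S f"
| "Ck_on (Suc n) f S \<longleftrightarrow>
     (\<forall>x\<in>S. f differentiable (at x)) \<and> (\<forall>v. Ck_on n (\<lambda>x. frechet_derivative f (at x) v) S)"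

definition smooth_on :: "'e::euclidean_space set \<Rightarrow> ('e \<Rightarrow> 'f::real_normed_vector) \<Rightarrow> bool" where
  "smooth_on S f \<longleftrightarrow> (\<forall>n. Ck_on n f S)"

text \<open>A chart is a pair \<open>(U, \<phi>)\<close>; only the values of \<open>\<phi>\<close> on \<open>U\<close> matter, and its inverse is
  \<open>inv_into U \<phi>\<close>.  Atlases are not required to be maximal.\<close>

type_synonym ('a, 'e) chart = "'a set \<times> ('a \<Rightarrow> 'e)"

record ('a, 'e) manifold =
  mtop :: "'a topology"
  atlas :: "('a, 'e) chart set"

definition smooth_manifold :: "('a, 'e::euclidean_space) manifold \<Rightarrow> bool" where
  "smooth_manifold M \<longleftrightarrow>
     Hausdorff_space (mtop M) \<and> second_countable (mtop M) \<and>
     topspace (mtop M) = (\<Union>(U, \<phi>)\<in>atlas M. U) \<and>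
     (\<forall>(U, \<phi>)\<in>atlas M.
        openin (mtop M) U \<and> open (\<phi> ` U) \<and>
        homeomorphic_map (subtopology (mtop M) U) (top_of_set (\<phi> ` U)) \<phi>) \<and>
     (\<forall>(U, \<phi>)\<in>atlas M. \<forall>(V, \<psi>)\<in>atlas M.
        smooth_on (\<phi> ` (U \<inter> V)) (\<lambda>x. \<psi> (inv_into U \<phi> x)))"

definition prod_manifold ::
  "('a, 'e) manifold \<Rightarrow> ('b, 'f) manifold \<Rightarrow> ('a \<times> 'b, 'e \<times> 'f) manifold" where
  "prod_manifold M N =
     \<lparr>mtop = prod_topology (mtop M) (mtop N),
      atlas = {(U \<times> V, map_prod \<phi> \<psi>) |U \<phi> V \<psi>. (U, \<phi>) \<in> atlas M \<and> (V, \<psi>) \<in> atlas N}\<rparr>"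

definition smooth_map ::
  "('a, 'e::euclidean_space) manifold \<Rightarrow> ('b, 'f::euclidean_space) manifold \<Rightarrow> ('a \<Rightarrow> 'b) \<Rightarrow> bool" where
  "smooth_map M N F \<longleftrightarrow>
     continuous_map (mtop M) (mtop N) F \<and>
     (\<forall>(U, \<phi>)\<in>atlas M. \<forall>(V, \<psi>)\<in>atlas N.
        smooth_on (\<phi> ` {p \<in> U. F p \<in> V}) (\<lambda>x. \<psi> (F (inv_into U \<phi> x))))"

definition diffeomorphism ::
  "('a, 'e::euclidean_space) manifold \<Rightarrow> ('b, 'f::euclidean_space) manifold \<Rightarrow> ('a \<Rightarrow> 'b) \<Rightarrow> bool" where
  "diffeomorphism M N F \<longleftrightarrow>
     smooth_map M N F \<and>
     (\<exists>F'. smooth_map N M F' \<and>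
           (\<forall>p\<in>topspace (mtop M). F' (F p) = p) \<and> (\<forall>q\<in>topspace (mtop N). F (F' q) = q))"

definition simply_connected_space :: "'a topology \<Rightarrow> bool" where
  "simply_connected_space X \<longleftrightarrow>
     path_connected_space X \<and>
     (\<forall>\<gamma>. pathin X \<gamma> \<and> \<gamma> 1 = \<gamma> 0 \<longrightarrow>
        homotopic_with (\<lambda>\<eta>. \<eta> 0 = \<gamma> 0 \<and> \<eta> 1 = \<gamma> 0) (top_of_set {0..1::real}) X \<gamma> (\<lambda>_. \<gamma> 0))"


section \<open>Tangent vectors and vector fields\<close>

definition smooth_fun_on :: "('a, 'e::euclidean_space) manifold \<Rightarrow> 'a set \<Rightarrow> ('a \<Rightarrow> real) \<Rightarrow> bool" where
  "smooth_fun_on M W f \<longleftrightarrow>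
     openin (mtop M) W \<and>
     (\<forall>(U, \<phi>)\<in>atlas M. smooth_on (\<phi> ` (U \<inter> W)) (\<lambda>x. f (inv_into U \<phi> x)))"

definition smooth_near :: "('a, 'e::euclidean_space) manifold \<Rightarrow> 'a \<Rightarrow> ('a \<Rightarrow> real) \<Rightarrow> bool" where
  "smooth_near M p f \<longleftrightarrow> (\<exists>W. p \<in> W \<and> smooth_fun_on M W f)"

text \<open>A tangent vector at \<open>p\<close> is a derivation at \<open>p\<close> of the functions that are smooth near \<open>p\<close>.  That it
  depends only on germs follows from the Leibniz rule: if \<open>f\<close> vanishes on a neighbourhood \<open>W\<close> of \<open>p\<close>,
  then \<open>f = f u\<close> for the indicator function \<open>u\<close> of the complement of \<open>W\<close>, and \<open>u\<close> is smooth near \<open>p\<close>.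
  Derivations take the dummy value 0 on other functions, so that tangent vectors are equal as
  derivations iff they are equal in HOL.\<close>

type_synonym 'a tvec = "('a \<Rightarrow> real) \<Rightarrow> real"

definition tangent_space :: "('a, 'e::euclidean_space) manifold \<Rightarrow> 'a \<Rightarrow> 'a tvec set" where
  "tangent_space M p = {v.
     (\<forall>f. \<not> smooth_near M p f \<longrightarrow> v f = 0) \<and>
     (\<forall>f g a b. smooth_near M p f \<and> smooth_near M p g \<longrightarrow>
        v (\<lambda>q. a * f q + b * g q) = a * v f + b * v g) \<and>
     (\<forall>f g. smooth_near M p f \<and> smooth_near M p g \<longrightarrow>
        v (\<lambda>q. f q * g q) = f p * v g + g p * v f)}"

definition pushforward ::
  "('b, 'f::euclidean_space) manifold \<Rightarrow> ('a \<Rightarrow> 'b) \<Rightarrow> 'a \<Rightarrow> 'a tvec \<Rightarrow> 'b tvec" where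
  "pushforward N F p v = (\<lambda>f. if smooth_near N (F p) f then v (\<lambda>q. f (F q)) else 0)"

type_synonym 'a vfield = "'a \<Rightarrow> 'a tvec"

definition smooth_vfield_on :: "('a, 'e::euclidean_space) manifold \<Rightarrow> 'a set \<Rightarrow> 'a vfield \<Rightarrow> bool" where
  "smooth_vfield_on M W X \<longleftrightarrow>
     openin (mtop M) W \<and> (\<forall>p\<in>W. X p \<in> tangent_space M p) \<and>
     (\<forall>V f. V \<subseteq> W \<and> smooth_fun_on M V f \<longrightarrow> smooth_fun_on M V (\<lambda>p. X p f))"

definition lie_bracket ::
  "('a, 'e::euclidean_space) manifold \<Rightarrow> 'a vfield \<Rightarrow> 'a vfield \<Rightarrow> 'a vfield" where
  "lie_bracket M X Y = (\<lambda>p f.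
     if p \<in> topspace (mtop M) \<and> smooth_near M p f
     then X p (\<lambda>q. Y q f) - Y p (\<lambda>q. X q f) else 0)"

definition lin_comb :: "real list \<Rightarrow> 'a vfield list \<Rightarrow> 'a vfield" where
  "lin_comb as Xs = (\<lambda>p f. \<Sum>i<length Xs. as ! i * (Xs ! i) p f)"


section \<open>Riemannian metrics\<close>

type_synonym 'a metric_tensor = "'a \<Rightarrow> 'a tvec \<Rightarrow> 'a tvec \<Rightarrow> real"

definition riemannian_metric ::
  "('a, 'e::euclidean_space) manifold \<Rightarrow> 'a metric_tensor \<Rightarrow> bool" where
  "riemannian_metric M g \<longleftrightarrow>
     (\<forall>p\<in>topspace (mtop M).
        (\<forall>v\<in>tangent_space M p. \<forall>w\<in>tangent_space M p. g p v w = g p w v) \<and>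
        (\<forall>u\<in>tangent_space M p. \<forall>v\<in>tangent_space M p. \<forall>w\<in>tangent_space M p. \<forall>a b.
           g p (\<lambda>f. a * u f + b * v f) w = a * g p u w + b * g p v w) \<and>
        (\<forall>v\<in>tangent_space M p. v \<noteq> (\<lambda>_. 0) \<longrightarrow> g p v v > 0)) \<and>
     (\<forall>W X Y. smooth_vfield_on M W X \<and> smooth_vfield_on M W Y \<longrightarrow>
        smooth_fun_on M W (\<lambda>p. g p (X p) (Y p)))"

definition riemannian_isometry ::
  "('a, 'e::euclidean_space) manifold \<Rightarrow> 'a metric_tensor \<Rightarrow>
   ('b, 'f::euclidean_space) manifold \<Rightarrow> 'b metric_tensor \<Rightarrow> ('a \<Rightarrow> 'b) \<Rightarrow> bool" where
  "riemannian_isometry M g N h F \<longleftrightarrow>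
     diffeomorphism M N F \<and>
     (\<forall>p\<in>topspace (mtop M). \<forall>v\<in>tangent_space M p. \<forall>w\<in>tangent_space M p.
        h (F p) (pushforward N F p v) (pushforward N F p w) = g p v w)"

definition isometric ::
  "('a, 'e::euclidean_space) manifold \<Rightarrow> 'a metric_tensor \<Rightarrow>
   ('b, 'f::euclidean_space) manifold \<Rightarrow> 'b metric_tensor \<Rightarrow> bool" where
  "isometric M g N h \<longleftrightarrow> (\<exists>F. riemannian_isometry M g N h F)"


section \<open>Hyperbolic 3-space\<close>

text \<open>The upper half-space model.  The metric of constant curvature \<open>\<kappa> < 0\<close> is
  \<open>(dx\<^sub>1\<^sup>2 + dx\<^sub>2\<^sup>2 + dx\<^sub>3\<^sup>2) / x\<^sub>3\<^sup>2\<close>, which has curvature \<open>-1\<close>, multiplied by \<open>-1/\<kappa>\<close>.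
  The coordinates of a tangent vector \<open>v\<close> are its values \<open>v (\<lambda>y. y $ i)\<close> on the coordinate
  functions.\<close>

definition hyperbolic_space :: "(real^3, real^3) manifold" where
  "hyperbolic_space =
     \<lparr>mtop = top_of_set {x. x $ 3 > 0}, atlas = {({x. x $ 3 > 0}, \<lambda>x. x)}\<rparr>"

definition hyperbolic_metric :: "real \<Rightarrow> (real^3) metric_tensor" where
  "hyperbolic_metric \<kappa> = (\<lambda>x v w.
     (- 1 / \<kappa>) * (\<Sum>i\<in>UNIV. v (\<lambda>y. y $ i) * w (\<lambda>y. y $ i)) / (x $ 3)\<^sup>2)"


section \<open>Lie groups\<close>

definition lie_group :: "'a monoid \<Rightarrow> ('a, 'e::euclidean_space) manifold \<Rightarrow> bool" where
  "lie_group G M \<longleftrightarrow>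
     group G \<and> smooth_manifold M \<and> carrier G = topspace (mtop M) \<and>
     smooth_map (prod_manifold M M) M (\<lambda>(x, y). x \<otimes>\<^bsub>G\<^esub> y) \<and>
     smooth_map M M (\<lambda>x. inv\<^bsub>G\<^esub> x)"

definition lie_group_isomorphic ::
  "'a monoid \<Rightarrow> ('a, 'e::euclidean_space) manifold \<Rightarrow>
   'b monoid \<Rightarrow> ('b, 'f::euclidean_space) manifold \<Rightarrow> bool" where
  "lie_group_isomorphic G M H N \<longleftrightarrow> (\<exists>F\<in>iso G H. diffeomorphism M N F)"

text \<open>The left invariant vector fields, which form a Lie algebra under \<^const>\<open>lie_bracket\<close>.  They
  are extended by 0 outside the group.\<close>

definition lie_algebra :: "'a monoid \<Rightarrow> ('a, 'e::euclidean_space) manifold \<Rightarrow> 'a vfield set" where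
  "lie_algebra G M = {X.
     smooth_vfield_on M (topspace (mtop M)) X \<and>
     (\<forall>p. p \<notin> topspace (mtop M) \<longrightarrow> X p = (\<lambda>_. 0)) \<and>
     (\<forall>a\<in>carrier G. \<forall>p\<in>carrier G. pushforward M (\<lambda>q. a \<otimes>\<^bsub>G\<^esub> q) p (X p) = X (a \<otimes>\<^bsub>G\<^esub> p))}"

definition lie_algebra_basis ::
  "'a monoid \<Rightarrow> ('a, 'e::euclidean_space) manifold \<Rightarrow> 'a vfield list \<Rightarrow> bool" where
  "lie_algebra_basis G M es \<longleftrightarrow>
     set es \<subseteq> lie_algebra G M \<and>
     (\<forall>X\<in>lie_algebra G M. \<exists>!as. length as = length es \<and> X = lin_comb as es)"

definition left_invariant_metric ::
  "'a monoid \<Rightarrow> ('a, 'e::euclidean_space) manifold \<Rightarrow> 'a metric_tensor \<Rightarrow> bool" where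
  "left_invariant_metric G M g \<longleftrightarrow>
     riemannian_metric M g \<and>
     (\<forall>a\<in>carrier G. \<forall>p\<in>carrier G. \<forall>v\<in>tangent_space M p. \<forall>w\<in>tangent_space M p.
        g (a \<otimes>\<^bsub>G\<^esub> p) (pushforward M (\<lambda>q. a \<otimes>\<^bsub>G\<^esub> q) p v) (pushforward M (\<lambda>q. a \<otimes>\<^bsub>G\<^esub> q) p w)
          = g p v w)"

text \<open>The inner product on the Lie algebra corresponding to a left invariant metric \<open>g\<close> is
  \<open>\<langle>X, Y\<rangle> = g(X, Y)\<close> evaluated at the identity.\<close>

definition gram_matrix ::
  "'a monoid \<Rightarrow> 'a metric_tensor \<Rightarrow> 'a vfield list \<Rightarrow> real list list" where
  "gram_matrix G g es = map (\<lambda>X. map (\<lambda>Y. g \<one>\<^bsub>G\<^esub> (X \<one>\<^bsub>G\<^esub>) (Y \<one>\<^bsub>G\<^esub>)) es) es"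

end

(*
Both Lie algebras have a basis u, w, e2 that is orthogonal for the given inner product, with u and w of
length 1 and e2 of length sqrt nu, such that
  [u, w] = 0,  [e2, u] = u + b w,  [e2, w] = w - b u,
where b = 0 for g_I and b = sqrt (c - 1), w = (f1 - f0) / b for g_c.  In the dual coframe alpha, omega, tau
the structure equations read d tau = 0 and d zeta = - (1 + i b) tau /\ zeta for zeta = alpha + i omega.
On the simply connected group this gives functions t, x, y with dt = tau and d(x + i y) = exp ((1 + i b) t) zeta,
and in the coordinates x, y, z = sqrt nu exp t the metric becomes nu (dx^2 + dy^2 + dz^2) / z^2, whatever b is.
Left translations change t, x, y only by the constants of integration, so (x, y, t) is a homomorphism
to the semidirect product of C with R in which t acts as exp ((1 + i b) t).  It is a local diffeomorphism, and
it is injective because the one-parameter subgroups of the target lift.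

The groups differ: in the semidirect product with b > 0 some element acts on the commutator subgroup C as a
negative scalar, while for b = 0 all elements act as positive scalars, and a continuous isomorphism is
real linear on C.
*)
theory Submission
  imports Defs
begin


section \<open>Calculus of \<open>C\<^sup>k\<close> functions\<close>

text \<open>The number b is the imaginary part of the eigenvalues of ad e2 on the plane of e0 and
  e1: for g_c the characteristic polynomial there is X^2 - 2 X + c, with roots 1 + i b and 1 - i b.
  The real part 1 is common to both algebras. The imaginary part rotates the plane, and the metric
  does not see it because the given inner product makes ad e2 - 1 skew: f1 - f0 is orthogonal to f0
  and has square length c - 2 + 1 = b^2.

  The groups are arbitrary realizations of their Lie algebras, so coordinates have to be produced
  from the frame alone. Beyond connectedness, simple connectedness enters at one place: local
  primitives of closed one-forms are continued along paths, and a homotopy shows that a loop returns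
  to its initial value. The resulting map to the model is a local diffeomorphism, which by itself
  need not be injective or surjective. In place of a covering or completeness argument the three
  coordinate subgroups of the model are lifted by repeated doubling; the product of the lifts is a
  continuous global section, and being a two-sided inverse is a clopen condition.\<close>

lemma Ck_on_subset: "Ck_on n f S \<Longrightarrow> T \<subseteq> S \<Longrightarrow> Ck_on n f T"
  by (induction n arbitrary: f) (auto intro: continuous_on_subset)

text \<open>Derivatives in \<open>Ck_on\<close> are taken at full neighbourhoods, so agreement on
  \<open>S\<close> passes to them because \<open>S\<close> is open. Most open-set hypotheses of the
  later lemmas go back to this.\<close>

lemma Ck_on_cong:
  assumes "open S" "\<And>x. x \<in> S \<Longrightarrow> f x = g x" "Ck_on n f S"
  shows "Ck_on n g S"
  using assms(2,3)
proof (induction n arbitrary: f g)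
  case 0
  then show ?case by (simp cong: continuous_on_cong)
next
  case (Suc n)
  have d: "f differentiable (at x)" if "x \<in> S" for x using Suc.prems(2) that by simp
  have D: "frechet_derivative f (at x) = frechet_derivative g (at x)" if "x \<in> S" for x
    by (rule frechet_derivative_transform_within_open[OF d[OF that] assms(1) that])
       (use Suc.prems in auto)
  have "g differentiable (at x)" if "x \<in> S" for x
    using d[OF that] has_derivative_transform_within_open[OF _ assms(1) that, of f _ UNIV g] Suc.prems(1)
    unfolding differentiable_def by blast
  moreover have "Ck_on n (\<lambda>x. frechet_derivative g (at x) v) S" for v
    by (rule Suc.IH[of "\<lambda>x. frechet_derivative f (at x) v"]) (use Suc.prems D in auto)
  ultimately show ?case by simp
qed

text \<open>Replaces the chosen \<open>frechet_derivative\<close> by any explicit derivative; most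
  inductions on the order below go through it.\<close>

lemma Ck_on_SucI:
  assumes "open S" "\<And>x. x \<in> S \<Longrightarrow> (f has_derivative f' x) (at x)"
    and "\<And>v. Ck_on n (\<lambda>x. f' x v) S"
  shows "Ck_on (Suc n) f S"
proof -
  have "frechet_derivative f (at x) = f' x" if "x \<in> S" for x
    using assms(2)[OF that] by (metis frechet_derivative_at)
  then have "Ck_on n (\<lambda>x. frechet_derivative f (at x) v) S" for v
    using Ck_on_cong[OF assms(1) _ assms(3)[of v]] by simp
  then show ?thesis using assms(2) by (auto simp: differentiable_def)
qed

lemma Ck_on_Suc_has_derivative:
  "Ck_on (Suc n) f S \<Longrightarrow> x \<in> S \<Longrightarrow> (f has_derivative frechet_derivative f (at x)) (at x)"
  using frechet_derivative_works by auto

lemma Ck_on_SucD: "Ck_on (Suc n) f S \<Longrightarrow> Ck_on n f S"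
proof (induction n arbitrary: f)
  case 0
  then show ?case
    by (simp add: continuous_at_imp_continuous_on differentiable_imp_continuous_within)
next
  case (Suc n)
  show ?case
    using Suc.prems Suc.IH unfolding Ck_on.simps(2)[of "Suc n"] Ck_on.simps(2)[of n f] by blast
qed

lemma Ck_on_imp_continuous_on: "Ck_on n f S \<Longrightarrow> continuous_on S f"
proof (induction n)
  case (Suc n)
  show ?case by (rule Suc.IH[OF Ck_on_SucD[OF Suc.prems]])
qed simp

text \<open>Differentiability at a point sees only a neighbourhood. This turns smoothness near each
  point into smoothness on a whole chart domain.\<close>

lemma Ck_on_local:
  assumes "\<And>x. x \<in> S \<Longrightarrow> \<exists>T. open T \<and> x \<in> T \<and> Ck_on n f T"
  shows "Ck_on n f S"
  using assms
proof (induction n arbitrary: f)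
  case 0
  have "isCont f x" if "x \<in> S" for x
    using 0[OF that] continuous_on_eq_continuous_at by auto
  then show ?case by (simp add: continuous_at_imp_continuous_on)
next
  case (Suc n)
  have "f differentiable (at x)" if "x \<in> S" for x
    using Suc.prems[OF that] by auto
  moreover have "Ck_on n (\<lambda>x. frechet_derivative f (at x) v) S" for v
  proof (rule Suc.IH)
    fix x assume "x \<in> S"
    from Suc.prems[OF this] show "\<exists>T. open T \<and> x \<in> T \<and> Ck_on n (\<lambda>x. frechet_derivative f (at x) v) T"
      by auto
  qed
  ultimately show ?case by simp
qed

lemma Ck_on_const: "Ck_on n (\<lambda>x. c) S"
proof (induction n arbitrary: c)
  case (Suc n)
  have "frechet_derivative (\<lambda>x. c) (at x) = (\<lambda>h. 0)" for x :: 'a by simp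
  then show ?case using Suc by simp
qed simp

lemma Ck_on_bounded_linear_id:
  assumes "open S" "bounded_linear L" shows "Ck_on n L S"
proof (cases n)
  case 0
  then show ?thesis using assms by (simp add: linear_continuous_on)
next
  case (Suc m)
  show ?thesis unfolding Suc
    by (rule Ck_on_SucI[OF assms(1), of _ "\<lambda>x. L"])
       (auto intro: bounded_linear_imp_has_derivative assms Ck_on_const)
qed

lemma Ck_on_bounded_linear:
  assumes "open S" "bounded_linear L" "Ck_on n f S" shows "Ck_on n (\<lambda>x. L (f x)) S"
  using assms(3)
proof (induction n arbitrary: f)
  case 0
  then show ?case using assms by (auto intro: bounded_linear.continuous_on)
next
  case (Suc n)
  show ?case
  proof (rule Ck_on_SucI[OF assms(1)])
    show "((\<lambda>x. L (f x)) has_derivative (\<lambda>v. L (frechet_derivative f (at x) v))) (at x)"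
      if "x \<in> S" for x
      using Suc.prems that by (intro bounded_linear.has_derivative[OF assms(2)] Ck_on_Suc_has_derivative)
    show "Ck_on n (\<lambda>x. L (frechet_derivative f (at x) v)) S" for v
      using Suc by auto
  qed
qed

lemma Ck_on_add:
  assumes "open S" "Ck_on n f S" "Ck_on n g S" shows "Ck_on n (\<lambda>x. f x + g x) S"
  using assms(2,3)
proof (induction n arbitrary: f g)
  case 0
  then show ?case by (auto intro: continuous_intros)
next
  case (Suc n)
  show ?case
  proof (rule Ck_on_SucI[OF assms(1)])
    show "((\<lambda>x. f x + g x) has_derivative
       (\<lambda>v. frechet_derivative f (at x) v + frechet_derivative g (at x) v)) (at x)" if "x \<in> S" for x
      using Suc.prems that by (intro has_derivative_add Ck_on_Suc_has_derivative)
    show "Ck_on n (\<lambda>x. frechet_derivative f (at x) v + frechet_derivative g (at x) v) S" for v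
      using Suc by auto
  qed
qed

lemma Ck_on_sum:
  assumes "open S" "\<And>i. i \<in> I \<Longrightarrow> Ck_on n (f i) S"
  shows "Ck_on n (\<lambda>x. \<Sum>i\<in>I. f i x) S"
  using assms(2)
  by (induction I rule: infinite_finite_induct) (auto intro: Ck_on_const Ck_on_add[OF assms(1)])

lemma Ck_on_bilinear:
  fixes prod :: "'a::real_normed_vector \<Rightarrow> 'b::real_normed_vector \<Rightarrow> 'c::real_normed_vector"
  assumes "open S" "bounded_bilinear prod" "Ck_on n f S" "Ck_on n g S"
  shows "Ck_on n (\<lambda>x. prod (f x) (g x)) S"
  using assms(3,4)
proof (induction n arbitrary: f g)
  case 0
  then show ?case by (auto intro: bounded_bilinear.continuous_on[OF assms(2)])
next
  case (Suc n)
  show ?case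
  proof (rule Ck_on_SucI[OF assms(1)])
    show "((\<lambda>x. prod (f x) (g x)) has_derivative
       (\<lambda>v. prod (f x) (frechet_derivative g (at x) v) + prod (frechet_derivative f (at x) v) (g x))) (at x)"
      if "x \<in> S" for x
      using Suc.prems that by (intro bounded_bilinear.FDERIV[OF assms(2)] Ck_on_Suc_has_derivative)
    show "Ck_on n (\<lambda>x. prod (f x) (frechet_derivative g (at x) v) +
        prod (frechet_derivative f (at x) v) (g x)) S" for v
      using Suc.prems Ck_on_SucD[OF Suc.prems(1)] Ck_on_SucD[OF Suc.prems(2)]
      by (intro Ck_on_add[OF assms(1)] Suc.IH) auto
  qed
qed

lemmas Ck_on_mult = Ck_on_bilinear[OF _ bounded_bilinear_mult]

lemma Ck_on_diff:
  assumes "open S" "Ck_on n f S" "Ck_on n g S" shows "Ck_on n (\<lambda>x. f x - g x) S"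
  using Ck_on_add[OF assms(1,2) Ck_on_bounded_linear[OF assms(1) bounded_linear_minus[OF bounded_linear_ident] assms(3)]]
  by simp

lemma Ck_on_prod:
  fixes f :: "'i \<Rightarrow> 'e::euclidean_space \<Rightarrow> real"
  assumes "open S" "\<And>i. i \<in> I \<Longrightarrow> Ck_on n (f i) S"
  shows "Ck_on n (\<lambda>x. \<Prod>i\<in>I. f i x) S"
  using assms(2)
  by (induction I rule: infinite_finite_induct) (auto intro: Ck_on_const Ck_on_mult[OF assms(1)])

lemma Ck_on_compose:
  fixes f :: "'e::euclidean_space \<Rightarrow> 'f::real_normed_vector" and g :: "'d::euclidean_space \<Rightarrow> 'e"
  assumes "open S" "g ` S \<subseteq> T" "Ck_on n f T" "Ck_on n g S"
  shows "Ck_on n (\<lambda>x. f (g x)) S"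
  using assms(3,4)
proof (induction n arbitrary: f)
  case 0
  then show ?case using assms(2) by (auto intro: continuous_on_compose2)
next
  case (Suc n)
  have lin: "linear (frechet_derivative f (at (g x)))" if "x \<in> S" for x
    using Ck_on_Suc_has_derivative[OF Suc.prems(1)] that assms(2) has_derivative_linear by blast
  show ?case
  proof (rule Ck_on_SucI[OF assms(1)])
    fix x assume x: "x \<in> S"
    have "((\<lambda>x. f (g x)) has_derivative
       (\<lambda>v. frechet_derivative f (at (g x)) (frechet_derivative g (at x) v))) (at x)"
      using x assms(2) Suc.prems
      by (intro has_derivative_compose[of g _ x UNIV f] Ck_on_Suc_has_derivative) auto
    \<comment> \<open>The direction \<open>frechet_derivative g (at x) v\<close> varies with
      \<open>x\<close>, whereas the induction hypothesis speaks of derivatives in a fixed direction.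
      The expansion in \<open>Basis\<close> makes the directions constant.\<close>
    also have "(\<lambda>v. frechet_derivative f (at (g x)) (frechet_derivative g (at x) v)) =
      (\<lambda>v. \<Sum>b\<in>Basis. (frechet_derivative g (at x) v \<bullet> b) *\<^sub>R frechet_derivative f (at (g x)) b)"
      by (rule ext, subst (1) euclidean_representation[symmetric])
         (simp add: linear_sum[OF lin[OF x]] linear_cmul[OF lin[OF x]])
    finally show "((\<lambda>x. f (g x)) has_derivative (\<lambda>v. \<Sum>b\<in>Basis.
        (frechet_derivative g (at x) v \<bullet> b) *\<^sub>R frechet_derivative f (at (g x)) b)) (at x)" .
  next
    fix v
    have "Ck_on n (\<lambda>x. frechet_derivative g (at x) v \<bullet> b) S" for b
      using Suc.prems(2) by (intro Ck_on_bounded_linear[OF assms(1) bounded_linear_inner_left]) auto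
    moreover have "Ck_on n (\<lambda>x. frechet_derivative f (at (g x)) b) S" for b
      using Suc.prems Ck_on_SucD[OF Suc.prems(2)]
      by (intro Suc.IH[where f="\<lambda>y. frechet_derivative f (at y) b"]) auto
    ultimately show "Ck_on n (\<lambda>x. \<Sum>b\<in>Basis.
        (frechet_derivative g (at x) v \<bullet> b) *\<^sub>R frechet_derivative f (at (g x)) b) S"
      by (intro Ck_on_sum Ck_on_bilinear[OF _ bounded_bilinear_scaleR] assms(1))
  qed
qed

text \<open>The derivative of the function is a polynomial in the function itself, so the induction
  for this single function closes. The same device serves \<open>exp\<close>, and \<open>sin\<close>
  together with \<open>cos\<close>.\<close>

lemma Ck_on_inverse:
  fixes S :: "real set"
  assumes "open S" "0 \<notin> S" shows "Ck_on n inverse S"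
proof (induction n)
  case 0
  then show ?case using assms by (auto intro!: continuous_intros)
next
  case (Suc n)
  show ?case
  proof (rule Ck_on_SucI[OF assms(1)])
    show "(inverse has_derivative (\<lambda>v. - (inverse x * v * inverse x))) (at x)" if "x \<in> S" for x :: real
      using has_derivative_inverse'[of x UNIV] that assms by auto
    have "Ck_on n (\<lambda>x. (- v) * (inverse x * inverse x)) S" for v
      by (intro Ck_on_mult Ck_on_const Suc assms)
    then show "Ck_on n (\<lambda>x. - (inverse x * v * inverse x)) S" for v
      by (simp add: mult_ac)
  qed
qed

lemma Ck_on_divide:
  fixes f g :: "'e::euclidean_space \<Rightarrow> real"
  assumes "open S" "Ck_on n f S" "Ck_on n g S" "\<And>x. x \<in> S \<Longrightarrow> g x \<noteq> 0"
  shows "Ck_on n (\<lambda>x. f x / g x) S"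
  unfolding divide_inverse
  by (intro Ck_on_mult assms Ck_on_compose[OF _ _ Ck_on_inverse[of "- {0}"]]) (use assms in auto)

lemma smooth_on_exp: "smooth_on UNIV (exp :: real \<Rightarrow> real)"
proof -
  have "Ck_on n (exp :: real \<Rightarrow> real) UNIV" for n
  proof (induction n)
    case (Suc n)
    show ?case
    proof (rule Ck_on_SucI)
      show "(exp has_derivative (\<lambda>v. exp x * v)) (at x)" for x :: real
        using DERIV_exp[of x] by (simp add: has_field_derivative_def)
    qed (auto intro!: Ck_on_mult Suc Ck_on_const)
  qed (auto intro: continuous_intros)
  then show ?thesis by (simp add: smooth_on_def)
qed

lemma smooth_on_sin_cos:
  "smooth_on UNIV (sin :: real \<Rightarrow> real)" "smooth_on UNIV (cos :: real \<Rightarrow> real)"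
proof -
  have "Ck_on n (sin :: real \<Rightarrow> real) UNIV \<and> Ck_on n (cos :: real \<Rightarrow> real) UNIV" for n
  proof (induction n)
    case (Suc n)
    have "Ck_on (Suc n) (sin :: real \<Rightarrow> real) UNIV"
    proof (rule Ck_on_SucI)
      show "(sin has_derivative (\<lambda>v. cos x * v)) (at x)" for x :: real
        using DERIV_sin[of x] by (simp add: has_field_derivative_def)
    qed (auto intro!: Ck_on_mult Suc[THEN conjunct2] Ck_on_const)
    moreover have "Ck_on (Suc n) (cos :: real \<Rightarrow> real) UNIV"
    proof (rule Ck_on_SucI)
      show "(cos has_derivative (\<lambda>v. sin x * (- v))) (at x)" for x :: real
        by (auto intro!: derivative_eq_intros)
      show "Ck_on n (\<lambda>x::real. sin x * (- v)) UNIV" for v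
        by (intro Ck_on_mult Suc[THEN conjunct1] Ck_on_const open_UNIV)
    qed auto
    ultimately show ?case by simp
  qed (auto intro: continuous_intros)
  then show "smooth_on UNIV (sin :: real \<Rightarrow> real)" "smooth_on UNIV (cos :: real \<Rightarrow> real)"
    by (simp_all add: smooth_on_def)
qed

section \<open>Vector-valued functions and Cramer's rule\<close>

lemma Ck_on_vecI:
  fixes f :: "'e::euclidean_space \<Rightarrow> real^'n"
  assumes "open S" "\<And>i. Ck_on n (\<lambda>x. f x $ i) S"
  shows "Ck_on n f S"
proof -
  have "Ck_on n (\<lambda>x. \<Sum>i\<in>UNIV. (f x $ i) *\<^sub>R axis i 1) S"
    by (intro Ck_on_sum Ck_on_bounded_linear[OF _ bounded_linear_scaleR_left] assms)
  also have "(\<lambda>x. \<Sum>i\<in>UNIV. (f x $ i) *\<^sub>R axis i (1::real)) = f"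
    by (rule ext, simp flip: scalar_mult_eq_scaleR add: basis_expansion)
  finally show ?thesis .
qed

lemma Ck_on_vec_nth:
  "open S \<Longrightarrow> Ck_on n f S \<Longrightarrow> Ck_on n (\<lambda>x. f x $ i) S"
  by (rule Ck_on_bounded_linear[OF _ bounded_linear_vec_nth])

lemma Ck_on_det:
  fixes A :: "'e::euclidean_space \<Rightarrow> real^'n^'n"
  assumes "open S" "\<And>i j. Ck_on n (\<lambda>x. A x $ i $ j) S"
  shows "Ck_on n (\<lambda>x. det (A x)) S"
  unfolding det_def by (intro Ck_on_sum Ck_on_mult Ck_on_const Ck_on_prod assms)

text \<open>Cramer's rule writes each component of \<open>u\<close> as a quotient of determinants,
  so \<open>u\<close> inherits the regularity of the coefficients although it is only known to solve
  the system pointwise.\<close>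

lemma Ck_on_linear_system:
  fixes A :: "'e::euclidean_space \<Rightarrow> real^'n^'n"
  assumes "open S" "\<And>i j. Ck_on n (\<lambda>x. A x $ i $ j) S" "\<And>i. Ck_on n (\<lambda>x. b x $ i) S"
    and "\<And>x. x \<in> S \<Longrightarrow> det (A x) \<noteq> 0" "\<And>x. x \<in> S \<Longrightarrow> A x *v u x = b x"
  shows "Ck_on n u S"
proof (rule Ck_on_vecI[OF assms(1)])
  fix k
  have "Ck_on n (\<lambda>x. det (\<chi> i j. if j = k then b x $ i else A x $ i $ j) / det (A x)) S"
  proof (intro Ck_on_divide Ck_on_det assms)
    show "Ck_on n (\<lambda>x. (\<chi> i j. if j = k then b x $ i else A x $ i $ j) $ i $ j) S" for i j
      using assms(2,3) by (cases "j = k") auto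
  qed (use assms in auto)
  moreover have "det (\<chi> i j. if j = k then b x $ i else A x $ i $ j) / det (A x) = u x $ k" if "x \<in> S" for x
    using cramer_lemma[of k "A x" "u x"] assms(4)[OF that] unfolding assms(5)[OF that] by simp
  ultimately show "Ck_on n (\<lambda>x. u x $ k) S"
    by (rule Ck_on_cong[OF assms(1), rotated])
qed


section \<open>The lemmas of Hadamard and Poincare\<close>

lemma ray_mem: "convex S \<Longrightarrow> p \<in> S \<Longrightarrow> x \<in> S \<Longrightarrow> 0 \<le> t \<Longrightarrow> t \<le> 1 \<Longrightarrow> p + t *\<^sub>R (x - p) \<in> S"
  using convexD_alt[of S p x t] by (simp add: algebra_simps)

lemma has_derivative_ray:
  assumes "(f has_derivative f') (at (p + t *\<^sub>R (x - p)))"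
  shows "((\<lambda>x. f (p + t *\<^sub>R (x - p))) has_derivative (\<lambda>v. f' (t *\<^sub>R v))) (at x within S)"
  by (rule has_derivative_compose[of "\<lambda>x. p + t *\<^sub>R (x - p)" "\<lambda>v. t *\<^sub>R v" x S f f', OF _ assms])
     (auto intro!: derivative_eq_intros)

lemma continuous_on_ray:
  fixes f :: "'e::real_normed_vector \<Rightarrow> 'b::topological_space"
  assumes "convex S" "p \<in> S" "x \<in> S" "continuous_on S f"
  shows "continuous_on {0..1} (\<lambda>t. f (p + t *\<^sub>R (x - p)))"
  by (rule continuous_on_compose2[OF assms(4)]) (auto intro!: continuous_intros ray_mem assms)

lemma linear_vec_expansion:
  fixes L :: "real^'n \<Rightarrow> 'b::real_vector"
  assumes "linear L" shows "L v = (\<Sum>i\<in>UNIV. v $ i *\<^sub>R L (axis i 1))"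
proof -
  have "L v = L (\<Sum>i\<in>UNIV. v $ i *\<^sub>R axis i 1)"
    by (simp flip: scalar_mult_eq_scaleR add: basis_expansion)
  then show ?thesis by (simp add: linear_sum[OF assms] linear_cmul[OF assms])
qed

text \<open>By the chain rule each differentiation along a ray brings out one more factor
  \<open>t\<close>; the weight \<open>t ^ m\<close> makes this family of integrals closed under
  differentiation.\<close>

lemma has_derivative_ray_integral:
  fixes f :: "'e::euclidean_space \<Rightarrow> real"
  assumes S: "open S" "convex S" "p \<in> S" and f: "Ck_on (Suc n) f S" and x: "x \<in> S"
  shows "((\<lambda>x. integral {0..1} (\<lambda>t. t ^ m * f (p + t *\<^sub>R (x - p)))) has_derivative
    (\<lambda>v. integral {0..1} (\<lambda>t. t ^ Suc m * frechet_derivative f (at (p + t *\<^sub>R (x - p))) v))) (at x)"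
proof -
  \<comment> \<open>\<open>leibniz_rule\<close> wants the derivative of the integrand as a jointly
    continuous map into the bounded linear functions; continuity is checked below on each basis
    vector.\<close>
  define D where "D x t = Blinfun (\<lambda>v. t ^ Suc m * frechet_derivative f (at (p + t *\<^sub>R (x - p))) v)" for x t
  have der: "(f has_derivative frechet_derivative f (at y)) (at y)" if "y \<in> S" for y
    using Ck_on_Suc_has_derivative[OF f that] .
  have bl: "bounded_linear (\<lambda>v. t ^ Suc m * frechet_derivative f (at (p + t *\<^sub>R (x - p))) v)"
    if "x \<in> S" "t \<in> {0..1}" for x t
    using has_derivative_bounded_linear[OF der] ray_mem[OF S(2,3)] that
    by (intro bounded_linear_const_mult) auto
  have D: "blinfun_apply (D x t) v = t ^ Suc m * frechet_derivative f (at (p + t *\<^sub>R (x - p))) v"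
    if "x \<in> S" "t \<in> {0..1}" for x t v
    unfolding D_def using bounded_linear_Blinfun_apply[OF bl[OF that]] by simp
  have cont: "continuous_on (S \<times> cbox 0 1) (\<lambda>(x, t). D x t)"
  proof (rule continuous_on_blinfun_componentwise)
    fix i :: 'e
    have "continuous_on S (\<lambda>y. frechet_derivative f (at y) i)"
      using f by (auto intro: Ck_on_imp_continuous_on)
    then have "continuous_on (S \<times> {0..1}) (\<lambda>z. frechet_derivative f (at (p + snd z *\<^sub>R (fst z - p))) i)"
      by (rule continuous_on_compose2) (auto intro!: continuous_intros ray_mem S)
    then have "continuous_on (S \<times> {0..1}) (\<lambda>z. snd z ^ Suc m * frechet_derivative f (at (p + snd z *\<^sub>R (fst z - p))) i)"
      by (intro continuous_intros)
    then show "continuous_on (S \<times> cbox 0 1) (\<lambda>z. blinfun_apply (case z of (x, t) \<Rightarrow> D x t) i)"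
      unfolding cbox_interval by (rule continuous_on_eq) (auto simp: D)
  qed
  have int: "(\<lambda>t. t ^ m * f (p + t *\<^sub>R (x - p))) integrable_on cbox 0 1" if "x \<in> S" for x
    unfolding cbox_interval
    by (intro integrable_continuous_real continuous_intros continuous_on_ray[OF S(2,3) that]
        Ck_on_imp_continuous_on[OF f])
  have derf: "((\<lambda>x. t ^ m * f (p + t *\<^sub>R (x - p))) has_derivative blinfun_apply (D x t)) (at x within S)"
    if "x \<in> S" "t \<in> cbox 0 1" for x t
  proof -
    have y: "p + t *\<^sub>R (x - p) \<in> S" using that by (intro ray_mem S) auto
    have "((\<lambda>x. t ^ m * f (p + t *\<^sub>R (x - p))) has_derivative
        (\<lambda>v. t ^ m * frechet_derivative f (at (p + t *\<^sub>R (x - p))) (t *\<^sub>R v))) (at x within S)"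
      by (intro has_derivative_mult_right has_derivative_ray der y)
    also have "(\<lambda>v. t ^ m * frechet_derivative f (at (p + t *\<^sub>R (x - p))) (t *\<^sub>R v)) = blinfun_apply (D x t)"
      using that linear_cmul[OF has_derivative_linear[OF der[OF y]]] by (auto simp: D)
    finally show ?thesis .
  qed
  have "((\<lambda>x. integral (cbox 0 1) (\<lambda>t. t ^ m * f (p + t *\<^sub>R (x - p)))) has_derivative
      blinfun_apply (integral (cbox 0 1) (D x))) (at x within S)"
    by (rule leibniz_rule[OF derf int cont x S(2)])
  moreover have "blinfun_apply (integral (cbox 0 1) (D x)) =
      (\<lambda>v. integral (cbox 0 1) (\<lambda>t. t ^ Suc m * frechet_derivative f (at (p + t *\<^sub>R (x - p))) v))"
  proof
    fix v
    have "continuous_on (cbox 0 1) (\<lambda>t. case (x, t) of (x, t) \<Rightarrow> D x t)"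
      by (rule continuous_on_compose2[OF cont continuous_on_Pair[OF continuous_on_const continuous_on_id]])
         (use x in auto)
    then have "continuous_on (cbox 0 1) (D x)" by simp
    then have "D x integrable_on cbox 0 1" by (rule integrable_continuous)
    then have "blinfun_apply (integral (cbox 0 1) (D x)) v = integral (cbox 0 1) (\<lambda>t. blinfun_apply (D x t) v)"
      by (rule blinfun_apply_integral)
    also have "\<dots> = integral (cbox 0 1) (\<lambda>t. t ^ Suc m * frechet_derivative f (at (p + t *\<^sub>R (x - p))) v)"
      using x by (intro integral_cong) (simp add: D)
    finally show "blinfun_apply (integral (cbox 0 1) (D x)) v =
      integral (cbox 0 1) (\<lambda>t. t ^ Suc m * frechet_derivative f (at (p + t *\<^sub>R (x - p))) v)" .
  qed
  ultimately show ?thesis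
    unfolding at_within_open[OF x S(1)] cbox_interval by (rule has_derivative_eq_rhs)
qed

lemma Ck_on_ray_integral:
  fixes f :: "'e::euclidean_space \<Rightarrow> real"
  assumes S: "open S" "convex S" "p \<in> S" and f: "Ck_on n f S"
  shows "Ck_on n (\<lambda>x. integral {0..1} (\<lambda>t. t ^ m * f (p + t *\<^sub>R (x - p)))) S"
  using f
proof (induction n arbitrary: f m)
  case 0
  then have "continuous_on S f" by simp
  then have "continuous_on (S \<times> {0..1}) (\<lambda>z. f (p + snd z *\<^sub>R (fst z - p)))"
    by (rule continuous_on_compose2) (auto intro!: continuous_intros ray_mem S)
  then have "continuous_on (S \<times> cbox 0 1) (\<lambda>(x, t). t ^ m * f (p + t *\<^sub>R (x - p)))"
    by (auto intro!: continuous_intros simp: case_prod_unfold)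
  then show ?case
    using integral_continuous_on_param[of S 0 1 "\<lambda>x t. t ^ m * f (p + t *\<^sub>R (x - p))"]
    by (simp add: cbox_interval)
next
  case (Suc n)
  show ?case
  proof (rule Ck_on_SucI[OF S(1)])
    show "((\<lambda>x. integral {0..1} (\<lambda>t. t ^ m * f (p + t *\<^sub>R (x - p)))) has_derivative
      (\<lambda>v. integral {0..1} (\<lambda>t. t ^ Suc m * frechet_derivative f (at (p + t *\<^sub>R (x - p))) v))) (at x)"
      if "x \<in> S" for x
      using has_derivative_ray_integral[OF S Suc.prems that] .
    show "Ck_on n (\<lambda>x. integral {0..1} (\<lambda>t. t ^ Suc m * frechet_derivative f (at (p + t *\<^sub>R (x - p))) v)) S" for v
      using Suc.prems by (intro Suc.IH[where f="\<lambda>y. frechet_derivative f (at y) v"]) simp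
  qed
qed

lemma smooth_onD: "smooth_on S f \<Longrightarrow> Ck_on n f S"
  by (simp add: smooth_on_def)

lemma smooth_on_has_derivative:
  "smooth_on S f \<Longrightarrow> x \<in> S \<Longrightarrow> (f has_derivative frechet_derivative f (at x)) (at x)"
  by (rule Ck_on_Suc_has_derivative[OF smooth_onD])

lemma smooth_on_frechet_derivative:
  assumes "smooth_on S f" shows "smooth_on S (\<lambda>x. frechet_derivative f (at x) v)"
  unfolding smooth_on_def using smooth_onD[OF assms, of "Suc n" for n] by simp

lemma smooth_on_imp_continuous_on: "smooth_on S f \<Longrightarrow> continuous_on S f"
  by (rule Ck_on_imp_continuous_on[OF smooth_onD])

lemma has_vector_derivative_ray:
  assumes "linear f'" "(f has_derivative f') (at (p + t *\<^sub>R (x - p)))"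
  shows "((\<lambda>t. f (p + t *\<^sub>R (x - p))) has_vector_derivative f' (x - p)) (at t within T)"
proof -
  have "((\<lambda>t. f (p + t *\<^sub>R (x - p))) has_derivative (\<lambda>s. f' (s *\<^sub>R (x - p)))) (at t within T)"
    by (rule has_derivative_compose[of "\<lambda>t. p + t *\<^sub>R (x - p)" "\<lambda>s. s *\<^sub>R (x - p)" t T f f', OF _ assms(2)])
       (auto intro!: derivative_eq_intros)
  then show ?thesis by (simp add: has_vector_derivative_def linear_cmul[OF assms(1)])
qed

text \<open>Integrate the derivative of \<open>f\<close> along the segment from \<open>p\<close> to
  \<open>x\<close>. A derivation at \<open>p\<close> kills the constant term and evaluates each
  \<open>g i\<close> at \<open>p\<close>, which is how derivations come to be determined by
  coordinates.\<close>

lemma hadamard_expansion: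
  fixes f :: "real^'n \<Rightarrow> real"
  assumes S: "open S" "convex S" "p \<in> S" and f: "smooth_on S f"
  obtains g where "\<And>i. smooth_on S (g i)" "\<And>i. g i p = frechet_derivative f (at p) (axis i 1)"
    "\<And>x. x \<in> S \<Longrightarrow> f x = f p + (\<Sum>i\<in>UNIV. (x $ i - p $ i) * g i x)"
proof -
  define D where "D i y = frechet_derivative f (at y) (axis i 1)" for i y
  \<comment> \<open>The factor \<open>t ^ 0\<close> fits the shape of
    \<open>Ck_on_ray_integral\<close>.\<close>
  define g where "g i x = integral {0..1} (\<lambda>t. t ^ 0 * D i (p + t *\<^sub>R (x - p)))" for i x
  have D: "smooth_on S (D i)" for i
    unfolding D_def by (rule smooth_on_frechet_derivative[OF f])
  have "smooth_on S (g i)" for i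
    using D[of i] unfolding smooth_on_def g_def by (intro allI Ck_on_ray_integral S) simp
  moreover have "g i p = frechet_derivative f (at p) (axis i 1)" for i
    by (simp add: g_def D_def)
  moreover have "f x = f p + (\<Sum>i\<in>UNIV. (x $ i - p $ i) * g i x)" if x: "x \<in> S" for x
  proof -
    have lin: "linear (frechet_derivative f (at y))" if "y \<in> S" for y
      using smooth_on_has_derivative[OF f that] by (rule has_derivative_linear)
    have "((\<lambda>t. frechet_derivative f (at (p + t *\<^sub>R (x - p))) (x - p)) has_integral
        f (p + 1 *\<^sub>R (x - p)) - f (p + 0 *\<^sub>R (x - p))) {0..1}"
    proof (rule fundamental_theorem_of_calculus)
      fix t :: real assume "t \<in> {0..1}"
      then have y: "p + t *\<^sub>R (x - p) \<in> S" by (intro ray_mem S x) auto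
      show "((\<lambda>t. f (p + t *\<^sub>R (x - p))) has_vector_derivative
          frechet_derivative f (at (p + t *\<^sub>R (x - p))) (x - p)) (at t within {0..1})"
        by (rule has_vector_derivative_ray[OF lin[OF y] smooth_on_has_derivative[OF f y]])
    qed simp
    then have "((\<lambda>t. \<Sum>i\<in>UNIV. (x $ i - p $ i) * D i (p + t *\<^sub>R (x - p))) has_integral f x - f p) {0..1}"
    proof (rule has_integral_eq_rhs[OF has_integral_eq, rotated])
      fix t :: real assume "t \<in> {0..1}"
      then have "p + t *\<^sub>R (x - p) \<in> S" by (intro ray_mem S x) auto
      from linear_vec_expansion[OF lin[OF this], of "x - p"]
      show "frechet_derivative f (at (p + t *\<^sub>R (x - p))) (x - p) =
        (\<Sum>i\<in>UNIV. (x $ i - p $ i) * D i (p + t *\<^sub>R (x - p)))"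
        by (simp add: D_def)
    qed simp
    moreover have "((\<lambda>t. \<Sum>i\<in>UNIV. (x $ i - p $ i) * D i (p + t *\<^sub>R (x - p))) has_integral
        (\<Sum>i\<in>UNIV. (x $ i - p $ i) * g i x)) {0..1}"
      unfolding g_def
      by (intro has_integral_sum has_integral_mult_right finite, simp, intro integrable_integral
          integrable_continuous_real continuous_on_ray[OF S(2,3) x] smooth_on_imp_continuous_on[OF D])
    ultimately have "f x - f p = (\<Sum>i\<in>UNIV. (x $ i - p $ i) * g i x)"
      by (rule has_integral_unique)
    then show ?thesis by simp
  qed
  ultimately show thesis by (rule that)
qed

text \<open>\<open>F\<close> is the line integral of the one-form \<open>w\<close> along the segment
  from \<open>p\<close>. After differentiation under the integral sign, closedness turns the
  integrand into the t-derivative of t times the value of \<open>w\<close> at p + t (x - p), paired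
  with \<open>v\<close>.\<close>

lemma poincare_primitive:
  fixes w :: "'n \<Rightarrow> real^'n \<Rightarrow> real"
  assumes S: "open S" "convex S" "p \<in> S" and w: "\<And>i. smooth_on S (w i)"
    and closed: "\<And>x i j. x \<in> S \<Longrightarrow>
      frechet_derivative (w i) (at x) (axis j 1) = frechet_derivative (w j) (at x) (axis i 1)"
  obtains F where "smooth_on S F"
    "\<And>x. x \<in> S \<Longrightarrow> (F has_derivative (\<lambda>v. \<Sum>i\<in>UNIV. v $ i * w i x)) (at x)"
proof -
  define W where "W i x = integral {0..1} (\<lambda>t. t ^ 0 * w i (p + t *\<^sub>R (x - p)))" for i x
  define F where "F x = (\<Sum>i\<in>UNIV. (x $ i - p $ i) * W i x)" for x
  have W: "Ck_on n (W i) S" for i n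
    using w[of i] unfolding smooth_on_def W_def by (intro allI Ck_on_ray_integral S) simp
  have "smooth_on S F"
    unfolding smooth_on_def F_def
    by (intro allI Ck_on_sum Ck_on_mult Ck_on_diff W S Ck_on_const
        Ck_on_bounded_linear_id bounded_linear_vec_nth)
  moreover have "(F has_derivative (\<lambda>v. \<Sum>i\<in>UNIV. v $ i * w i x)) (at x)" if x: "x \<in> S" for x
  proof -
    let ?D = "\<lambda>i y. frechet_derivative (w i) (at y)" and ?r = "\<lambda>t. p + t *\<^sub>R (x - p)"
    have lin: "linear (?D i y)" if "y \<in> S" for y i
      using smooth_on_has_derivative[OF w that] by (rule has_derivative_linear)
    have cw: "Ck_on (Suc 0) (w i) S" for i by (rule smooth_onD[OF w])
    have cD: "continuous_on {0..1} (\<lambda>t. ?D i (?r t) v)" for i v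
      using continuous_on_ray[OF S(2,3) x smooth_on_imp_continuous_on[OF smooth_on_frechet_derivative[OF w]]] .
    have cw': "continuous_on {0..1} (\<lambda>t. w i (?r t))" for i
      using continuous_on_ray[OF S(2,3) x smooth_on_imp_continuous_on[OF w]] .
    have "((\<lambda>x. W i x) has_derivative (\<lambda>v. integral {0..1} (\<lambda>t. t ^ Suc 0 * ?D i (?r t) v))) (at x)" for i
      unfolding W_def by (rule has_derivative_ray_integral[OF S cw x])
    then have "(F has_derivative (\<lambda>v. \<Sum>i\<in>UNIV. (x $ i - p $ i) * integral {0..1} (\<lambda>t. t ^ Suc 0 * ?D i (?r t) v)
        + v $ i * W i x)) (at x)"
      unfolding F_def
      by (auto intro!: derivative_eq_intros bounded_linear.has_derivative[OF bounded_linear_vec_nth])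
    moreover have "(\<Sum>i\<in>UNIV. (x $ i - p $ i) * integral {0..1} (\<lambda>t. t ^ Suc 0 * ?D i (?r t) v)
        + v $ i * W i x) = (\<Sum>i\<in>UNIV. v $ i * w i x)" for v
    proof -
      have A: "((\<lambda>t. \<Sum>i\<in>UNIV. (x $ i - p $ i) * (t * ?D i (?r t) v) + v $ i * w i (?r t)) has_integral
        (\<Sum>i\<in>UNIV. (x $ i - p $ i) * integral {0..1} (\<lambda>t. t * ?D i (?r t) v) + v $ i * W i x)) {0..1}"
        unfolding W_def
        by (intro has_integral_sum has_integral_add has_integral_mult_right integrable_integral
          integrable_continuous_real continuous_intros cD finite) (simp, intro integrable_integral
          integrable_continuous_real cw')
      have B: "((\<lambda>t. \<Sum>j\<in>UNIV. v $ j * (t * ?D j (?r t) (x - p) + w j (?r t))) has_integral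
          (\<Sum>j\<in>UNIV. v $ j * w j x)) {0..1}"
      proof (intro has_integral_sum has_integral_mult_right finite)
        fix j
        have "((\<lambda>t. t * w j (?r t)) has_vector_derivative (t * ?D j (?r t) (x - p) + w j (?r t))) (at t within {0..1})"
          if "t \<in> {0..1}" for t
        proof -
          have "?r t \<in> S" using that by (intro ray_mem S x) auto
          then have "((\<lambda>t. w j (?r t)) has_vector_derivative ?D j (?r t) (x - p)) (at t within {0..1})"
            by (intro has_vector_derivative_ray lin smooth_on_has_derivative[OF w])
          then show ?thesis
            by (auto intro!: derivative_eq_intros simp flip: has_real_derivative_iff_has_vector_derivative)
        qed
        then have "((\<lambda>t. t * ?D j (?r t) (x - p) + w j (?r t)) has_integral 1 * w j (?r 1) - 0 * w j (?r 0)) {0..1}"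
          by (intro fundamental_theorem_of_calculus) auto
        then show "((\<lambda>t. t * ?D j (?r t) (x - p) + w j (?r t)) has_integral w j x) {0..1}" by simp
      qed
      \<comment> \<open>\<open>closed\<close> exchanges the direction of differentiation with the
        index of the form, so that \<open>x - p\<close> becomes the direction of differentiation, as
        in \<open>B\<close>.\<close>
      have C: "(\<Sum>i\<in>UNIV. (x $ i - p $ i) * (t * ?D i (?r t) v) + v $ i * w i (?r t)) =
          (\<Sum>j\<in>UNIV. v $ j * (t * ?D j (?r t) (x - p) + w j (?r t)))" if "t \<in> {0..1}" for t
      proof -
        have r: "?r t \<in> S" using that by (intro ray_mem S x) auto
        have "(\<Sum>i\<in>UNIV. (x $ i - p $ i) * ?D i (?r t) v) =
            (\<Sum>i\<in>UNIV. \<Sum>j\<in>UNIV. (x $ i - p $ i) * (v $ j * ?D i (?r t) (axis j 1)))"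
          by (subst linear_vec_expansion[OF lin[OF r], of _ v]) (simp add: sum_distrib_left)
        also have "\<dots> = (\<Sum>j\<in>UNIV. \<Sum>i\<in>UNIV. (x $ i - p $ i) * (v $ j * ?D i (?r t) (axis j 1)))"
          by (rule sum.swap)
        also have "\<dots> = (\<Sum>j\<in>UNIV. v $ j * ?D j (?r t) (x - p))"
          by (subst linear_vec_expansion[OF lin[OF r], of _ "x - p"])
             (simp add: sum_distrib_left closed[OF r] mult_ac)
        finally have e: "(\<Sum>i\<in>UNIV. (x $ i - p $ i) * ?D i (?r t) v) = (\<Sum>j\<in>UNIV. v $ j * ?D j (?r t) (x - p))" .
        have "(\<Sum>i\<in>UNIV. (x $ i - p $ i) * (t * ?D i (?r t) v) + v $ i * w i (?r t)) =
            t * (\<Sum>i\<in>UNIV. (x $ i - p $ i) * ?D i (?r t) v) + (\<Sum>i\<in>UNIV. v $ i * w i (?r t))"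
          by (simp add: sum.distrib sum_distrib_left mult.left_commute)
        also have "\<dots> = (\<Sum>j\<in>UNIV. v $ j * (t * ?D j (?r t) (x - p) + w j (?r t)))"
          unfolding e by (simp add: sum.distrib sum_distrib_left distrib_left mult.left_commute)
        finally show ?thesis .
      qed
      show ?thesis
        using has_integral_unique[OF has_integral_eq[OF C A] B] by simp
    qed
    ultimately show ?thesis by simp
  qed
  ultimately show thesis by (rule that)
qed


section \<open>Smooth functions, smooth maps and tangent vectors\<close>

lemma Ck_on_euclideanI:
  fixes f :: "'e::euclidean_space \<Rightarrow> 'f::euclidean_space"
  assumes "open S" "\<And>b. b \<in> Basis \<Longrightarrow> Ck_on n (\<lambda>x. f x \<bullet> b) S"
  shows "Ck_on n f S"
proof -
  have "Ck_on n (\<lambda>x. \<Sum>b\<in>Basis. (f x \<bullet> b) *\<^sub>R b) S"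
    by (intro Ck_on_sum Ck_on_bounded_linear[OF _ bounded_linear_scaleR_left] assms)
  then show ?thesis by (simp add: euclidean_representation)
qed

locale smooth_mfld =
  fixes M :: "('a, 'e::euclidean_space) manifold"
  assumes smooth: "smooth_manifold M"
begin

lemma ex_chart:
  assumes "p \<in> topspace (mtop M)" obtains U \<phi> where "(U, \<phi>) \<in> atlas M" "p \<in> U"
  using smooth assms unfolding smooth_manifold_def by auto

context
  fixes U \<phi>
  assumes chart: "(U, \<phi>) \<in> atlas M"
begin

lemma chart_openin: "openin (mtop M) U"
  and chart_open: "open (\<phi> ` U)"
  and chart_homeomorphic: "homeomorphic_map (subtopology (mtop M) U) (top_of_set (\<phi> ` U)) \<phi>"
  using smooth chart unfolding smooth_manifold_def by auto

lemma chart_subset: "U \<subseteq> topspace (mtop M)"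
  by (rule openin_subset[OF chart_openin])

lemma chart_inj: "inj_on \<phi> U"
  using homeomorphic_imp_injective_map[OF chart_homeomorphic] chart_subset
  by (simp add: inf_absorb2)

lemma chart_inv [simp]: "p \<in> U \<Longrightarrow> inv_into U \<phi> (\<phi> p) = p"
  by (rule inv_into_f_f[OF chart_inj])

lemma chart_image_open:
  assumes "openin (mtop M) W" shows "open (\<phi> ` (U \<inter> W))"
proof -
  have "openin (top_of_set (\<phi> ` U)) (\<phi> ` (U \<inter> W))"
    using homeomorphic_imp_open_map[OF chart_homeomorphic] assms
    unfolding open_map_def by (auto simp: openin_subtopology_Int2)
  then show ?thesis using chart_open openin_open_eq by blast
qed

lemma chart_vimage_openin:
  assumes "open O'" shows "openin (mtop M) {p \<in> U. \<phi> p \<in> O'}"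
proof -
  have "continuous_map (subtopology (mtop M) U) euclidean \<phi>"
    using homeomorphic_imp_continuous_map[OF chart_homeomorphic] continuous_map_into_fulltopology
    by blast
  then have "openin (subtopology (mtop M) U) {p \<in> topspace (subtopology (mtop M) U). \<phi> p \<in> O'}"
    using openin_continuous_map_preimage assms by fastforce
  moreover have "{p \<in> topspace (subtopology (mtop M) U). \<phi> p \<in> O'} = {p \<in> U. \<phi> p \<in> O'}"
    using chart_subset by auto
  ultimately show ?thesis using openin_trans_full[OF _ chart_openin] by simp
qed

lemma chart_inv_continuous: "continuous_map (top_of_set (\<phi> ` U)) (mtop M) (inv_into U \<phi>)"
  unfolding continuous_map
proof (intro conjI allI impI)
  show "inv_into U \<phi> ` topspace (top_of_set (\<phi> ` U)) \<subseteq> topspace (mtop M)"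
    using chart_subset by auto
  fix W assume W: "openin (mtop M) W"
  have "{x \<in> topspace (top_of_set (\<phi> ` U)). inv_into U \<phi> x \<in> W} = \<phi> ` (U \<inter> W)" by auto
  then show "openin (top_of_set (\<phi> ` U)) {x \<in> topspace (top_of_set (\<phi> ` U)). inv_into U \<phi> x \<in> W}"
    using chart_image_open[OF W] chart_open by (simp add: openin_open_eq) auto
qed

end

lemma chart_transition:
  assumes "(U, \<phi>) \<in> atlas M" "(V, \<psi>) \<in> atlas M"
  shows "smooth_on (\<phi> ` (U \<inter> V)) (\<lambda>x. \<psi> (inv_into U \<phi> x))"
  using smooth assms unfolding smooth_manifold_def by fast

lemma smooth_fun_on_openin: "smooth_fun_on M W f \<Longrightarrow> openin (mtop M) W"
  by (simp add: smooth_fun_on_def)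

lemma smooth_fun_on_subset:
  "smooth_fun_on M W f \<Longrightarrow> openin (mtop M) V \<Longrightarrow> V \<subseteq> W \<Longrightarrow> smooth_fun_on M V f"
  unfolding smooth_fun_on_def smooth_on_def
  by (auto 4 3 intro: Ck_on_subset)

lemma smooth_near_topspace: "smooth_near M p f \<Longrightarrow> p \<in> topspace (mtop M)"
  unfolding smooth_near_def smooth_fun_on_def using openin_subset by blast

text \<open>\<open>smooth_fun_on\<close> quantifies over all charts of the atlas; smooth transition
  maps carry a test in one chart to the others.\<close>

lemma smooth_near_chartI:
  assumes c: "(U, \<phi>) \<in> atlas M" and p: "p \<in> U" and O': "open O'" "\<phi> p \<in> O'"
    and f: "smooth_on (O' \<inter> \<phi> ` U) (\<lambda>x. f (inv_into U \<phi> x))"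
  shows "smooth_near M p f"
proof -
  define W where "W = {q \<in> U. \<phi> q \<in> O'}"
  have W: "openin (mtop M) W" unfolding W_def by (rule chart_vimage_openin[OF c O'(1)])
  have "smooth_on (\<psi> ` (V \<inter> W)) (\<lambda>x. f (inv_into V \<psi> x))" if d: "(V, \<psi>) \<in> atlas M" for V \<psi>
    unfolding smooth_on_def
  proof
    fix n
    have S: "open (\<psi> ` (V \<inter> W))" by (rule chart_image_open[OF d W])
    have g: "Ck_on n (\<lambda>x. \<phi> (inv_into V \<psi> x)) (\<psi> ` (V \<inter> W))"
      using chart_transition[OF d c] unfolding smooth_on_def W_def by (auto intro: Ck_on_subset)
    have "Ck_on n (\<lambda>x. f (inv_into U \<phi> (\<phi> (inv_into V \<psi> x)))) (\<psi> ` (V \<inter> W))"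
    proof (rule Ck_on_compose[OF S _ smooth_onD[OF f] g])
      show "(\<lambda>x. \<phi> (inv_into V \<psi> x)) ` \<psi> ` (V \<inter> W) \<subseteq> O' \<inter> \<phi> ` U"
        using chart_inv[OF d] by (auto simp: W_def)
    qed
    then show "Ck_on n (\<lambda>x. f (inv_into V \<psi> x)) (\<psi> ` (V \<inter> W))"
      by (rule Ck_on_cong[OF S, rotated]) (auto simp: W_def chart_inv[OF c] chart_inv[OF d])
  qed
  then have "smooth_fun_on M W f" using W by (auto simp: smooth_fun_on_def)
  then show ?thesis using p O' unfolding smooth_near_def W_def by (intro exI[of _ "{q \<in> U. \<phi> q \<in> O'}"]) auto
qed

lemma smooth_near_chartD:
  assumes c: "(U, \<phi>) \<in> atlas M" and p: "p \<in> U" and f: "smooth_near M p f"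
  obtains O' where "open O'" "\<phi> p \<in> O'" "O' \<subseteq> \<phi> ` U" "smooth_on O' (\<lambda>x. f (inv_into U \<phi> x))"
proof -
  obtain W where "p \<in> W" "smooth_fun_on M W f" using f unfolding smooth_near_def by blast
  then show thesis
    using that[of "\<phi> ` (U \<inter> W)"] c p chart_image_open[OF c] by (auto simp: smooth_fun_on_def)
qed

lemma smooth_fun_on_iff:
  "smooth_fun_on M W f \<longleftrightarrow> openin (mtop M) W \<and> (\<forall>p\<in>W. smooth_near M p f)"
proof safe
  assume W: "openin (mtop M) W" and f: "\<forall>p\<in>W. smooth_near M p f"
  have "Ck_on n (\<lambda>x. f (inv_into U \<phi> x)) (\<phi> ` (U \<inter> W))" if c: "(U, \<phi>) \<in> atlas M" for U \<phi> n
  proof (rule Ck_on_local)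
    fix x assume "x \<in> \<phi> ` (U \<inter> W)"
    then obtain p where p: "p \<in> U" "p \<in> W" "x = \<phi> p" by auto
    with f have "smooth_near M p f" by simp
    from smooth_near_chartD[OF c p(1) this]
    show "\<exists>T. open T \<and> x \<in> T \<and> Ck_on n (\<lambda>x. f (inv_into U \<phi> x)) T"
      unfolding p(3) using smooth_onD by metis
  qed
  then show "smooth_fun_on M W f" using W by (auto simp: smooth_fun_on_def smooth_on_def)
qed (auto simp: smooth_fun_on_def smooth_near_def)

lemma smooth_near_cong:
  assumes W: "openin (mtop M) W" "p \<in> W" "\<And>q. q \<in> W \<Longrightarrow> f q = g q" and f: "smooth_near M p f"
  shows "smooth_near M p g"
proof -
  obtain V where V: "p \<in> V" "smooth_fun_on M V f" using f unfolding smooth_near_def by blast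
  then have VW: "smooth_fun_on M (V \<inter> W) f"
    by (intro smooth_fun_on_subset[OF V(2)] openin_Int W(1) smooth_fun_on_openin[OF V(2)]) auto
  have "Ck_on n (\<lambda>x. g (inv_into U \<phi> x)) (\<phi> ` (U \<inter> (V \<inter> W)))" if c: "(U, \<phi>) \<in> atlas M" for U \<phi> n
  proof (rule Ck_on_cong[of _ "\<lambda>x. f (inv_into U \<phi> x)"])
    show "open (\<phi> ` (U \<inter> (V \<inter> W)))" by (rule chart_image_open[OF c smooth_fun_on_openin[OF VW]])
    show "Ck_on n (\<lambda>x. f (inv_into U \<phi> x)) (\<phi> ` (U \<inter> (V \<inter> W)))"
      using VW c unfolding smooth_fun_on_def smooth_on_def by fast
  qed (use W chart_inv[OF c] in auto)
  then have "smooth_fun_on M (V \<inter> W) g"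
    using smooth_fun_on_openin[OF VW] by (auto simp: smooth_fun_on_def smooth_on_def)
  then show ?thesis using V W by (auto simp: smooth_near_def)
qed

text \<open>One argument for all pointwise operations that preserve \<open>Ck_on\<close>:
  \<open>H\<close> is instantiated by addition, by multiplication and, ignoring its second argument,
  by composition with a smooth function.\<close>

lemma smooth_near_lift2:
  assumes H: "\<And>n S F G. open S \<Longrightarrow> Ck_on n F S \<Longrightarrow> Ck_on n G S \<Longrightarrow> Ck_on n (\<lambda>x::'e. H (F x) (G x) :: real) S"
    and f: "smooth_near M p f" and g: "smooth_near M p g"
  shows "smooth_near M p (\<lambda>q. H (f q) (g q))"
proof -
  obtain U \<phi> where c: "(U, \<phi>) \<in> atlas M" "p \<in> U" using ex_chart smooth_near_topspace[OF f] by blast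
  obtain O1 where O1: "open O1" "\<phi> p \<in> O1" "O1 \<subseteq> \<phi> ` U" "smooth_on O1 (\<lambda>x. f (inv_into U \<phi> x))"
    using smooth_near_chartD[OF c f] .
  obtain O2 where O2: "open O2" "\<phi> p \<in> O2" "O2 \<subseteq> \<phi> ` U" "smooth_on O2 (\<lambda>x. g (inv_into U \<phi> x))"
    using smooth_near_chartD[OF c g] .
  have e: "O1 \<inter> O2 \<inter> \<phi> ` U = O1 \<inter> O2" using O1 by auto
  have "Ck_on n (\<lambda>x. H (f (inv_into U \<phi> x)) (g (inv_into U \<phi> x))) (O1 \<inter> O2)" for n
    using smooth_onD[OF O1(4)] smooth_onD[OF O2(4)] O1 O2
    by (intro H) (auto intro: Ck_on_subset)
  then show ?thesis
    using O1 O2 by (intro smooth_near_chartI[OF c, of "O1 \<inter> O2"]) (auto simp: e smooth_on_def)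
qed

lemma smooth_near_add:
  "smooth_near M p f \<Longrightarrow> smooth_near M p g \<Longrightarrow> smooth_near M p (\<lambda>q. f q + g q)"
  by (rule smooth_near_lift2) (rule Ck_on_add)

lemma smooth_near_mult:
  "smooth_near M p f \<Longrightarrow> smooth_near M p g \<Longrightarrow> smooth_near M p (\<lambda>q. f q * g q)"
  by (rule smooth_near_lift2) (rule Ck_on_mult)

lemma smooth_near_const:
  assumes "p \<in> topspace (mtop M)" shows "smooth_near M p (\<lambda>q. k)"
proof -
  obtain U \<phi> where c: "(U, \<phi>) \<in> atlas M" "p \<in> U" using ex_chart[OF assms] .
  show ?thesis
    by (rule smooth_near_chartI[OF c open_UNIV UNIV_I]) (simp add: smooth_on_def Ck_on_const)
qed

lemma smooth_near_compose:
  assumes "smooth_on UNIV (h :: real \<Rightarrow> real)" "smooth_near M p f"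
  shows "smooth_near M p (\<lambda>q. h (f q))"
  by (rule smooth_near_lift2[where H="\<lambda>x y. h x", OF _ assms(2) assms(2)])
     (rule Ck_on_compose[OF _ _ smooth_onD[OF assms(1)]], auto)

lemma smooth_near_lin:
  assumes "smooth_near M p f" "smooth_near M p g"
  shows "smooth_near M p (\<lambda>q. a * f q + b * g q)"
  by (intro smooth_near_add smooth_near_mult smooth_near_const smooth_near_topspace[OF assms(1)] assms)

lemma smooth_near_cmult: "smooth_near M p f \<Longrightarrow> smooth_near M p (\<lambda>q. a * f q)"
  using smooth_near_lin[of p f f a 0] by simp

lemma smooth_near_diff:
  assumes "smooth_near M p f" "smooth_near M p g"
  shows "smooth_near M p (\<lambda>q. f q - g q)"
  using smooth_near_lin[OF assms, of 1 "-1"] by simp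

lemma smooth_near_sum:
  assumes "p \<in> topspace (mtop M)" "\<And>i. i \<in> I \<Longrightarrow> smooth_near M p (f i)"
  shows "smooth_near M p (\<lambda>q. \<Sum>i\<in>I. f i q)"
  using assms(2)
  by (induction I rule: infinite_finite_induct) (auto intro: smooth_near_const assms(1) smooth_near_add)

lemma smooth_near_chart:
  assumes c: "(U, \<phi>) \<in> atlas M" and p: "p \<in> U" and h: "open O'" "\<phi> p \<in> O'" "smooth_on O' (h :: 'e \<Rightarrow> real)"
  shows "smooth_near M p (\<lambda>q. h (\<phi> q))"
proof (rule smooth_near_chartI[OF c p h(1,2)])
  show "smooth_on (O' \<inter> \<phi> ` U) (\<lambda>x. h (\<phi> (inv_into U \<phi> x)))"
    unfolding smooth_on_def
  proof
    fix n
    show "Ck_on n (\<lambda>x. h (\<phi> (inv_into U \<phi> x))) (O' \<inter> \<phi> ` U)"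
      by (rule Ck_on_cong[of _ h])
         (auto simp: h chart_open[OF c] f_inv_into_f intro: Ck_on_subset[OF smooth_onD[OF h(3)]])
  qed
qed

lemma smooth_near_coord:
  assumes c: "(U, \<phi>) \<in> atlas M" and p: "p \<in> U" and L: "bounded_linear (L :: 'e \<Rightarrow> real)"
  shows "smooth_near M p (\<lambda>q. L (\<phi> q))"
  by (rule smooth_near_chart[OF c p, of UNIV]) (auto simp: smooth_on_def intro: Ck_on_bounded_linear_id L)

section \<open>Tangent vectors as derivations on germs\<close>

lemma tangent_const:
  assumes p: "p \<in> topspace (mtop M)" and v: "v \<in> tangent_space M p"
  shows "v (\<lambda>q. k) = 0"
proof -
  have 1: "smooth_near M p (\<lambda>q. 1)" by (rule smooth_near_const[OF p])
  have "v (\<lambda>q. 1 * 1) = 1 * v (\<lambda>q. 1) + 1 * v (\<lambda>q. 1)"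
    using v 1 unfolding tangent_space_def by blast
  then have "v (\<lambda>q. 1) = 0" by simp
  moreover have "v (\<lambda>q. k * 1 + 0 * 1) = k * v (\<lambda>q. 1) + 0 * v (\<lambda>q. 1)"
    using v 1 unfolding tangent_space_def by blast
  ultimately show ?thesis by simp
qed

lemma tangent_lin:
  "v \<in> tangent_space M p \<Longrightarrow> smooth_near M p f \<Longrightarrow> smooth_near M p g \<Longrightarrow>
    v (\<lambda>q. a * f q + b * g q) = a * v f + b * v g"
  unfolding tangent_space_def by blast

lemma tangent_mult:
  "v \<in> tangent_space M p \<Longrightarrow> smooth_near M p f \<Longrightarrow> smooth_near M p g \<Longrightarrow>
    v (\<lambda>q. f q * g q) = f p * v g + g p * v f"
  unfolding tangent_space_def by blast

lemma tangent_not_smooth: "v \<in> tangent_space M p \<Longrightarrow> \<not> smooth_near M p f \<Longrightarrow> v f = 0"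
  unfolding tangent_space_def by blast

lemma tangent_add:
  "v \<in> tangent_space M p \<Longrightarrow> smooth_near M p f \<Longrightarrow> smooth_near M p g \<Longrightarrow> v (\<lambda>q. f q + g q) = v f + v g"
  using tangent_lin[of v p f g 1 1] by simp

lemma tangent_diff:
  "v \<in> tangent_space M p \<Longrightarrow> smooth_near M p f \<Longrightarrow> smooth_near M p g \<Longrightarrow> v (\<lambda>q. f q - g q) = v f - v g"
  using tangent_lin[of v p f g 1 "-1"] by simp

lemma tangent_cmult:
  "v \<in> tangent_space M p \<Longrightarrow> smooth_near M p f \<Longrightarrow> v (\<lambda>q. a * f q) = a * v f"
  using tangent_lin[of v p f f a 0] by simp

lemma tangent_sum:
  assumes "p \<in> topspace (mtop M)" "v \<in> tangent_space M p" "\<And>i. i \<in> I \<Longrightarrow> smooth_near M p (f i)"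
  shows "v (\<lambda>q. \<Sum>i\<in>I. f i q) = (\<Sum>i\<in>I. v (f i))"
  using assms(3)
proof (induction I rule: infinite_finite_induct)
  case (insert i I)
  have "v (\<lambda>q. f i q + (\<Sum>i\<in>I. f i q)) = v (f i) + v (\<lambda>q. \<Sum>i\<in>I. f i q)"
    by (rule tangent_add[OF assms(2)]) (auto intro: smooth_near_sum assms(1) insert.prems)
  then show ?case using insert by simp
qed (auto simp: tangent_const[OF assms(1,2)])

lemma tangent_cong:
  assumes W: "openin (mtop M) W" "p \<in> W" "\<And>q. q \<in> W \<Longrightarrow> f q = g q" and v: "v \<in> tangent_space M p"
  shows "v f = v g"
proof (cases "smooth_near M p f")
  case True
  have g: "smooth_near M p g" by (rule smooth_near_cong[OF W True])
  \<comment> \<open>Multiplication by \<open>u\<close> does not change \<open>f - g\<close>, and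
    both factors vanish at \<open>p\<close>, so the Leibniz rule gives the value 0.\<close>
  define u :: "'a \<Rightarrow> real" where "u q = (if q \<in> W then 0 else 1)" for q
  have p: "p \<in> topspace (mtop M)" using W openin_subset by blast
  have u: "smooth_near M p u"
    by (rule smooth_near_cong[OF W(1,2) _ smooth_near_const[OF p, of 0]]) (simp add: u_def)
  have "(\<lambda>q. f q - g q) = (\<lambda>q. (f q - g q) * u q)" using W(3) by (auto simp: u_def)
  then have "v (\<lambda>q. f q - g q) = v (\<lambda>q. (f q - g q) * u q)" by simp
  also have "\<dots> = (f p - g p) * v u + u p * v (\<lambda>q. f q - g q)"
    by (rule tangent_mult[OF v smooth_near_diff[OF True g] u])
  also have "\<dots> = 0" using W by (simp add: u_def)
  finally show ?thesis using tangent_diff[OF v True g] by simp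
next
  case False
  then have "\<not> smooth_near M p g" using smooth_near_cong[OF W(1,2), of g f] W(3) by auto
  then show ?thesis using False tangent_not_smooth[OF v] by simp
qed

lemma tangent_lincomb:
  "u \<in> tangent_space M p \<Longrightarrow> v \<in> tangent_space M p \<Longrightarrow> (\<lambda>f. a * u f + b * v f) \<in> tangent_space M p"
  unfolding tangent_space_def by (auto simp: algebra_simps)

end

text \<open>Hadamard's lemma in the chart writes \<open>f\<close> near \<open>p\<close> as a
  constant plus products with factors vanishing at \<open>p\<close>; the Leibniz rule leaves only
  the values of \<open>v\<close> on the coordinate functions.\<close>

lemma tangent_coord:
  fixes M :: "('a, real^'n) manifold"
  assumes M: "smooth_manifold M" and c: "(U, \<phi>) \<in> atlas M" and p: "p \<in> U"
    and v: "v \<in> tangent_space M p" and f: "smooth_near M p f"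
  shows "v f = (\<Sum>i\<in>UNIV. v (\<lambda>q. \<phi> q $ i) *
    frechet_derivative (\<lambda>x. f (inv_into U \<phi> x)) (at (\<phi> p)) (axis i 1))"
proof -
  interpret smooth_mfld M by standard (rule M)
  obtain O' where O': "open O'" "\<phi> p \<in> O'" "O' \<subseteq> \<phi> ` U" "smooth_on O' (\<lambda>x. f (inv_into U \<phi> x))"
    using smooth_near_chartD[OF c p f] .
  obtain e where e: "e > 0" "ball (\<phi> p) e \<subseteq> O'" using O' openE by blast
  let ?B = "ball (\<phi> p) e" and ?f = "\<lambda>x. f (inv_into U \<phi> x)"
  have top: "p \<in> topspace (mtop M)" using p chart_subset[OF c] by auto
  have sB: "smooth_on ?B ?f"
    using O'(4) e unfolding smooth_on_def by (auto intro: Ck_on_subset)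
  obtain g where g: "\<And>i. smooth_on ?B (g i)" "\<And>i. g i (\<phi> p) = frechet_derivative ?f (at (\<phi> p)) (axis i 1)"
    "\<And>x. x \<in> ?B \<Longrightarrow> ?f x = ?f (\<phi> p) + (\<Sum>i\<in>UNIV. (x $ i - \<phi> p $ i) * g i x)"
    using hadamard_expansion[OF open_ball convex_ball _ sB, of "\<phi> p"] e(1) by auto
  have co: "smooth_near M p (\<lambda>q. \<phi> q $ i)" for i
    by (rule smooth_near_coord[OF c p bounded_linear_vec_nth])
  have h: "smooth_near M p (\<lambda>q. \<phi> q $ i - \<phi> p $ i)" for i
    by (rule smooth_near_diff[OF co smooth_near_const[OF top]])
  have k: "smooth_near M p (\<lambda>q. g i (\<phi> q))" for i
    by (rule smooth_near_chart[OF c p open_ball _ g(1)]) (use e in auto)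
  have "v f = v (\<lambda>q. f p + (\<Sum>i\<in>UNIV. (\<phi> q $ i - \<phi> p $ i) * g i (\<phi> q)))"
  proof (rule tangent_cong[OF chart_vimage_openin[OF c open_ball] _ _ v])
    show "p \<in> {q \<in> U. \<phi> q \<in> ?B}" using p e by auto
    show "f q = f p + (\<Sum>i\<in>UNIV. (\<phi> q $ i - \<phi> p $ i) * g i (\<phi> q))" if "q \<in> {q \<in> U. \<phi> q \<in> ?B}" for q
      using g(3)[of "\<phi> q"] that p chart_inv[OF c] by simp
  qed
  also have "\<dots> = v (\<lambda>q. f p) + v (\<lambda>q. \<Sum>i\<in>UNIV. (\<phi> q $ i - \<phi> p $ i) * g i (\<phi> q))"
    by (intro tangent_add[OF v] smooth_near_sum[OF top] smooth_near_mult h k smooth_near_const[OF top])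
  also have "\<dots> = (\<Sum>i\<in>UNIV. v (\<lambda>q. (\<phi> q $ i - \<phi> p $ i) * g i (\<phi> q)))"
    by (simp add: tangent_const[OF top v])
       (intro tangent_sum[OF top v] smooth_near_mult h k)
  also have "\<dots> = (\<Sum>i\<in>UNIV. v (\<lambda>q. \<phi> q $ i) * g i (\<phi> p))"
  proof (rule sum.cong[OF refl])
    fix i
    have "v (\<lambda>q. (\<phi> q $ i - \<phi> p $ i) * g i (\<phi> q)) =
        (\<phi> p $ i - \<phi> p $ i) * v (\<lambda>q. g i (\<phi> q)) + g i (\<phi> p) * v (\<lambda>q. \<phi> q $ i - \<phi> p $ i)"
      by (rule tangent_mult[OF v h k])
    also have "v (\<lambda>q. \<phi> q $ i - \<phi> p $ i) = v (\<lambda>q. \<phi> q $ i)"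
      using tangent_diff[OF v co smooth_near_const[OF top]] tangent_const[OF top v] by simp
    finally show "v (\<lambda>q. (\<phi> q $ i - \<phi> p $ i) * g i (\<phi> q)) = v (\<lambda>q. \<phi> q $ i) * g i (\<phi> p)" by simp
  qed
  finally show ?thesis unfolding g(2) .
qed

text \<open>A description of smooth maps without charts, from which composition and pushforward
  follow easily. For the direction towards \<open>smooth_map\<close> the pullback condition is
  applied to the coordinate functions of a chart of \<open>N\<close>.\<close>

lemma smooth_map_iff:
  fixes M :: "('a, 'e::euclidean_space) manifold" and N :: "('b, 'f::euclidean_space) manifold"
  assumes M: "smooth_manifold M" and N: "smooth_manifold N"
  shows "smooth_map M N F \<longleftrightarrow> continuous_map (mtop M) (mtop N) F \<and>
    (\<forall>p\<in>topspace (mtop M). \<forall>f. smooth_near N (F p) f \<longrightarrow> smooth_near M p (\<lambda>q. f (F q)))"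
proof -
  interpret M: smooth_mfld M by standard (rule M)
  interpret N: smooth_mfld N by standard (rule N)
  have "smooth_near M p (\<lambda>q. f (F q))"
    if F: "smooth_map M N F" and p: "p \<in> topspace (mtop M)" and f: "smooth_near N (F p) f" for p f
  proof -
    obtain U \<phi> where c: "(U, \<phi>) \<in> atlas M" "p \<in> U" using M.ex_chart[OF p] .
    obtain V \<psi> where d: "(V, \<psi>) \<in> atlas N" "F p \<in> V" using N.ex_chart[OF N.smooth_near_topspace[OF f]] .
    obtain O' where O': "open O'" "\<psi> (F p) \<in> O'" "O' \<subseteq> \<psi> ` V" "smooth_on O' (\<lambda>x. f (inv_into V \<psi> x))"
      using N.smooth_near_chartD[OF d f] .
    define W where "W = {q \<in> topspace (mtop M). F q \<in> {r \<in> V. \<psi> r \<in> O'}}"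
    have W: "openin (mtop M) W" unfolding W_def
      using F openin_continuous_map_preimage N.chart_vimage_openin[OF d(1) O'(1)]
      unfolding smooth_map_def by blast
    let ?S = "\<phi> ` (U \<inter> W)"
    have S: "open ?S" by (rule M.chart_image_open[OF c(1) W])
    have "smooth_on ?S (\<lambda>x. f (F (inv_into U \<phi> x)))" unfolding smooth_on_def
    proof
      fix n
      have "Ck_on n (\<lambda>x. \<psi> (F (inv_into U \<phi> x))) (\<phi> ` {p \<in> U. F p \<in> V})"
        using F c d unfolding smooth_map_def smooth_on_def by fast
      then have g: "Ck_on n (\<lambda>x. \<psi> (F (inv_into U \<phi> x))) ?S"
        by (rule Ck_on_subset) (auto simp: W_def)
      have "Ck_on n (\<lambda>x. f (inv_into V \<psi> (\<psi> (F (inv_into U \<phi> x))))) ?S"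
        by (rule Ck_on_compose[OF S _ smooth_onD[OF O'(4)] g]) (auto simp: W_def M.chart_inv[OF c(1)])
      then show "Ck_on n (\<lambda>x. f (F (inv_into U \<phi> x))) ?S"
        by (rule Ck_on_cong[OF S, rotated]) (auto simp: W_def M.chart_inv[OF c(1)] N.chart_inv[OF d(1)])
    qed
    moreover have "?S \<inter> \<phi> ` U = ?S" by auto
    ultimately show ?thesis
      using c d p O' by (intro M.smooth_near_chartI[OF c S]) (auto simp: W_def)
  qed
  moreover have "smooth_map M N F" if F: "continuous_map (mtop M) (mtop N) F"
    and *: "\<And>p f. p \<in> topspace (mtop M) \<Longrightarrow> smooth_near N (F p) f \<Longrightarrow> smooth_near M p (\<lambda>q. f (F q))"
  proof -
    have "Ck_on n (\<lambda>x. \<psi> (F (inv_into U \<phi> x))) (\<phi> ` {p \<in> U. F p \<in> V})"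
      if c: "(U, \<phi>) \<in> atlas M" and d: "(V, \<psi>) \<in> atlas N" for U \<phi> V \<psi> n
    proof (rule Ck_on_euclideanI)
      have e: "{p \<in> U. F p \<in> V} = U \<inter> {p \<in> topspace (mtop M). F p \<in> V}"
        using M.chart_subset[OF c] by auto
      show "open (\<phi> ` {p \<in> U. F p \<in> V})" unfolding e
        by (intro M.chart_image_open[OF c] openin_continuous_map_preimage[OF F] N.chart_openin[OF d])
      fix b
      show "Ck_on n (\<lambda>x. \<psi> (F (inv_into U \<phi> x)) \<bullet> b) (\<phi> ` {p \<in> U. F p \<in> V})"
      proof (rule Ck_on_local)
        fix x assume "x \<in> \<phi> ` {p \<in> U. F p \<in> V}"
        then obtain p where p: "p \<in> U" "F p \<in> V" "x = \<phi> p" by auto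
        have "smooth_near N (F p) (\<lambda>r. \<psi> r \<bullet> b)"
          by (rule N.smooth_near_coord[OF d p(2) bounded_linear_inner_left])
        then have "smooth_near M p (\<lambda>q. \<psi> (F q) \<bullet> b)"
          using *[of p "\<lambda>r. \<psi> r \<bullet> b"] p M.chart_subset[OF c] by auto
        from M.smooth_near_chartD[OF c p(1) this] obtain O' where "open O'" "\<phi> p \<in> O'"
          "smooth_on O' (\<lambda>x. \<psi> (F (inv_into U \<phi> x)) \<bullet> b)" by metis
        then show "\<exists>T. open T \<and> x \<in> T \<and> Ck_on n (\<lambda>x. \<psi> (F (inv_into U \<phi> x)) \<bullet> b) T"
          unfolding p(3) using smooth_onD by metis
      qed
    qed
    then show ?thesis using F unfolding smooth_map_def smooth_on_def by auto
  qed
  ultimately show ?thesis unfolding smooth_map_def by blast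
qed

lemma smooth_map_pullback:
  assumes "smooth_manifold M" "smooth_manifold N" "smooth_map M N F" "p \<in> topspace (mtop M)"
    "smooth_near N (F p) f"
  shows "smooth_near M p (\<lambda>q. f (F q))"
  using smooth_map_iff[OF assms(1,2)] assms(3-5) by blast

lemma smooth_map_compose:
  assumes "smooth_manifold M" "smooth_manifold N" "smooth_manifold P" "smooth_map M N F" "smooth_map N P F'"
  shows "smooth_map M P (\<lambda>p. F' (F p))"
proof -
  have F: "continuous_map (mtop M) (mtop N) F" and F': "continuous_map (mtop N) (mtop P) F'"
    using assms(4,5) unfolding smooth_map_def by auto
  have "smooth_near M p (\<lambda>q. f (F' (F q)))"
    if "p \<in> topspace (mtop M)" "smooth_near P (F' (F p)) f" for p f
  proof -
    have "F p \<in> topspace (mtop N)" using that F unfolding continuous_map_def by auto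
    then have "smooth_near N (F p) (\<lambda>r. f (F' r))"
      using smooth_map_pullback[OF assms(2,3,5)] that by blast
    then show ?thesis
      using smooth_map_pullback[OF assms(1,2,4) that(1), of "\<lambda>r. f (F' r)"] by blast
  qed
  then show ?thesis
    unfolding smooth_map_iff[OF assms(1,3)] using continuous_map_compose[OF F F'] by (auto simp: o_def)
qed

lemma pushforward_tangent:
  assumes M: "smooth_manifold M" and N: "smooth_manifold N" and F: "smooth_map M N F"
    and p: "p \<in> topspace (mtop M)" and v: "v \<in> tangent_space M p"
  shows "pushforward N F p v \<in> tangent_space N (F p)"
proof -
  interpret M: smooth_mfld M by standard (rule M)
  interpret N: smooth_mfld N by standard (rule N)
  note pb = smooth_map_pullback[OF M N F p]
  show ?thesis
    unfolding tangent_space_def pushforward_def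
    by (auto simp: N.smooth_near_lin N.smooth_near_mult intro!: M.tangent_lin[OF v] M.tangent_mult[OF v] pb)
qed

lemma smooth_map_topspace:
  "smooth_map M N F \<Longrightarrow> p \<in> topspace (mtop M) \<Longrightarrow> F p \<in> topspace (mtop N)"
  unfolding smooth_map_def continuous_map_def by auto

section \<open>Isometry is symmetric and transitive\<close>

lemma isometric_sym:
  assumes M: "smooth_manifold M" and N: "smooth_manifold N" and "isometric M g N h"
  shows "isometric N h M g"
proof -
  interpret N: smooth_mfld N by standard (rule N)
  obtain F F' where F: "smooth_map M N F" and F': "smooth_map N M F'"
    and inv: "\<And>p. p \<in> topspace (mtop M) \<Longrightarrow> F' (F p) = p" "\<And>q. q \<in> topspace (mtop N) \<Longrightarrow> F (F' q) = q"
    and iso: "\<And>p v w. p \<in> topspace (mtop M) \<Longrightarrow> v \<in> tangent_space M p \<Longrightarrow> w \<in> tangent_space M p \<Longrightarrow>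
        h (F p) (pushforward N F p v) (pushforward N F p w) = g p v w"
    using assms(3) unfolding isometric_def riemannian_isometry_def diffeomorphism_def by blast
  \<comment> \<open>\<open>F (F' r) = r\<close> holds on the manifold only, so the two functions
    agree on an open set and not as HOL functions; \<open>tangent_cong\<close> closes the
    gap.\<close>
  have pp: "pushforward N F (F' q) (pushforward M F' q v) = v"
    if q: "q \<in> topspace (mtop N)" and v: "v \<in> tangent_space N q" for q v
  proof
    fix f
    show "pushforward N F (F' q) (pushforward M F' q v) f = v f"
    proof (cases "smooth_near N q f")
      case True
      have "smooth_near M (F' q) (\<lambda>r. f (F r))"
        using smooth_map_pullback[OF M N F smooth_map_topspace[OF F' q]] True inv(2)[OF q] by simp
      moreover have "v (\<lambda>r. f (F (F' r))) = v f"
        by (rule N.tangent_cong[OF openin_topspace q _ v]) (simp add: inv)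
      ultimately show ?thesis using True inv(2)[OF q] by (simp add: pushforward_def)
    next
      case False
      then show ?thesis using N.tangent_not_smooth[OF v] inv(2)[OF q] by (simp add: pushforward_def)
    qed
  qed
  have "g (F' q) (pushforward M F' q v) (pushforward M F' q w) = h q v w"
    if q: "q \<in> topspace (mtop N)" and "v \<in> tangent_space N q" "w \<in> tangent_space N q" for q v w
    using iso[OF smooth_map_topspace[OF F' q] pushforward_tangent[OF N M F' q that(2)]
        pushforward_tangent[OF N M F' q that(3)]] pp[OF q] that inv(2)[OF q] by simp
  then have "riemannian_isometry N h M g F'"
    unfolding riemannian_isometry_def diffeomorphism_def using F F' inv by blast
  then show ?thesis unfolding isometric_def by blast
qed

lemma isometric_trans:
  assumes M: "smooth_manifold M" and N: "smooth_manifold N" and P: "smooth_manifold P"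
    and "isometric M g N h" "isometric N h P k"
  shows "isometric M g P k"
proof -
  interpret P: smooth_mfld P by standard (rule P)
  obtain F F' where F: "smooth_map M N F" and F': "smooth_map N M F'"
    and inv: "\<And>p. p \<in> topspace (mtop M) \<Longrightarrow> F' (F p) = p" "\<And>q. q \<in> topspace (mtop N) \<Longrightarrow> F (F' q) = q"
    and iso: "\<And>p v w. p \<in> topspace (mtop M) \<Longrightarrow> v \<in> tangent_space M p \<Longrightarrow> w \<in> tangent_space M p \<Longrightarrow>
        h (F p) (pushforward N F p v) (pushforward N F p w) = g p v w"
    using assms(4) unfolding isometric_def riemannian_isometry_def diffeomorphism_def by blast
  obtain K K' where K: "smooth_map N P K" and K': "smooth_map P N K'"
    and invK: "\<And>p. p \<in> topspace (mtop N) \<Longrightarrow> K' (K p) = p" "\<And>q. q \<in> topspace (mtop P) \<Longrightarrow> K (K' q) = q"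
    and isoK: "\<And>p v w. p \<in> topspace (mtop N) \<Longrightarrow> v \<in> tangent_space N p \<Longrightarrow> w \<in> tangent_space N p \<Longrightarrow>
        k (K p) (pushforward P K p v) (pushforward P K p w) = h p v w"
    using assms(5) unfolding isometric_def riemannian_isometry_def diffeomorphism_def by blast
  have pp: "pushforward P (\<lambda>p. K (F p)) p v = pushforward P K (F p) (pushforward N F p v)"
    if p: "p \<in> topspace (mtop M)" for p v
    using smooth_map_pullback[OF N P K smooth_map_topspace[OF F p]] by (auto simp: pushforward_def)
  have "k (K (F p)) (pushforward P (\<lambda>p. K (F p)) p v) (pushforward P (\<lambda>p. K (F p)) p w) = g p v w"
    if p: "p \<in> topspace (mtop M)" and "v \<in> tangent_space M p" "w \<in> tangent_space M p" for p v w
    unfolding pp[OF p] using isoK[OF smooth_map_topspace[OF F p] pushforward_tangent[OF M N F p that(2)]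
        pushforward_tangent[OF M N F p that(3)]] iso[OF that] by simp
  moreover have "smooth_map M P (\<lambda>p. K (F p))" "smooth_map P M (\<lambda>p. F' (K' p))"
    by (rule smooth_map_compose[OF M N P F K]) (rule smooth_map_compose[OF P N M K' F'])
  ultimately have "riemannian_isometry M g P k (\<lambda>p. K (F p))"
    unfolding riemannian_isometry_def diffeomorphism_def
    using inv invK smooth_map_topspace[OF F] smooth_map_topspace[OF K'] by (intro conjI exI[of _ "\<lambda>p. F' (K' p)"]) auto
  then show ?thesis unfolding isometric_def by blast
qed


section \<open>Monodromy\<close>

lemma continuous_map_near:
  fixes S :: "'z::metric_space set"
  assumes "continuous_map (top_of_set S) X k" "openin X W" "s \<in> S" "k s \<in> W"
  obtains e where "e > 0" "\<And>s'. s' \<in> S \<Longrightarrow> dist s' s < e \<Longrightarrow> k s' \<in> W"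
proof -
  have "openin (top_of_set S) {s' \<in> topspace (top_of_set S). k s' \<in> W}"
    by (rule openin_continuous_map_preimage[OF assms(1,2)])
  moreover have "s \<in> {s' \<in> topspace (top_of_set S). k s' \<in> W}" using assms(3,4) by simp
  ultimately obtain e where "e > 0" "\<forall>s'\<in>S. dist s' s < e \<longrightarrow> s' \<in> {s' \<in> topspace (top_of_set S). k s' \<in> W}"
    unfolding openin_euclidean_subtopology_iff by blast
  then show thesis by (intro that[of e]) auto
qed

text \<open>The model case is the set of local primitives of a closed one-form: two of them differ
  by a local constant wherever both are defined. In a path connected domain any two points are
  joined by a path along which a single member is a continuation.\<close>

locale local_system =
  fixes X :: "'a topology" and \<F> :: "('a set \<times> ('a \<Rightarrow> real)) set"
  assumes path_connected: "(U, f) \<in> \<F> \<Longrightarrow> path_connectedin X U"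
    and cover: "p \<in> topspace X \<Longrightarrow> \<exists>U f. (U, f) \<in> \<F> \<and> openin X U \<and> p \<in> U"
    and compatible: "(U, f) \<in> \<F> \<Longrightarrow> (V, g) \<in> \<F> \<Longrightarrow> p \<in> U \<Longrightarrow> p \<in> V \<Longrightarrow>
      \<exists>W. openin X W \<and> p \<in> W \<and> (\<forall>q\<in>W. f q - g q = f p - g p)"
begin

text \<open>\<open>\<phi>\<close> is an analytic continuation of the system along \<open>k\<close>: up to local constants it is the
  composition of \<open>k\<close> with members of the system.\<close>

definition lift :: "('z::metric_space \<Rightarrow> 'a) \<Rightarrow> ('z \<Rightarrow> real) \<Rightarrow> 'z set \<Rightarrow> bool" where
  "lift k \<phi> S \<longleftrightarrow> (\<forall>s\<in>S. \<forall>(U, f)\<in>\<F>. k s \<in> U \<longrightarrow>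
     (\<exists>e>0. \<forall>s'\<in>S. dist s' s < e \<longrightarrow> \<phi> s' - f (k s') = \<phi> s - f (k s)))"

lemma liftD:
  "lift k \<phi> S \<Longrightarrow> s \<in> S \<Longrightarrow> (U, f) \<in> \<F> \<Longrightarrow> k s \<in> U \<Longrightarrow>
    \<exists>e>0. \<forall>s'\<in>S. dist s' s < e \<longrightarrow> \<phi> s' - f (k s') = \<phi> s - f (k s)"
  unfolding lift_def by blast

lemma lift_cong:
  assumes "lift k \<phi> S" "\<And>s. s \<in> S \<Longrightarrow> k s = k' s" "\<And>s. s \<in> S \<Longrightarrow> \<phi> s = \<phi>' s + c"
  shows "lift k' \<phi>' S"
  unfolding lift_def
proof safe
  fix s U f assume s: "s \<in> S" "(U, f) \<in> \<F>" "k' s \<in> U"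
  have "k s \<in> U" using s assms(2) by simp
  then obtain e where e: "e > 0" "\<forall>s'\<in>S. dist s' s < e \<longrightarrow> \<phi> s' - f (k s') = \<phi> s - f (k s)"
    using liftD[OF assms(1) s(1,2)] by blast
  have "\<phi>' s' - f (k' s') = \<phi>' s - f (k' s)" if "s' \<in> S" "dist s' s < e" for s'
  proof -
    have "\<phi> s' - f (k s') = \<phi> s - f (k s)" using e(2) that by blast
    then show ?thesis
      unfolding assms(2)[OF that(1)] assms(2)[OF s(1)] assms(3)[OF that(1)] assms(3)[OF s(1)] by simp
  qed
  then show "\<exists>e>0. \<forall>s'\<in>S. dist s' s < e \<longrightarrow> \<phi>' s' - f (k' s') = \<phi>' s - f (k' s)"
    using e(1) by blast
qed

lemma lift_compose:
  assumes "lift k \<phi> S" "continuous_on T h" "h ` T \<subseteq> S"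
  shows "lift (\<lambda>t. k (h t)) (\<lambda>t. \<phi> (h t)) T"
  unfolding lift_def
proof safe
  fix t U f assume t: "t \<in> T" "(U, f) \<in> \<F>" "k (h t) \<in> U"
  have "h t \<in> S" using t(1) assms(3) by blast
  then obtain e where e: "e > 0" "\<forall>s'\<in>S. dist s' (h t) < e \<longrightarrow> \<phi> s' - f (k s') = \<phi> (h t) - f (k (h t))"
    using liftD[OF assms(1) _ t(2,3)] by blast
  obtain d where d: "d > 0" "\<And>t'. t' \<in> T \<Longrightarrow> dist t' t < d \<Longrightarrow> dist (h t') (h t) < e"
    using assms(2) t(1) e(1) unfolding continuous_on_iff by blast
  have "h t' \<in> S" if "t' \<in> T" for t' using assms(3) that by blast
  then show "\<exists>d>0. \<forall>t'\<in>T. dist t' t < d \<longrightarrow> \<phi> (h t') - f (k (h t')) = \<phi> (h t) - f (k (h t))"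
    using e(2) d by blast
qed

text \<open>Near each point both lifts follow the same member of the system up to constants, so
  their difference is locally constant on a connected set.\<close>

lemma lift_unique:
  assumes "connected S" "lift k \<phi> S" "lift k \<psi> S" "k ` S \<subseteq> topspace X" "a \<in> S" "b \<in> S"
  shows "\<phi> a - \<psi> a = \<phi> b - \<psi> b"
proof (rule connected_local_const[OF assms(1,5,6), where f="\<lambda>s. \<phi> s - \<psi> s"], rule ballI)
  fix s assume s: "s \<in> S"
  then have "k s \<in> topspace X" using assms(4) by blast
  from cover[OF this] obtain U f where U: "(U, f) \<in> \<F>" "k s \<in> U" by blast
  obtain d where d: "d > 0" "\<forall>s'\<in>S. dist s' s < d \<longrightarrow> \<phi> s' - f (k s') = \<phi> s - f (k s)"
    using liftD[OF assms(2) s U] by blast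
  obtain e where e: "e > 0" "\<forall>s'\<in>S. dist s' s < e \<longrightarrow> \<psi> s' - f (k s') = \<psi> s - f (k s)"
    using liftD[OF assms(3) s U] by blast
  have "\<phi> s - \<psi> s = \<phi> s' - \<psi> s'" if "s' \<in> S" "dist s' s < min d e" for s'
  proof -
    have "dist s' s < d" "dist s' s < e" using that(2) by auto
    then have "\<phi> s' - f (k s') = \<phi> s - f (k s)" "\<psi> s' - f (k s') = \<psi> s - f (k s)"
      using d(2) e(2) that(1) by blast+
    then show ?thesis by linarith
  qed
  then show "\<forall>\<^sub>F s' in at s within S. \<phi> s - \<psi> s = \<phi> s' - \<psi> s'"
    unfolding eventually_at using d(1) e(1) by (intro exI[of _ "min d e"]) auto
qed

lemma lift_chart:
  assumes U: "(U, f) \<in> \<F>" and k: "continuous_map (top_of_set S) X k" "k ` S \<subseteq> U"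
  shows "lift k (\<lambda>s. f (k s)) S"
  unfolding lift_def
proof safe
  fix s V g assume s: "s \<in> S" "(V, g) \<in> \<F>" "k s \<in> V"
  obtain W where W: "openin X W" "k s \<in> W" "\<forall>q\<in>W. f q - g q = f (k s) - g (k s)"
    using compatible[OF U s(2) _ s(3)] k(2) s(1) by blast
  obtain e where "e > 0" "\<And>s'. s' \<in> S \<Longrightarrow> dist s' s < e \<Longrightarrow> k s' \<in> W"
    using continuous_map_near[OF k(1) W(1) s(1) W(2)] by blast
  then show "\<exists>e>0. \<forall>s'\<in>S. dist s' s < e \<longrightarrow> f (k s') - g (k s') = f (k s) - g (k s)"
    using W(3) by blast
qed

text \<open>At a point outside one of the closed sets that set imposes no condition nearby; at a
  common point the smaller of the two radii works.\<close>

lemma lift_union: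
  assumes S: "closed S" "lift k \<phi> S" and T: "closed T" "lift k \<phi> T"
  shows "lift k \<phi> (S \<union> T)"
  unfolding lift_def
proof (intro ballI, clarify)
  fix s U f assume s: "s \<in> S \<union> T" "(U, f) \<in> \<F>" "k s \<in> U"
  have *: "\<exists>e>0. \<forall>s'\<in>R. dist s' s < e \<longrightarrow> \<phi> s' - f (k s') = \<phi> s - f (k s)"
    if "closed R" "lift k \<phi> R" for R
  proof (cases "s \<in> R")
    case True
    then show ?thesis using liftD[OF that(2) _ s(2,3)] by blast
  next
    case False
    then have "open (- R)" "s \<in> - R" using that(1) by auto
    then obtain e where "e > 0" "ball s e \<subseteq> - R" by (rule openE)
    then show ?thesis by (intro exI[of _ e]) (auto simp: dist_commute subset_iff)
  qed
  obtain d e where de: "d > 0" "\<forall>s'\<in>S. dist s' s < d \<longrightarrow> \<phi> s' - f (k s') = \<phi> s - f (k s)"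
    "e > 0" "\<forall>s'\<in>T. dist s' s < e \<longrightarrow> \<phi> s' - f (k s') = \<phi> s - f (k s)"
    using *[OF S] *[OF T] by blast
  then show "\<exists>e>0. \<forall>s'\<in>S \<union> T. dist s' s < e \<longrightarrow> \<phi> s' - f (k s') = \<phi> s - f (k s)"
  proof (intro exI[of _ "min d e"] conjI ballI impI)
    fix s' assume "s' \<in> S \<union> T" "dist s' s < min d e"
    moreover from this(2) have "dist s' s < d" "dist s' s < e" by auto
    ultimately show "\<phi> s' - f (k s') = \<phi> s - f (k s)" using de(2,4) by blast
  qed (use de(1,3) in simp)
qed

text \<open>On the connected overlap the two lifts differ by one constant, and shifting \<psi> by it
  makes them agree.\<close>

lemma lift_glue:
  assumes S: "closed S" "lift k \<phi> S" and T: "closed T" "lift k \<psi> T"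
    and "connected (S \<inter> T)" "S \<inter> T \<noteq> {}" "k ` S \<subseteq> topspace X"
  shows "\<exists>\<theta>. lift k \<theta> (S \<union> T)"
proof -
  obtain x where x: "x \<in> S \<inter> T" using assms(6) by blast
  define \<theta> where "\<theta> s = (if s \<in> S then \<phi> s else \<psi> s + (\<phi> x - \<psi> x))" for s
  have r: "lift k \<phi> (S \<inter> T)" "lift k \<psi> (S \<inter> T)"
    using lift_compose[OF S(2), of "S \<inter> T" "\<lambda>x. x"] lift_compose[OF T(2), of "S \<inter> T" "\<lambda>x. x"] by auto
  have "\<phi> s = \<psi> s + (\<phi> x - \<psi> x)" if "s \<in> S \<inter> T" for s
  proof -
    have "k ` (S \<inter> T) \<subseteq> topspace X" using assms(7) by blast
    from lift_unique[OF assms(5) r this that x] show ?thesis by simp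
  qed
  then have "lift k \<theta> T"
    by (intro lift_cong[OF T(2), where c="- (\<phi> x - \<psi> x)"]) (auto simp: \<theta>_def)
  moreover have "lift k \<theta> S"
    by (intro lift_cong[OF S(2), where c=0]) (auto simp: \<theta>_def)
  ultimately show ?thesis using lift_union S(1) T(1) by blast
qed

text \<open>Small rectangles map into a single member of the system. Bisection in the second
  coordinate assembles them into a full-height strip around each \<open>s\<close>, and bisection in
  the first coordinate assembles the strips into the square; consecutive pieces meet in a segment,
  which is connected.\<close>

lemma lift_square:
  fixes k :: "real \<times> real \<Rightarrow> 'a"
  assumes k: "continuous_map (top_of_set ({0..1} \<times> {0..1})) X k"
  shows "\<exists>\<phi>. lift k \<phi> ({0..1} \<times> {0..1})"
proof -
  have ktop: "k z \<in> topspace X" if "z \<in> {0..1} \<times> {0..1}" for z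
    using k that unfolding continuous_map_def by auto
  define L where "L a b u v \<longleftrightarrow> (\<exists>\<phi>. lift k \<phi> ({a..b} \<times> {u..v}))" for a b u v
  have loc: "\<exists>d>0. \<forall>a b u v. 0 \<le> a \<and> a \<le> s \<and> s \<le> b \<and> b \<le> 1 \<and> b - a < d \<and>
      0 \<le> u \<and> u \<le> t \<and> t \<le> v \<and> v \<le> 1 \<and> v - u < d \<longrightarrow> L a b u v"
    if st: "0 \<le> s" "s \<le> 1" "0 \<le> t" "t \<le> 1" for s t
  proof -
    obtain U f where U: "(U, f) \<in> \<F>" "openin X U" "k (s, t) \<in> U"
      using cover[OF ktop[of "(s, t)"]] st by auto
    have "(s, t) \<in> {0..1} \<times> {0..1}" using st by simp
    from continuous_map_near[OF k U(2) this U(3)]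
    obtain e where e: "e > 0" "\<And>z. z \<in> {0..1} \<times> {0..1} \<Longrightarrow> dist z (s, t) < e \<Longrightarrow> k z \<in> U"
      by blast
    have "L a b u v" if h: "0 \<le> a" "a \<le> s" "s \<le> b" "b \<le> 1" "b - a < e / 2"
      "0 \<le> u" "u \<le> t" "t \<le> v" "v \<le> 1" "v - u < e / 2" for a b u v
    proof -
      have sub: "{a..b} \<times> {u..v} \<subseteq> {0..1} \<times> {0..1}" using h by auto
      have "k ` ({a..b} \<times> {u..v}) \<subseteq> U"
      proof (rule image_subsetI)
        fix z assume "z \<in> {a..b} \<times> {u..v}"
        then obtain x y where xy: "z = (x, y)" "x \<in> {a..b}" "y \<in> {u..v}" by blast
        have "dist (x, y) (s, t) \<le> dist x s + dist y t"
          by (simp add: dist_Pair_Pair sqrt_sum_squares_le_sum)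
        also have "\<dots> < e" using xy h by (auto simp: dist_real_def)
        finally show "k z \<in> U" using e(2)[of "(x, y)"] xy sub by blast
      qed
      from lift_chart[OF U(1) continuous_map_from_subtopology_mono[OF k sub] this]
      show ?thesis unfolding L_def by blast
    qed
    then show ?thesis using e(1) by (intro exI[of _ "e / 2"]) auto
  qed
  have strip: "\<exists>d>0. \<forall>a b. 0 \<le> a \<and> a \<le> s \<and> s \<le> b \<and> b \<le> 1 \<and> b - a < d \<longrightarrow> L a b 0 1"
    if s: "0 \<le> s" "s \<le> 1" for s
  proof -
    \<comment> \<open>\<open>Bolzano\<close> also asks about intervals that stick out of the unit
      interval; the guard makes \<open>R\<close> vacuous there. The width \<open>d\<close> precedes
      \<open>a\<close> and \<open>b\<close>, so that two stacked pieces can be cut to a common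
      strip.\<close>
    define R where "R u v \<longleftrightarrow> (0 \<le> u \<and> v \<le> 1 \<longrightarrow>
      (\<exists>d>0. \<forall>a b. 0 \<le> a \<and> a \<le> s \<and> s \<le> b \<and> b \<le> 1 \<and> b - a < d \<longrightarrow> L a b u v))" for u v
    have "(0::real) \<le> 1" by simp
    then have "R 0 1"
    proof (induction rule: Bolzano)
      case (trans u v w)
      show ?case unfolding R_def
      proof
        assume uw: "0 \<le> u \<and> w \<le> 1"
        then have "0 \<le> u \<and> v \<le> 1" "0 \<le> v \<and> w \<le> 1" using trans(3,4) by auto
        then obtain d e where d: "d > 0" "\<And>a b. 0 \<le> a \<and> a \<le> s \<and> s \<le> b \<and> b \<le> 1 \<and> b - a < d \<Longrightarrow> L a b u v"
          and e: "e > 0" "\<And>a b. 0 \<le> a \<and> a \<le> s \<and> s \<le> b \<and> b \<le> 1 \<and> b - a < e \<Longrightarrow> L a b v w"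
          using trans(1,2) unfolding R_def by blast
        have "L a b u w" if h: "0 \<le> a" "a \<le> s" "s \<le> b" "b \<le> 1" "b - a < min d e" for a b
        proof -
          obtain \<phi> \<psi> where l: "lift k \<phi> ({a..b} \<times> {u..v})" "lift k \<psi> ({a..b} \<times> {v..w})"
            using d(2)[of a b] e(2)[of a b] h unfolding L_def by auto
          have i: "{a..b} \<times> {u..v} \<inter> {a..b} \<times> {v..w} = {a..b} \<times> {v}"
            and un: "{a..b} \<times> {u..v} \<union> {a..b} \<times> {v..w} = {a..b} \<times> {u..w}"
            using trans(3,4) by auto
          have "\<exists>\<theta>. lift k \<theta> ({a..b} \<times> {u..v} \<union> {a..b} \<times> {v..w})"
          proof (rule lift_glue[OF _ l(1) _ l(2)])
            show "connected ({a..b} \<times> {u..v} \<inter> {a..b} \<times> {v..w})"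
              unfolding i by (intro connected_Times) auto
            show "k ` ({a..b} \<times> {u..v}) \<subseteq> topspace X"
              using ktop h uw trans(3,4) by (auto simp: image_subset_iff)
            show "{a..b} \<times> {u..v} \<inter> {a..b} \<times> {v..w} \<noteq> {}" unfolding i using h by auto
          qed (auto intro: closed_Times)
          then show ?thesis unfolding un L_def .
        qed
        then show "\<exists>d>0. \<forall>a b. 0 \<le> a \<and> a \<le> s \<and> s \<le> b \<and> b \<le> 1 \<and> b - a < d \<longrightarrow> L a b u w"
          using d(1) e(1) by (intro exI[of _ "min d e"]) auto
      qed
    next
      case (local t)
      then obtain d where d: "d > 0" "\<And>a b u v. 0 \<le> a \<and> a \<le> s \<and> s \<le> b \<and> b \<le> 1 \<and> b - a < d \<and>
          0 \<le> u \<and> u \<le> t \<and> t \<le> v \<and> v \<le> 1 \<and> v - u < d \<Longrightarrow> L a b u v"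
        using loc[OF s, of t] by blast
      have "R u v" if "u \<le> t" "t \<le> v" "v - u < d" for u v
        unfolding R_def using d that by (intro impI exI[of _ d]) auto
      then show ?case using d(1) by (intro exI[of _ d]) auto
    qed
    then show ?thesis unfolding R_def by simp
  qed
  define R where "R a b \<longleftrightarrow> (0 \<le> a \<and> b \<le> 1 \<longrightarrow> L a b 0 1)" for a b
  have "(0::real) \<le> 1" by simp
  then have "R 0 1"
  proof (induction rule: Bolzano)
    case (trans a b c)
    show ?case unfolding R_def
    proof
      assume ac: "0 \<le> a \<and> c \<le> 1"
      then have "0 \<le> a \<and> b \<le> 1" "0 \<le> b \<and> c \<le> 1" using trans(3,4) by auto
      then obtain \<phi> \<psi> where l: "lift k \<phi> ({a..b} \<times> {0..1})" "lift k \<psi> ({b..c} \<times> {0..1})"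
        using trans(1,2) unfolding R_def L_def by blast
      have i: "{a..b} \<times> {0..1} \<inter> {b..c} \<times> {0..1} = {b} \<times> {0..1::real}"
        and un: "{a..b} \<times> {0..1} \<union> {b..c} \<times> {0..1} = {a..c} \<times> {0..1::real}"
        using trans(3,4) by auto
      have "\<exists>\<theta>. lift k \<theta> ({a..b} \<times> {0..1} \<union> {b..c} \<times> {0..1})"
      proof (rule lift_glue[OF _ l(1) _ l(2)])
        show "connected ({a..b} \<times> {0..1} \<inter> {b..c} \<times> {0..1::real})"
          unfolding i by (intro connected_Times) auto
        show "k ` ({a..b} \<times> {0..1}) \<subseteq> topspace X"
          using ktop ac trans(3,4) by (auto simp: image_subset_iff)
      qed (auto intro: closed_Times simp: i)
      then show "L a c 0 1" unfolding un L_def .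
    qed
  next
    case (local s)
    then obtain d where d: "d > 0" "\<And>a b. 0 \<le> a \<and> a \<le> s \<and> s \<le> b \<and> b \<le> 1 \<and> b - a < d \<Longrightarrow> L a b 0 1"
      using strip[of s] by blast
    then show ?case unfolding R_def by (intro exI[of _ d]) auto
  qed
  then show ?thesis unfolding R_def L_def by simp
qed

text \<open>A path is a map of the square that ignores the first coordinate, so
  \<open>lift_square\<close> covers it.\<close>

lemma lift_path:
  assumes "pathin X \<gamma>" shows "\<exists>\<phi>. lift \<gamma> \<phi> {0..1}"
proof -
  have "continuous_map (top_of_set ({0..1} \<times> {0..1})) (top_of_set {0..1}) (snd :: real \<times> real \<Rightarrow> real)"
    by (auto simp: continuous_map_in_subtopology intro!: continuous_intros)
  from continuous_map_compose[OF this assms[unfolded pathin_def]]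
  have "continuous_map (top_of_set ({0..1} \<times> {0..1})) X (\<lambda>z. \<gamma> (snd (z :: real \<times> real)))"
    by (simp add: o_def)
  from lift_square[OF this] obtain \<phi> where "lift (\<lambda>z. \<gamma> (snd z)) \<phi> ({0..1::real} \<times> {0..1})" by blast
  then have "lift (\<lambda>t. \<gamma> (snd (0 :: real, t))) (\<lambda>t. \<phi> (0, t)) {0..1}"
    by (rule lift_compose) (auto intro!: continuous_intros)
  then show ?thesis by auto
qed

lemma lift_const:
  assumes "connected S" "lift k \<phi> S" "\<And>s. s \<in> S \<Longrightarrow> k s = p" "p \<in> topspace X" "a \<in> S" "b \<in> S"
  shows "\<phi> a = \<phi> b"
proof -
  have "lift k (\<lambda>_. 0) S"
    unfolding lift_def using assms(3) by (intro ballI, clarify) (intro exI[of _ 1], simp)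
  from lift_unique[OF assms(1,2) this _ assms(5,6)] show ?thesis using assms(3,4) by auto
qed

text \<open>The homotopy \<open>h\<close> is constant on the three sides of the square other than
  \<open>{0} \<times> {0..1}\<close>, so a lift of \<open>h\<close> takes the same value at all four
  corners. On the remaining side it lifts \<gamma> and is therefore \<phi> up to a constant.\<close>

lemma lift_loop:
  assumes X: "simply_connected_space X" and \<gamma>: "pathin X \<gamma>" "\<gamma> 1 = \<gamma> 0" and \<phi>: "lift \<gamma> \<phi> {0..1}"
  shows "\<phi> 1 = \<phi> 0"
proof -
  have "homotopic_with (\<lambda>\<eta>. \<eta> 0 = \<gamma> 0 \<and> \<eta> 1 = \<gamma> 0) (top_of_set {0..1::real}) X \<gamma> (\<lambda>_. \<gamma> 0)"
    using X \<gamma> unfolding simply_connected_space_def by blast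
  then obtain h where h: "continuous_map (top_of_set ({0..1} \<times> {0..1})) X h"
    "\<And>x. h (0::real, x::real) = \<gamma> x" "\<And>x. h (1, x) = \<gamma> 0"
    "\<And>t. t \<in> {0..1} \<Longrightarrow> h (t, 0) = \<gamma> 0 \<and> h (t, 1) = \<gamma> 0"
    unfolding homotopic_with_def by auto
  obtain \<psi> where \<psi>: "lift h \<psi> ({0..1} \<times> {0..1})" using lift_square[OF h(1)] by blast
  have \<gamma>top: "\<gamma> x \<in> topspace X" if "x \<in> {0..1}" for x
    using \<gamma>(1) that unfolding pathin_def continuous_map_def by auto
  have top: "\<gamma> 0 \<in> topspace X" by (rule \<gamma>top) simp
  have const: "\<theta> 0 = \<theta> 1" if "lift k \<theta> {0..1}" "\<And>s. s \<in> {0..1} \<Longrightarrow> k s = \<gamma> 0" for k and \<theta> :: "real \<Rightarrow> real"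
    by (rule lift_const[OF connected_Icc that top]) auto
  have "\<psi> (0, 0) = \<psi> (1, 0)"
    by (rule const[OF lift_compose[OF \<psi>, of "{0..1}" "\<lambda>t. (t, 0)"]])
       (use h in \<open>auto intro!: continuous_intros\<close>)
  moreover have "\<psi> (0, 1) = \<psi> (1, 1)"
    by (rule const[OF lift_compose[OF \<psi>, of "{0..1}" "\<lambda>t. (t, 1)"]])
       (use h in \<open>auto intro!: continuous_intros\<close>)
  moreover have "\<psi> (1, 0) = \<psi> (1, 1)"
    by (rule const[OF lift_compose[OF \<psi>, of "{0..1}" "\<lambda>t. (1, t)"]])
       (use h in \<open>auto intro!: continuous_intros\<close>)
  ultimately have sides: "\<psi> (0, 0) = \<psi> (0, 1)" by simp
  have "lift (\<lambda>t. h (0, t)) (\<lambda>t. \<psi> (0, t)) {0..1}"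
    by (rule lift_compose[OF \<psi>]) (auto intro!: continuous_intros)
  then have "lift \<gamma> (\<lambda>t. \<psi> (0, t)) {0..1}" unfolding h(2) .
  moreover have "\<gamma> ` {0..1} \<subseteq> topspace X" using \<gamma>top by blast
  ultimately have "\<phi> 0 - \<psi> (0, 0) = \<phi> 1 - \<psi> (0, 1)"
    using lift_unique[OF connected_Icc \<phi>, of "\<lambda>t. \<psi> (0, t)" 0 1] by simp
  then show ?thesis using sides by simp
qed

section \<open>Concatenation of paths and increments of lifts\<close>

definition path_join :: "(real \<Rightarrow> 'a) \<Rightarrow> (real \<Rightarrow> 'a) \<Rightarrow> real \<Rightarrow> 'a" where
  "path_join \<alpha> \<beta> s = (if s \<le> 1/2 then \<alpha> (2 * s) else \<beta> (2 * s - 1))"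

lemma path_compose:
  assumes "pathin X \<gamma>" "continuous_on S h" "h ` S \<subseteq> {0..1}"
  shows "continuous_map (top_of_set S) X (\<lambda>s. \<gamma> (h s))"
proof -
  have "continuous_map (top_of_set S) (top_of_set {0..1}) h"
    using assms(2,3) by (auto simp: continuous_map_in_subtopology)
  from continuous_map_compose[OF this assms(1)[unfolded pathin_def]] show ?thesis by (simp add: o_def)
qed

lemma path_join:
  assumes "pathin X \<alpha>" "pathin X \<beta>" "\<alpha> 1 = \<beta> 0"
  shows "pathin X (path_join \<alpha> \<beta>)"
  unfolding pathin_def path_join_def
proof (rule continuous_map_cases_le)
  have "{x \<in> topspace (top_of_set {0..1}). x \<le> 1 / 2} = {0..1/2::real}"
    "{x \<in> topspace (top_of_set {0..1}). 1 / 2 \<le> x} = {1/2..1::real}" by auto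
  moreover have "{0..1} \<inter> {0..1/2} = {0..1/2::real}" "{0..1} \<inter> {1/2..1} = {1/2..1::real}" by auto
  ultimately show "continuous_map (subtopology (top_of_set {0..1}) {x \<in> topspace (top_of_set {0..1}). x \<le> 1 / 2})
      X (\<lambda>s. \<alpha> (2 * s))"
    "continuous_map (subtopology (top_of_set {0..1}) {x \<in> topspace (top_of_set {0..1}). 1 / 2 \<le> x})
      X (\<lambda>s. \<beta> (2 * s - 1))"
    by (auto simp: subtopology_subtopology intro!: path_compose assms continuous_intros)
  show "\<alpha> (2 * x) = \<beta> (2 * x - 1)" if "x = 1 / 2" for x
    unfolding that by (simp add: assms(3))
qed auto

text \<open>When the system consists of primitives of a closed one-form, \<open>d\<close> is the
  integral of the form along \<gamma>.\<close>

definition increment :: "(real \<Rightarrow> 'a) \<Rightarrow> real \<Rightarrow> bool" where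
  "increment \<gamma> d \<longleftrightarrow> (\<exists>\<phi>. lift \<gamma> \<phi> {0..1} \<and> d = \<phi> 1 - \<phi> 0)"

lemma increment_unique:
  assumes "pathin X \<gamma>" "increment \<gamma> d" "lift \<gamma> \<phi> {0..1}"
  shows "d = \<phi> 1 - \<phi> 0"
proof -
  have top: "\<gamma> ` {0..1} \<subseteq> topspace X" using assms(1) unfolding pathin_def continuous_map_def by auto
  obtain \<psi> where \<psi>: "lift \<gamma> \<psi> {0..1}" "d = \<psi> 1 - \<psi> 0" using assms(2) unfolding increment_def by blast
  from lift_unique[OF connected_Icc \<psi>(1) assms(3) top, of 0 1] \<psi>(2) show ?thesis by simp
qed

lemma increment_join:
  assumes p: "pathin X \<alpha>" "pathin X \<beta>" "\<alpha> 1 = \<beta> 0" and a: "increment \<alpha> a" and b: "increment \<beta> b"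
  shows "increment (path_join \<alpha> \<beta>) (a + b)"
proof -
  obtain \<phi> where \<phi>: "lift (path_join \<alpha> \<beta>) \<phi> {0..1}" using lift_path[OF path_join[OF p]] by blast
  have "lift (\<lambda>s. path_join \<alpha> \<beta> (s / 2)) (\<lambda>s. \<phi> (s / 2)) {0..1}"
    by (rule lift_compose[OF \<phi>]) (auto intro!: continuous_intros)
  then have "lift \<alpha> (\<lambda>s. \<phi> (s / 2)) {0..1}"
    by (rule lift_cong[where c=0]) (auto simp: path_join_def)
  from increment_unique[OF p(1) a this] have A: "a = \<phi> (1/2) - \<phi> 0" by simp
  have "lift (\<lambda>s. path_join \<alpha> \<beta> ((s + 1) / 2)) (\<lambda>s. \<phi> ((s + 1) / 2)) {0..1}"
    by (rule lift_compose[OF \<phi>]) (auto intro!: continuous_intros)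
  \<comment> \<open>At \<open>s = 0\<close> the joined path still uses its first branch, and
    \<alpha> 1 = \<beta> 0 gives the value.\<close>
  moreover have "path_join \<alpha> \<beta> ((s + 1) / 2) = \<beta> s" if "s \<in> {0..1}" for s
    using that p(3) by (cases "s = 0") (simp_all add: path_join_def add_divide_distrib)
  ultimately have "lift \<beta> (\<lambda>s. \<phi> ((s + 1) / 2)) {0..1}"
    by (rule lift_cong[where c=0]) simp_all
  from increment_unique[OF p(2) b this] have "b = \<phi> 1 - \<phi> (1/2)" by simp
  then show ?thesis using A \<phi> unfolding increment_def by auto
qed

lemma increment_reverse:
  assumes "increment \<gamma> a" shows "increment (\<lambda>s. \<gamma> (1 - s)) (- a)"
proof -
  obtain \<phi> where \<phi>: "lift \<gamma> \<phi> {0..1}" "a = \<phi> 1 - \<phi> 0" using assms unfolding increment_def by blast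
  have "lift (\<lambda>s. \<gamma> (1 - s)) (\<lambda>s. \<phi> (1 - s)) {0..1}"
    by (rule lift_compose[OF \<phi>(1)]) (auto intro!: continuous_intros)
  then show ?thesis
    unfolding increment_def \<phi>(2) by (intro exI[of _ "\<lambda>s. \<phi> (1 - s)"]) simp
qed

lemma increment_loop:
  assumes "simply_connected_space X" "pathin X \<gamma>" "\<gamma> 1 = \<gamma> 0" "increment \<gamma> a"
  shows "a = 0"
  using assms(4) lift_loop[OF assms(1-3)] unfolding increment_def by auto

text \<open>\<open>F p\<close> is the increment along a chosen path from \<open>x0\<close> to
  \<open>p\<close>. The path to \<open>p\<close>, a path inside \<open>U\<close> from
  \<open>p\<close> to \<open>q\<close> and the reversed path to \<open>q\<close> form a loop, whose
  increment F p + (f q - f p) - F q vanishes by \<open>increment_loop\<close>.\<close>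

theorem global_function:
  assumes X: "simply_connected_space X"
  shows "\<exists>F. \<forall>(U, f)\<in>\<F>. \<forall>p\<in>U. \<forall>q\<in>U. F q - f q = F p - f p"
proof (cases "topspace X = {}")
  case True
  then show ?thesis using path_connected unfolding path_connectedin_def by fast
next
  case False
  then obtain x0 where x0: "x0 \<in> topspace X" by blast
  have "\<exists>\<gamma>. pathin X \<gamma> \<and> \<gamma> 0 = x0 \<and> \<gamma> 1 = p" if "p \<in> topspace X" for p
    using X x0 that unfolding simply_connected_space_def path_connected_space_def by blast
  then obtain \<gamma> where \<gamma>: "\<And>p. p \<in> topspace X \<Longrightarrow> pathin X (\<gamma> p) \<and> \<gamma> p 0 = x0 \<and> \<gamma> p 1 = p"
    by metis
  have "\<exists>d. increment (\<gamma> p) d" if "p \<in> topspace X" for p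
    using lift_path[of "\<gamma> p"] \<gamma>[OF that] unfolding increment_def by blast
  then obtain F where F: "\<And>p. p \<in> topspace X \<Longrightarrow> increment (\<gamma> p) (F p)" by metis
  have "F q - f q = F p - f p" if U: "(U, f) \<in> \<F>" "p \<in> U" "q \<in> U" for U f p q
  proof -
    have top: "p \<in> topspace X" "q \<in> topspace X"
      using path_connected[OF U(1)] U(2,3) unfolding path_connectedin_def by auto
    obtain \<delta> where \<delta>: "pathin X \<delta>" "\<delta> ` {0..1} \<subseteq> U" "\<delta> 0 = p" "\<delta> 1 = q"
      using path_connected[OF U(1)] U(2,3) unfolding path_connectedin by blast
    have d: "increment \<delta> (f q - f p)"
      unfolding increment_def using lift_chart[OF U(1) \<delta>(1)[unfolded pathin_def] \<delta>(2)] \<delta>(3,4)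
      by (intro exI[of _ "\<lambda>s. f (\<delta> s)"]) simp
    have r: "pathin X (\<lambda>s. \<gamma> q (1 - s))"
      unfolding pathin_def using \<gamma>[OF top(2)] by (intro path_compose) (auto intro!: continuous_intros)
    have j: "pathin X (path_join \<delta> (\<lambda>s. \<gamma> q (1 - s)))"
      using path_join[OF \<delta>(1) r] \<delta>(4) \<gamma>[OF top(2)] by simp
    have "increment (path_join \<delta> (\<lambda>s. \<gamma> q (1 - s))) (f q - f p + - F q)"
      using increment_join[OF \<delta>(1) r _ d increment_reverse[OF F[OF top(2)]]] \<delta>(4) \<gamma>[OF top(2)] by simp
    then have "increment (path_join (\<gamma> p) (path_join \<delta> (\<lambda>s. \<gamma> q (1 - s)))) (F p + (f q - f p + - F q))"
      using \<gamma>[OF top(1)] \<delta>(3) by (intro increment_join[OF _ j _ F[OF top(1)]]) (auto simp: path_join_def)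
    moreover have "pathin X (path_join (\<gamma> p) (path_join \<delta> (\<lambda>s. \<gamma> q (1 - s))))"
      using \<gamma>[OF top(1)] \<delta>(3) by (intro path_join[OF _ j]) (auto simp: path_join_def)
    ultimately have "F p + (f q - f p + - F q) = 0"
      using \<gamma>[OF top(1)] \<gamma>[OF top(2)] by (intro increment_loop[OF X]) (auto simp: path_join_def)
    then show ?thesis by simp
  qed
  then show ?thesis by (intro exI[of _ F]) blast
qed

end


section \<open>Primitives of closed one-forms in a moving frame\<close>

text \<open>Pointwise independence is enough for a frame: there are as many fields as coordinates,
  and \<open>tangent_combination\<close> derives that they span.\<close>

locale frame = smooth_mfld M for M :: "('a, real^'n) manifold" +
  fixes E :: "'n \<Rightarrow> 'a vfield"
  assumes E_field: "smooth_vfield_on M (topspace (mtop M)) (E i)"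
    and E_independent: "p \<in> topspace (mtop M) \<Longrightarrow> (\<And>f. (\<Sum>i\<in>UNIV. s $ i * E i p f) = 0) \<Longrightarrow> s = 0"
begin

lemma E_tangent: "p \<in> topspace (mtop M) \<Longrightarrow> E i p \<in> tangent_space M p"
  using E_field[of i] unfolding smooth_vfield_on_def by blast

lemma E_smooth_near:
  assumes "smooth_near M p f" shows "smooth_near M p (\<lambda>q. E i q f)"
proof -
  obtain W where W: "p \<in> W" "smooth_fun_on M W f" using assms unfolding smooth_near_def by blast
  have "W \<subseteq> topspace (mtop M)" by (rule openin_subset[OF smooth_fun_on_openin[OF W(2)]])
  then have "smooth_fun_on M W (\<lambda>q. E i q f)"
    using E_field[of i] W(2) unfolding smooth_vfield_on_def by blast
  then show ?thesis using W(1) unfolding smooth_near_def by blast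
qed

text \<open>Besides a chart, \<phi> may be any map into the coordinate space; \<open>coeff\<close>
  is then the matrix of its differential with respect to the frame.\<close>

definition coeff :: "('a \<Rightarrow> real^'n) \<Rightarrow> 'a \<Rightarrow> real^'n^'n" where
  "coeff \<phi> p = (\<chi> i j. E i p (\<lambda>q. \<phi> q $ j))"

lemma coeff_nth [simp]: "coeff \<phi> p $ i $ j = E i p (\<lambda>q. \<phi> q $ j)"
  by (simp add: coeff_def)

definition grad :: "(real^'n \<Rightarrow> real) \<Rightarrow> real^'n \<Rightarrow> real^'n" where
  "grad h x = (\<chi> j. frechet_derivative h (at x) (axis j 1))"

lemma grad_cong:
  assumes "smooth_on S h" "open S" "x \<in> S" "\<And>y. y \<in> S \<Longrightarrow> h y = k y"
  shows "grad h x = grad k x"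
proof -
  have "h differentiable at x"
    using smooth_on_has_derivative[OF assms(1,3)] unfolding differentiable_def by blast
  from frechet_derivative_transform_within_open[OF this assms(2-4)]
  show ?thesis by (simp add: grad_def)
qed

context
  fixes U \<phi>
  assumes c: "(U, \<phi>) \<in> atlas M"
begin

lemma frame_coord:
  assumes "p \<in> U" "smooth_near M p f"
  shows "E i p f = (coeff \<phi> p *v grad (\<lambda>x. f (inv_into U \<phi> x)) (\<phi> p)) $ i"
  using tangent_coord[OF smooth c assms(1) E_tangent assms(2)] chart_subset[OF c] assms(1)
  by (auto simp: matrix_vector_mult_def grad_def)

lemma frame_chart_function:
  assumes p: "p \<in> U" and h: "open O'" "\<phi> p \<in> O'" "smooth_on O' h"
  shows "E i p (\<lambda>q. h (\<phi> q)) = (coeff \<phi> p *v grad h (\<phi> p)) $ i"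
proof -
  have "grad h (\<phi> p) = grad (\<lambda>x. h (\<phi> (inv_into U \<phi> x))) (\<phi> p)"
  proof (rule grad_cong[of "O' \<inter> \<phi> ` U"])
    show "smooth_on (O' \<inter> \<phi> ` U) h" using h(3) unfolding smooth_on_def by (auto intro: Ck_on_subset)
  qed (use h p chart_open[OF c] in \<open>auto simp: f_inv_into_f\<close>)
  with frame_coord[OF p smooth_near_chart[OF c p h]] show ?thesis by simp
qed

text \<open>A vector in the kernel of the transpose would be a linear relation between the frame
  vectors, first on coordinate functions and then, by \<open>frame_coord\<close>, on all
  functions.\<close>

lemma det_coeff:
  assumes p: "p \<in> U" shows "det (coeff \<phi> p) \<noteq> 0"
proof
  assume "det (coeff \<phi> p) = 0"
  then have "\<not> invertible (transpose (coeff \<phi> p))" by (simp add: invertible_det_nz)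
  then obtain s where s: "transpose (coeff \<phi> p) *v s = 0" "s \<noteq> 0"
    unfolding invertible_left_inverse matrix_left_invertible_ker by blast
  have s0: "(\<Sum>i\<in>UNIV. coeff \<phi> p $ i $ j * s $ i) = 0" for j
    using s(1) by (simp add: vec_eq_iff matrix_vector_mult_def transpose_def)
  have top: "p \<in> topspace (mtop M)" using p chart_subset[OF c] by auto
  have "(\<Sum>i\<in>UNIV. s $ i * E i p f) = 0" for f
  proof (cases "smooth_near M p f")
    case True
    let ?D = "grad (\<lambda>x. f (inv_into U \<phi> x)) (\<phi> p)"
    have "(\<Sum>i\<in>UNIV. s $ i * E i p f) = (\<Sum>i\<in>UNIV. \<Sum>j\<in>UNIV. s $ i * (coeff \<phi> p $ i $ j * ?D $ j))"
      unfolding frame_coord[OF p True] by (simp add: matrix_vector_mult_def sum_distrib_left)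
    also have "\<dots> = (\<Sum>j\<in>UNIV. \<Sum>i\<in>UNIV. s $ i * (coeff \<phi> p $ i $ j * ?D $ j))"
      by (rule sum.swap)
    also have "\<dots> = (\<Sum>j\<in>UNIV. ?D $ j * (\<Sum>i\<in>UNIV. coeff \<phi> p $ i $ j * s $ i))"
      by (simp add: sum_distrib_left mult_ac)
    finally show ?thesis unfolding s0 by simp
  next
    case False
    then show ?thesis by (simp add: tangent_not_smooth[OF E_tangent[OF top]])
  qed
  from E_independent[OF top this] s(2) show False by blast
qed

end

lemma tangent_combination:
  assumes p: "p \<in> topspace (mtop M)" and v: "v \<in> tangent_space M p"
  obtains s :: "real^'n" where "\<And>f. v f = (\<Sum>i\<in>UNIV. s $ i * E i p f)"
proof -
  obtain U \<phi> where c: "(U, \<phi>) \<in> atlas M" "p \<in> U" using ex_chart[OF p] .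
  define A where "A = coeff \<phi> p"
  have "invertible (transpose A)"
    using det_coeff[OF c] by (simp add: A_def invertible_det_nz)
  then obtain B where B: "transpose A ** B = mat 1" unfolding invertible_def by blast
  \<comment> \<open>Match \<open>v\<close> with the frame on the coordinate functions, a linear
    system with matrix \<open>transpose A\<close>; agreement on all other smooth functions then
    follows from \<open>tangent_coord\<close>.\<close>
  define s where "s = B *v (\<chi> j. v (\<lambda>q. \<phi> q $ j))"
  have s: "transpose A *v s = (\<chi> j. v (\<lambda>q. \<phi> q $ j))"
    unfolding s_def by (simp add: matrix_vector_mul_assoc B)
  have sj: "v (\<lambda>q. \<phi> q $ j) = (\<Sum>i\<in>UNIV. A $ i $ j * s $ i)" for j
    using s by (simp add: vec_eq_iff matrix_vector_mult_def transpose_def)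
  have "v f = (\<Sum>i\<in>UNIV. s $ i * E i p f)" for f
  proof (cases "smooth_near M p f")
    case True
    let ?D = "grad (\<lambda>x. f (inv_into U \<phi> x)) (\<phi> p)"
    have "v f = (\<Sum>j\<in>UNIV. v (\<lambda>q. \<phi> q $ j) * ?D $ j)"
      using tangent_coord[OF smooth c v True] by (simp add: grad_def)
    also have "\<dots> = (\<Sum>j\<in>UNIV. \<Sum>i\<in>UNIV. s $ i * (A $ i $ j * ?D $ j))"
      unfolding sj by (simp add: sum_distrib_left mult_ac)
    also have "\<dots> = (\<Sum>i\<in>UNIV. \<Sum>j\<in>UNIV. s $ i * (A $ i $ j * ?D $ j))"
      by (rule sum.swap)
    also have "\<dots> = (\<Sum>i\<in>UNIV. s $ i * E i p f)"
      unfolding frame_coord[OF c True] A_def by (simp add: matrix_vector_mult_def sum_distrib_left)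
    finally show ?thesis .
  next
    case False
    then show ?thesis by (simp add: tangent_not_smooth[OF E_tangent[OF p]] tangent_not_smooth[OF v])
  qed
  then show thesis by (rule that)
qed

text \<open>In a chart the frame derivatives are an invertible matrix times the gradient, so the
  gradient vanishes on a ball.\<close>

lemma locally_constant:
  assumes W: "openin (mtop M) W" "p \<in> W"
    and f: "\<And>q. q \<in> W \<Longrightarrow> smooth_near M q f" "\<And>q i. q \<in> W \<Longrightarrow> E i q f = 0"
  shows "\<exists>V. openin (mtop M) V \<and> p \<in> V \<and> V \<subseteq> W \<and> (\<forall>q\<in>V. f q = f p)"
proof -
  have top: "p \<in> topspace (mtop M)" using W openin_subset by blast
  obtain U \<phi> where c: "(U, \<phi>) \<in> atlas M" "p \<in> U" using ex_chart[OF top] .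
  let ?f = "\<lambda>x. f (inv_into U \<phi> x)"
  have "open (\<phi> ` (U \<inter> W))" "\<phi> p \<in> \<phi> ` (U \<inter> W)" using chart_image_open[OF c(1) W(1)] c(2) W(2) by auto
  then obtain e where e: "e > 0" "ball (\<phi> p) e \<subseteq> \<phi> ` (U \<inter> W)" by (rule openE)
  have "(?f has_derivative (\<lambda>h. 0)) (at x within ball (\<phi> p) e)" if x: "x \<in> ball (\<phi> p) e" for x
  proof -
    obtain q where q: "q \<in> U" "q \<in> W" "x = \<phi> q" using e(2) x by auto
    obtain O' where O': "open O'" "\<phi> q \<in> O'" "O' \<subseteq> \<phi> ` U" "smooth_on O' ?f"
      using smooth_near_chartD[OF c(1) q(1) f(1)[OF q(2)]] .
    have d: "(?f has_derivative frechet_derivative ?f (at x)) (at x)"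
      unfolding q(3) by (rule smooth_on_has_derivative[OF O'(4,2)])
    have "coeff \<phi> q *v grad ?f x = 0"
      using frame_coord[OF c(1) q(1) f(1)[OF q(2)]] f(2)[OF q(2)] by (simp add: vec_eq_iff q(3))
    moreover have "\<exists>B. B ** coeff \<phi> q = mat 1"
      using det_coeff[OF c(1) q(1)] invertible_det_nz invertible_left_inverse by blast
    ultimately have "grad ?f x = 0" unfolding matrix_left_invertible_ker by blast
    then have 0: "frechet_derivative ?f (at x) (axis j 1) = 0" for j
      by (simp add: grad_def vec_eq_iff)
    have "frechet_derivative ?f (at x) = (\<lambda>h. 0)"
      by (rule ext, subst linear_vec_expansion[OF has_derivative_linear[OF d]]) (simp add: 0)
    with d show ?thesis by (simp add: has_derivative_at_withinI)
  qed
  from has_derivative_zero_constant[OF convex_ball this]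
  obtain k where k: "\<And>x. x \<in> ball (\<phi> p) e \<Longrightarrow> ?f x = k" by blast
  define V where "V = {q \<in> U. \<phi> q \<in> ball (\<phi> p) e}"
  have "f q = k" if "q \<in> V" for q
    using k[of "\<phi> q"] that chart_inv[OF c(1)] by (simp add: V_def)
  moreover have "p \<in> V" using c(2) e(1) by (simp add: V_def)
  moreover have "V \<subseteq> W"
  proof
    fix q assume "q \<in> V"
    then have q: "q \<in> U" "\<phi> q \<in> \<phi> ` (U \<inter> W)" using e(2) by (auto simp: V_def)
    then obtain r where "r \<in> U" "r \<in> W" "\<phi> q = \<phi> r" by auto
    then show "q \<in> W" using inj_onD[OF chart_inj[OF c(1)], of q r] q(1) by simp
  qed
  moreover have "openin (mtop M) V" unfolding V_def by (rule chart_vimage_openin[OF c(1) open_ball])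
  ultimately show ?thesis by (intro exI[of _ V]) simp
qed

lemma constant_if_frame_zero:
  assumes conn: "connected_space (mtop M)"
    and f: "\<And>q. q \<in> topspace (mtop M) \<Longrightarrow> smooth_near M q f" "\<And>q i. q \<in> topspace (mtop M) \<Longrightarrow> E i q f = 0"
    and pq: "p \<in> topspace (mtop M)" "q \<in> topspace (mtop M)"
  shows "f q = f p"
proof -
  have o: "openin (mtop M) {q \<in> topspace (mtop M). P (f q)}" for P
  proof (subst openin_subopen, safe)
    fix q assume q: "q \<in> topspace (mtop M)" "P (f q)"
    from locally_constant[OF openin_topspace q(1) f]
    obtain V where V: "openin (mtop M) V" "q \<in> V" "V \<subseteq> topspace (mtop M)" "\<forall>r\<in>V. f r = f q" by blast
    have "P (f r)" if "r \<in> V" for r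
    proof -
      have "f r = f q" using V(4) that by blast
      then show ?thesis using q(2) by simp
    qed
    then show "\<exists>T. openin (mtop M) T \<and> q \<in> T \<and> T \<subseteq> {q \<in> topspace (mtop M). P (f q)}"
      using V(1-3) by blast
  qed
  have "topspace (mtop M) - {q \<in> topspace (mtop M). f q = f p} = {q \<in> topspace (mtop M). f q \<noteq> f p}" by auto
  then have "closedin (mtop M) {q \<in> topspace (mtop M). f q = f p}"
    using o[of "\<lambda>y. y \<noteq> f p"] by (simp add: closedin_def)
  then have "{q \<in> topspace (mtop M). f q = f p} = {} \<or> {q \<in> topspace (mtop M). f q = f p} = topspace (mtop M)"
    using o[of "\<lambda>y. y = f p"] conn unfolding connected_space_clopen_in by blast
  then show ?thesis using pq by blast
qed

text \<open>\<open>C\<close> are the structure constants of the frame and \<open>a\<close> stands for the one-form \<open>\<theta>\<close> with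
  \<open>\<theta> (E i) = a i\<close>; then \<open>closed\<close> says \<open>d\<theta> (E i, E j) = 0\<close>.\<close>

context
  fixes C :: "'n \<Rightarrow> 'n \<Rightarrow> 'n \<Rightarrow> real" and a :: "'n \<Rightarrow> 'a \<Rightarrow> real"
  assumes bracket: "\<And>p f i j. smooth_near M p f \<Longrightarrow>
      E i p (\<lambda>q. E j q f) - E j p (\<lambda>q. E i q f) = (\<Sum>k\<in>UNIV. C i j k * E k p f)"
    and a: "\<And>p i. p \<in> topspace (mtop M) \<Longrightarrow> smooth_near M p (a i)"
    and closed: "\<And>p i j. p \<in> topspace (mtop M) \<Longrightarrow> E i p (a j) - E j p (a i) = (\<Sum>k\<in>UNIV. C i j k * a k p)"
begin

text \<open>The form is rewritten in chart coordinates, where its components \<open>w\<close> solve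
  the linear system with matrix \<open>coeff \<phi>\<close> and right-hand side \<open>a\<close>;
  then the Poincare lemma applies on a ball. The work lies in translating closedness from the frame,
  where brackets contribute, to symmetry of partial derivatives.\<close>

lemma local_primitive:
  assumes p: "p \<in> topspace (mtop M)"
  shows "\<exists>W f. openin (mtop M) W \<and> p \<in> W \<and> path_connectedin (mtop M) W \<and>
    (\<forall>q\<in>W. smooth_near M q f \<and> (\<forall>i. E i q f = a i q))"
proof -
  obtain U \<phi> where c: "(U, \<phi>) \<in> atlas M" "p \<in> U" using ex_chart[OF p] .
  obtain e where e: "e > 0" "ball (\<phi> p) e \<subseteq> \<phi> ` U"
    using openE[OF chart_open[OF c(1)]] c(2) by blast
  let ?B = "ball (\<phi> p) e" and ?I = "inv_into U \<phi>"
  have Utop: "q \<in> topspace (mtop M)" if "q \<in> U" for q using chart_subset[OF c(1)] that by auto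
  have chart_smooth: "smooth_on (\<phi> ` U) (\<lambda>x. f (?I x))" if "\<And>q. q \<in> U \<Longrightarrow> smooth_near M q f" for f
  proof -
    have "smooth_fun_on M U f" using smooth_fun_on_iff chart_openin[OF c(1)] that by blast
    then show ?thesis using c(1) unfolding smooth_fun_on_def by fastforce
  qed
  have coord: "smooth_near M q (\<lambda>q. \<phi> q $ j)" if "q \<in> U" for q j
    by (rule smooth_near_coord[OF c(1) that bounded_linear_vec_nth])
  have "\<exists>u. coeff \<phi> (?I x) *v u = (\<chi> i. a i (?I x))" if "x \<in> \<phi> ` U" for x
  proof -
    have "invertible (coeff \<phi> (?I x))"
      using det_coeff[OF c(1) inv_into_into[OF that]] by (simp add: invertible_det_nz)
    then obtain B where "coeff \<phi> (?I x) ** B = mat 1" unfolding invertible_def by blast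
    then show ?thesis
      by (intro exI[of _ "B *v (\<chi> i. a i (?I x))"]) (simp add: matrix_vector_mul_assoc)
  qed
  then obtain w where w: "\<And>x. x \<in> \<phi> ` U \<Longrightarrow> coeff \<phi> (?I x) *v w x = (\<chi> i. a i (?I x))"
    by metis
  \<comment> \<open>\<open>w\<close> was chosen point by point; it is smooth all the same, as the
    unique solution of a linear system with smooth coefficients.\<close>
  have w_smooth': "Ck_on n w (\<phi> ` U)" for n
  proof (rule Ck_on_linear_system[OF chart_open[OF c(1)] _ _ _ w])
    show "Ck_on n (\<lambda>x. coeff \<phi> (?I x) $ i $ j) (\<phi> ` U)" for i j
      unfolding coeff_nth by (rule smooth_onD[OF chart_smooth[OF E_smooth_near[OF coord]]])
    show "Ck_on n (\<lambda>x. (\<chi> i. a i (?I x)) $ i) (\<phi> ` U)" for i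
      by (simp add: smooth_onD[OF chart_smooth[OF a[OF Utop]]])
    show "det (coeff \<phi> (?I x)) \<noteq> 0" if "x \<in> \<phi> ` U" for x
      by (rule det_coeff[OF c(1) inv_into_into[OF that]])
  qed
  then have w_smooth: "smooth_on (\<phi> ` U) (\<lambda>x. w x $ l)" for l
    unfolding smooth_on_def using Ck_on_vec_nth[OF chart_open[OF c(1)]] by blast
  have aw: "a j q = (\<Sum>l\<in>UNIV. E j q (\<lambda>q. \<phi> q $ l) * w (\<phi> q) $ l)" if "q \<in> U" for q j
    using w[OF imageI[OF that]] chart_inv[OF c(1) that] by (simp add: vec_eq_iff matrix_vector_mult_def)
  have w_near: "smooth_near M q (\<lambda>q. w (\<phi> q) $ l)" if "q \<in> U" for q l
    by (rule smooth_near_chart[OF c(1) that chart_open[OF c(1)] imageI[OF that] w_smooth])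
  have w_closed: "grad (\<lambda>x. w x $ k) x $ l = grad (\<lambda>x. w x $ l) x $ k" if x: "x \<in> \<phi> ` U" for x k l
  proof -
    obtain q where q: "q \<in> U" "x = \<phi> q" using x by blast
    define A where "A = coeff \<phi> q"
    define G where "G k l = grad (\<lambda>x. w x $ l) x $ k" for k l
    \<comment> \<open>The product rule for \<open>a j\<close>: the first sum holds iterated frame
      derivatives, which combine to brackets after antisymmetrizing in \<open>i\<close> and
      \<open>j\<close>; the second holds the partial derivatives \<open>G\<close>.\<close>
    have Ea: "E i q (a j) = (\<Sum>l\<in>UNIV. E i q (\<lambda>r. E j r (\<lambda>q. \<phi> q $ l)) * w x $ l) +
        (\<Sum>l\<in>UNIV. \<Sum>k\<in>UNIV. A $ j $ l * (A $ i $ k * G k l))" for i j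
    proof -
      note Eq = E_tangent[OF Utop[OF q(1)]]
      have "E i q (a j) = E i q (\<lambda>r. \<Sum>l\<in>UNIV. E j r (\<lambda>q. \<phi> q $ l) * w (\<phi> r) $ l)"
        by (rule tangent_cong[OF chart_openin[OF c(1)] q(1) aw Eq])
      also have "\<dots> = (\<Sum>l\<in>UNIV. E i q (\<lambda>r. E j r (\<lambda>q. \<phi> q $ l) * w (\<phi> r) $ l))"
        by (intro tangent_sum[OF Utop[OF q(1)] Eq] smooth_near_mult E_smooth_near coord w_near q(1))
      also have "\<dots> = (\<Sum>l\<in>UNIV. A $ j $ l * E i q (\<lambda>r. w (\<phi> r) $ l) + w x $ l * E i q (\<lambda>r. E j r (\<lambda>q. \<phi> q $ l)))"
        unfolding q(2) A_def coeff_nth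
        by (intro sum.cong refl tangent_mult[OF Eq] E_smooth_near coord w_near q(1))
      also have "\<dots> = (\<Sum>l\<in>UNIV. A $ j $ l * (\<Sum>k\<in>UNIV. A $ i $ k * G k l) + w x $ l * E i q (\<lambda>r. E j r (\<lambda>q. \<phi> q $ l)))"
        using frame_chart_function[OF c(1) q(1) chart_open[OF c(1)] imageI[OF q(1)] w_smooth]
        by (simp add: G_def A_def q(2) matrix_vector_mult_def)
      finally show ?thesis by (simp add: sum.distrib sum_distrib_left mult.commute)
    qed
    have "(\<Sum>l\<in>UNIV. \<Sum>k\<in>UNIV. A $ j $ l * (A $ i $ k * G k l)) =
        (\<Sum>l\<in>UNIV. \<Sum>k\<in>UNIV. A $ i $ l * (A $ j $ k * G k l))" for i j
    proof -
      \<comment> \<open>The brackets alone already account for the whole of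
        \<open>E i q (a j) - E j q (a i)\<close>, by \<open>closed\<close>; hence the sums with
        \<open>G\<close> must be symmetric in \<open>i\<close> and \<open>j\<close>.\<close>
      have "(\<Sum>l\<in>UNIV. E i q (\<lambda>r. E j r (\<lambda>q. \<phi> q $ l)) * w x $ l) -
          (\<Sum>l\<in>UNIV. E j q (\<lambda>r. E i r (\<lambda>q. \<phi> q $ l)) * w x $ l) =
          (\<Sum>l\<in>UNIV. (\<Sum>m\<in>UNIV. C i j m * E m q (\<lambda>q. \<phi> q $ l)) * w x $ l)"
        using bracket[OF coord[OF q(1)]] by (simp flip: sum_subtractf left_diff_distrib)
      also have "\<dots> = (\<Sum>l\<in>UNIV. \<Sum>m\<in>UNIV. C i j m * (E m q (\<lambda>q. \<phi> q $ l) * w x $ l))"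
        by (simp add: sum_distrib_right mult.assoc)
      also have "\<dots> = (\<Sum>m\<in>UNIV. \<Sum>l\<in>UNIV. C i j m * (E m q (\<lambda>q. \<phi> q $ l) * w x $ l))"
        by (rule sum.swap)
      also have "\<dots> = (\<Sum>m\<in>UNIV. C i j m * a m q)"
        unfolding aw[OF q(1)] q(2) by (simp add: sum_distrib_left)
      also have "\<dots> = E i q (a j) - E j q (a i)" by (rule closed[OF Utop[OF q(1)], symmetric])
      finally show ?thesis unfolding Ea by simp
    qed
    also have "(\<Sum>l\<in>UNIV. \<Sum>k\<in>UNIV. A $ i $ l * (A $ j $ k * G k l)) =
        (\<Sum>l\<in>UNIV. \<Sum>k\<in>UNIV. A $ j $ l * (A $ i $ k * G l k))" for i j
      by (subst sum.swap) (simp add: mult.left_commute)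
    finally have AGA: "(\<Sum>l\<in>UNIV. \<Sum>k\<in>UNIV. A $ j $ l * (A $ i $ k * G k l)) =
        (\<Sum>l\<in>UNIV. \<Sum>k\<in>UNIV. A $ j $ l * (A $ i $ k * G l k))" for i j .
    \<comment> \<open>Up to a factor 2, \<open>Z\<close> is the antisymmetric part of the matrix of
      partial derivatives. \<open>AGA\<close> says that the product of \<open>A\<close>,
      \<open>Z\<close> and the transpose of \<open>A\<close> is 0, and the invertible
      \<open>A\<close> is cancelled on one side and then on the other.\<close>
    define Z where "Z = (\<chi> k l. G k l - G l k)"
    have inv: "\<exists>B. B ** A = mat 1"
      using det_coeff[OF c(1) q(1)] invertible_det_nz invertible_left_inverse unfolding A_def by blast
    have "A *v (\<chi> l. (A *v column l Z) $ i) = 0" for i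
    proof -
      have "(A *v (\<chi> l. (A *v column l Z) $ i)) $ j = (\<Sum>l\<in>UNIV. \<Sum>k\<in>UNIV. A $ j $ l * (A $ i $ k * (G k l - G l k)))" for j
        by (simp add: matrix_vector_mult_def column_def Z_def sum_distrib_left)
      also have "\<dots> j = 0" for j
        using AGA[of j i] by (simp add: right_diff_distrib sum_subtractf)
      finally show ?thesis by (simp add: vec_eq_iff)
    qed
    then have "(\<chi> l. (A *v column l Z) $ i) = 0" for i
      using inv unfolding matrix_left_invertible_ker by blast
    then have "A *v column l Z = 0" for l by (simp add: vec_eq_iff)
    then have "column l Z = 0" for l using inv unfolding matrix_left_invertible_ker by blast
    then have "G k l - G l k = 0" by (simp add: vec_eq_iff column_def Z_def)
    then show ?thesis by (simp add: G_def)
  qed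
  have wB: "smooth_on ?B (\<lambda>x. w x $ i)" for i
    using w_smooth[of i] e(2) unfolding smooth_on_def by (auto intro: Ck_on_subset)
  have clB: "frechet_derivative (\<lambda>x. w x $ i) (at x) (axis j 1) = frechet_derivative (\<lambda>x. w x $ j) (at x) (axis i 1)"
    if "x \<in> ?B" for x i j
    using w_closed[of x i j] that e(2) by (auto simp: grad_def)
  have pB: "\<phi> p \<in> ?B" using e by simp
  obtain F where F: "smooth_on ?B F"
    "\<And>x. x \<in> ?B \<Longrightarrow> (F has_derivative (\<lambda>v. \<Sum>i\<in>UNIV. v $ i * w x $ i)) (at x)"
    using poincare_primitive[OF open_ball convex_ball pB wB clB] by blast
  have grad_F: "grad F x = w x" if "x \<in> ?B" for x
    using frechet_derivative_at[OF F(2)[OF that], symmetric]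
    by (simp add: grad_def vec_eq_iff axis_def if_distrib[of "\<lambda>y. y * _"] cong: if_cong)
  define W where "W = {q \<in> U. \<phi> q \<in> ?B}"
  have "openin (mtop M) W" unfolding W_def by (rule chart_vimage_openin[OF c(1) open_ball])
  moreover have "p \<in> W" using c(2) e(1) by (simp add: W_def)
  \<comment> \<open>\<open>local_system\<close> wants path connected domains; \<open>W\<close> is
    the image of a ball under the inverse chart.\<close>
  moreover have "path_connectedin (mtop M) W"
  proof -
    have "path_connectedin (top_of_set (\<phi> ` U)) ?B"
      using e(2) by (simp add: path_connectedin_subtopology convex_imp_path_connected)
    from path_connectedin_continuous_map_image[OF chart_inv_continuous[OF c(1)] this]
    have "path_connectedin (mtop M) (?I ` ?B)" .
    also have "?I ` ?B = W"
    proof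
      show "?I ` ?B \<subseteq> W" using e(2) by (auto simp: W_def f_inv_into_f inv_into_into subset_iff)
      show "W \<subseteq> ?I ` ?B" unfolding W_def using chart_inv[OF c(1)] by force
    qed
    finally show ?thesis .
  qed
  moreover have "smooth_near M q (\<lambda>q. F (\<phi> q)) \<and> (\<forall>i. E i q (\<lambda>q. F (\<phi> q)) = a i q)" if "q \<in> W" for q
  proof -
    have q: "q \<in> U" "\<phi> q \<in> ?B" using that by (auto simp: W_def)
    have "E i q (\<lambda>q. F (\<phi> q)) = a i q" for i
      using w[OF imageI[OF q(1)]] frame_chart_function[OF c(1) q(1) open_ball q(2) F(1)]
      by (simp add: grad_F[OF q(2)] vec_eq_iff chart_inv[OF c(1) q(1)])
    then show ?thesis using smooth_near_chart[OF c(1) q(1) open_ball q(2) F(1)] by blast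
  qed
  ultimately show ?thesis by blast
qed

text \<open>Local primitives form a \<open>local_system\<close>, since the difference of two of them
  has vanishing frame derivatives. The function from \<open>global_function\<close> differs from
  each of them by a constant on its domain and so is a primitive itself.\<close>

theorem global_primitive:
  assumes X: "simply_connected_space (mtop M)"
  obtains F where "\<And>p. p \<in> topspace (mtop M) \<Longrightarrow> smooth_near M p F"
    "\<And>p i. p \<in> topspace (mtop M) \<Longrightarrow> E i p F = a i p"
proof -
  define \<F> where "\<F> = {(W, f). openin (mtop M) W \<and> path_connectedin (mtop M) W \<and>
    (\<forall>q\<in>W. smooth_near M q f \<and> (\<forall>i. E i q f = a i q))}"
  interpret local_system "mtop M" \<F>
  proof
    show "path_connectedin (mtop M) U" if "(U, f) \<in> \<F>" for U f using that by (simp add: \<F>_def)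
    show "\<exists>U f. (U, f) \<in> \<F> \<and> openin (mtop M) U \<and> p \<in> U" if "p \<in> topspace (mtop M)" for p
      using local_primitive[OF that] unfolding \<F>_def by blast
    show "\<exists>W. openin (mtop M) W \<and> p \<in> W \<and> (\<forall>q\<in>W. f q - g q = f p - g p)"
      if "(U, f) \<in> \<F>" "(V, g) \<in> \<F>" "p \<in> U" "p \<in> V" for U f V g p
    proof -
      have f: "smooth_near M q f" "E i q f = a i q" and g: "smooth_near M q g" "E i q g = a i q"
        if "q \<in> U \<inter> V" for q i using that \<open>(U, f) \<in> \<F>\<close> \<open>(V, g) \<in> \<F>\<close> by (auto simp: \<F>_def)
      have "openin (mtop M) (U \<inter> V)" "p \<in> U \<inter> V" using that by (auto simp: \<F>_def)
      from locally_constant[OF this, of "\<lambda>q. f q - g q"]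
      show ?thesis
        using smooth_near_diff[OF f(1) g(1)] tangent_diff[OF E_tangent[OF smooth_near_topspace[OF f(1)]] f(1) g(1)] f(2) g(2)
        by auto
    qed
  qed
  obtain F where F: "\<And>U f p q. (U, f) \<in> \<F> \<Longrightarrow> p \<in> U \<Longrightarrow> q \<in> U \<Longrightarrow> F q - f q = F p - f p"
    using global_function[OF X] by blast
  have "smooth_near M p F \<and> (\<forall>i. E i p F = a i p)" if p: "p \<in> topspace (mtop M)" for p
  proof -
    obtain U f where U: "openin (mtop M) U" "p \<in> U" "(U, f) \<in> \<F>" using cover[OF p] by blast
    have f: "smooth_near M p f" "\<And>i. E i p f = a i p" using U by (auto simp: \<F>_def)
    have e: "f q + (F p - f p) = F q" if "q \<in> U" for q using F[OF U(3,2) that] by simp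
    have k: "smooth_near M p (\<lambda>q. F p - f p)" by (rule smooth_near_const[OF p])
    have "E i p F = a i p" for i
      using tangent_cong[OF U(1,2) e E_tangent[OF p]] tangent_add[OF E_tangent[OF p] f(1) k]
        tangent_const[OF p E_tangent[OF p]] f(2) by simp
    then show ?thesis using smooth_near_cong[OF U(1,2) e smooth_near_add[OF f(1) k]] by blast
  qed
  then show thesis using that by blast
qed

end

end


section \<open>Maps with invertible differential\<close>

context frame
begin

context
  fixes F :: "'a \<Rightarrow> real^'n"
  assumes F: "\<And>p j. p \<in> topspace (mtop M) \<Longrightarrow> smooth_near M p (\<lambda>q. F q $ j)"
begin

lemma smooth_on_chart_map:
  assumes c: "(U, \<phi>) \<in> atlas M"
  shows "smooth_on (\<phi> ` U) (\<lambda>x. F (inv_into U \<phi> x))"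
  unfolding smooth_on_def
proof (intro allI Ck_on_vecI chart_open[OF c])
  fix n j
  have "smooth_fun_on M U (\<lambda>q. F q $ j)"
    using smooth_fun_on_iff chart_openin[OF c] F chart_subset[OF c] by blast
  then have "smooth_on (\<phi> ` (U \<inter> U)) (\<lambda>x. F (inv_into U \<phi> x) $ j)"
    using c unfolding smooth_fun_on_def by fast
  then show "Ck_on n (\<lambda>x. F (inv_into U \<phi> x) $ j) (\<phi> ` U)" by (simp add: smooth_on_def)
qed

lemma continuous_map_smooth: "continuous_map (mtop M) euclidean F"
  unfolding continuous_map
proof (intro conjI allI impI)
  fix W :: "(real^'n) set" assume "openin euclidean W"
  then have W: "open W" by simp
  show "openin (mtop M) {p \<in> topspace (mtop M). F p \<in> W}"
  proof (subst openin_subopen, intro ballI)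
    fix p assume p: "p \<in> {p \<in> topspace (mtop M). F p \<in> W}"
    then obtain U \<phi> where c: "(U, \<phi>) \<in> atlas M" "p \<in> U" using ex_chart by blast
    let ?O = "(\<lambda>x. F (inv_into U \<phi> x)) -` W \<inter> \<phi> ` U"
    have "open ?O"
      using smooth_on_imp_continuous_on[OF smooth_on_chart_map[OF c(1)]] chart_open[OF c(1)] W
      by (simp add: continuous_on_open_vimage)
    then have "openin (mtop M) {q \<in> U. \<phi> q \<in> ?O}" by (rule chart_vimage_openin[OF c(1)])
    moreover have "{q \<in> U. \<phi> q \<in> ?O} = {q \<in> U. F q \<in> W}"
      using chart_inv[OF c(1)] by (auto simp: inj_on_eq_iff[OF chart_inj[OF c(1)]])
    ultimately show "\<exists>T. openin (mtop M) T \<and> p \<in> T \<and> T \<subseteq> {p \<in> topspace (mtop M). F p \<in> W}"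
      using p c chart_subset[OF c(1)] by (intro exI[of _ "{q \<in> U. F q \<in> W}"]) auto
  qed
qed auto

context
  fixes U \<phi>
  assumes c: "(U, \<phi>) \<in> atlas M"
begin

definition jacobian :: "real^'n \<Rightarrow> real^'n^'n" where
  "jacobian x = (\<chi> k j. frechet_derivative (\<lambda>x. F (inv_into U \<phi> x)) (at x) (axis j 1) $ k)"

lemma has_derivative_jacobian:
  assumes "x \<in> \<phi> ` U"
  shows "((\<lambda>x. F (inv_into U \<phi> x)) has_derivative (\<lambda>v. jacobian x *v v)) (at x)"
proof -
  have d: "((\<lambda>x. F (inv_into U \<phi> x)) has_derivative frechet_derivative (\<lambda>x. F (inv_into U \<phi> x)) (at x)) (at x)"
    by (rule smooth_on_has_derivative[OF smooth_on_chart_map[OF c] assms])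
  moreover have "frechet_derivative (\<lambda>x. F (inv_into U \<phi> x)) (at x) = (\<lambda>v. jacobian x *v v)"
    by (rule ext, subst linear_vec_expansion[OF has_derivative_linear[OF d]])
       (simp add: vec_eq_iff matrix_vector_mult_def jacobian_def mult.commute)
  ultimately show ?thesis by simp
qed

lemma Ck_on_jacobian: "Ck_on n (\<lambda>x. jacobian x $ k $ j) (\<phi> ` U)"
  unfolding jacobian_def
  using Ck_on_vec_nth[OF chart_open[OF c] smooth_onD[OF smooth_on_frechet_derivative[OF smooth_on_chart_map[OF c]]]]
  by simp

text \<open>By the chain rule \<open>coeff F\<close> is \<open>coeff \<phi>\<close> times the
  transposed Jacobian in the chart.\<close>

lemma det_jacobian:
  assumes p: "p \<in> U" and "det (coeff F p) \<noteq> 0"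
  shows "det (jacobian (\<phi> p)) \<noteq> 0"
proof -
  have top: "p \<in> topspace (mtop M)" using p chart_subset[OF c] by blast
  have "coeff F p = coeff \<phi> p ** transpose (jacobian (\<phi> p))"
  proof -
    have g: "grad (\<lambda>x. F (inv_into U \<phi> x) $ j) (\<phi> p) $ k = jacobian (\<phi> p) $ j $ k" for j k
    proof -
      have "((\<lambda>x. F (inv_into U \<phi> x) $ j) has_derivative (\<lambda>v. (jacobian (\<phi> p) *v v) $ j)) (at (\<phi> p))"
        using bounded_linear.has_derivative[OF bounded_linear_vec_nth has_derivative_jacobian[OF imageI[OF p]]] .
      from frechet_derivative_at[OF this, symmetric] show ?thesis
        by (simp add: grad_def matrix_vector_mul_component inner_axis)
    qed
    show ?thesis
      using frame_coord[OF c p F[OF top]]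
      by (simp add: vec_eq_iff matrix_matrix_mult_def matrix_vector_mult_def transpose_def g)
  qed
  then show ?thesis using assms(2) by (auto simp: det_mul)
qed

end

text \<open>The inverse function theorem read through a chart. Injectivity on \<open>U\<close> and
  the continuous section on \<open>V\<close> are what the lifting of one-parameter subgroups builds
  on.\<close>

lemma local_section:
  assumes p: "p \<in> topspace (mtop M)" and det: "det (coeff F p) \<noteq> 0"
  obtains U V \<sigma> where "openin (mtop M) U" "p \<in> U" "inj_on F U" "open V" "F p \<in> V"
    "continuous_map (top_of_set V) (mtop M) \<sigma>" "\<And>y. y \<in> V \<Longrightarrow> \<sigma> y \<in> U \<and> F (\<sigma> y) = y"
proof -
  obtain U \<phi> where c: "(U, \<phi>) \<in> atlas M" "p \<in> U" using ex_chart[OF p] .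
  let ?f = "\<lambda>x. F (inv_into U \<phi> x)" and ?J = "jacobian U \<phi>"
  define f' where "f' x = Blinfun (\<lambda>v. ?J x *v v)" for x
  have f': "blinfun_apply (f' x) = (\<lambda>v. ?J x *v v)" for x
    unfolding f'_def by (rule bounded_linear_Blinfun_apply) simp
  have "continuous_on (\<phi> ` U) f'"
  proof (rule continuous_on_blinfun_componentwise)
    fix i :: "real^'n"
    have cont: "continuous_on (\<phi> ` U) (\<lambda>x. ?J x $ k $ j)" for k j
      by (rule Ck_on_imp_continuous_on[OF Ck_on_jacobian[OF c(1)]])
    show "continuous_on (\<phi> ` U) (\<lambda>x. blinfun_apply (f' x) i)"
      unfolding f' matrix_vector_mult_def
      by (intro continuous_on_vec_lambda continuous_on_sum continuous_on_mult continuous_on_const cont)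
  qed
  moreover obtain B where B: "B ** ?J (\<phi> p) = mat 1"
    using det_jacobian[OF c det] invertible_det_nz invertible_left_inverse by blast
  have "Blinfun (\<lambda>v. B *v v) o\<^sub>L f' (\<phi> p) = id_blinfun"
    by (rule blinfun_eqI) (simp add: f' bounded_linear_Blinfun_apply matrix_vector_mul_assoc B)
  ultimately obtain U' V g g' where UV: "open U'" "U' \<subseteq> \<phi> ` U" "\<phi> p \<in> U'" "open V" "?f (\<phi> p) \<in> V"
      "homeomorphism U' V ?f g"
    using inverse_function_theorem[OF chart_open[OF c(1)], of ?f f' "\<phi> p"]
      has_derivative_jacobian[OF c(1)] c(2) f' by (metis imageI)
  have inv: "inv_into U \<phi> (\<phi> q) = q" if "q \<in> U" for q by (rule chart_inv[OF c(1) that])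
  show thesis
  proof (rule that[of "{q \<in> U. \<phi> q \<in> U'}" V "\<lambda>y. inv_into U \<phi> (g y)"])
    show "openin (mtop M) {q \<in> U. \<phi> q \<in> U'}" by (rule chart_vimage_openin[OF c(1) UV(1)])
    show "p \<in> {q \<in> U. \<phi> q \<in> U'}" using c UV by simp
    show "inj_on F {q \<in> U. \<phi> q \<in> U'}"
    proof (rule inj_onI)
      fix q r assume qr: "q \<in> {q \<in> U. \<phi> q \<in> U'}" "r \<in> {q \<in> U. \<phi> q \<in> U'}" "F q = F r"
      then have "g (?f (\<phi> q)) = g (?f (\<phi> r))" using inv by simp
      then have "\<phi> q = \<phi> r" using homeomorphism_apply1[OF UV(6)] qr by simp
      then show "q = r" using inv qr by (metis (no_types, lifting) mem_Collect_eq)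
    qed
    show "F p \<in> V" using UV(5) inv[OF c(2)] by simp
    have gV: "g y \<in> U'" "?f (g y) = y" if "y \<in> V" for y
      using UV(6) that unfolding homeomorphism_def by auto
    then show "inv_into U \<phi> (g y) \<in> {q \<in> U. \<phi> q \<in> U'} \<and> F (inv_into U \<phi> (g y)) = y" if "y \<in> V" for y
      using that UV(2) by (auto simp: f_inv_into_f inv_into_into subset_iff)
    have "continuous_map (top_of_set V) (top_of_set (\<phi> ` U)) g"
      using UV(2,6) gV unfolding homeomorphism_def by (auto simp: continuous_map_in_subtopology)
    from continuous_map_compose[OF this chart_inv_continuous[OF c(1)]]
    show "continuous_map (top_of_set V) (mtop M) (\<lambda>y. inv_into U \<phi> (g y))" by (simp add: o_def)
  qed (rule UV)
qed

text \<open>\<open>F'\<close> is only continuous at the outset. Its derivative is the inverse of the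
  Jacobian of \<open>F\<close> at \<open>F'\<close>, which solves a linear system whose coefficients
  are as regular as \<open>F'\<close>; so each order of smoothness yields the next.\<close>

lemma smooth_on_inverse:
  assumes det: "\<And>p. p \<in> topspace (mtop M) \<Longrightarrow> det (coeff F p) \<noteq> 0"
    and T: "open T" and F': "continuous_map (top_of_set T) (mtop M) F'" "\<And>y. y \<in> T \<Longrightarrow> F (F' y) = y"
    and c: "(V, \<psi>) \<in> atlas M"
  shows "smooth_on {y \<in> T. F' y \<in> V} (\<lambda>y. \<psi> (F' y))"
proof -
  define T' where "T' = {y \<in> T. F' y \<in> V}"
  define g where "g y = \<psi> (F' y)" for y
  let ?f = "\<lambda>x. F (inv_into V \<psi> x)" and ?J = "jacobian V \<psi>"
  have "openin (top_of_set T) {y \<in> topspace (top_of_set T). F' y \<in> V}"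
    by (rule openin_continuous_map_preimage[OF F'(1) chart_openin[OF c]])
  then have T': "open T'" using T by (simp add: T'_def openin_open_eq)
  have gV: "g y \<in> \<psi> ` V" if "y \<in> T'" for y using that by (simp add: g_def T'_def)
  have fg: "?f (g y) = y" if "y \<in> T'" for y
    using that F'(2) chart_inv[OF c] by (simp add: g_def T'_def)
  have "continuous_map (top_of_set T') (subtopology (mtop M) V) F'"
    using continuous_map_from_subtopology_mono[OF F'(1), of T'] unfolding T'_def
    by (auto simp: continuous_map_in_subtopology)
  from continuous_map_compose[OF this homeomorphic_imp_continuous_map[OF chart_homeomorphic[OF c]]]
  have gc: "continuous_on T' g"
    by (auto simp: continuous_map_in_subtopology g_def o_def)
  have detJ: "det (?J (g y)) \<noteq> 0" if "y \<in> T'" for y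
    using det_jacobian[OF c _ det] that chart_subset[OF c] by (auto simp: g_def T'_def)
  then have "\<exists>B. B ** ?J (g y) = mat 1 \<and> ?J (g y) ** B = mat 1" if "y \<in> T'" for y
    using that invertible_det_nz[of "?J (g y)"] unfolding invertible_def by blast
  then obtain B where B: "\<And>y. y \<in> T' \<Longrightarrow> B y ** ?J (g y) = mat 1 \<and> ?J (g y) ** B y = mat 1"
    by metis
  have der: "(g has_derivative (\<lambda>v. B y *v v)) (at y)" if y: "y \<in> T'" for y
  proof (rule has_derivative_inverse_basic[OF has_derivative_jacobian[OF c gV[OF y]] _ _ _ T' y fg])
    show "(\<lambda>v. B y *v v) \<circ> (\<lambda>v. ?J (g y) *v v) = id"
      using B[OF y] by (auto simp: matrix_vector_mul_assoc)
    show "isCont g y" using gc T' y by (simp add: continuous_on_eq_continuous_at)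
  qed simp
  have "Ck_on n g T'" for n
  proof (induction n)
    case 0
    then show ?case using gc by simp
  next
    case (Suc n)
    show ?case
    proof (rule Ck_on_SucI[OF T' der])
      show "Ck_on n (\<lambda>y. B y *v v) T'" for v
      proof (rule Ck_on_linear_system[OF T'])
        show "Ck_on n (\<lambda>y. ?J (g y) $ i $ j) T'" for i j
          by (rule Ck_on_compose[OF T' _ Ck_on_jacobian[OF c] Suc]) (use gV in auto)
        show "Ck_on n (\<lambda>y. v $ i) T'" for i by (rule Ck_on_const)
        show "?J (g y) *v (B y *v v) = v" if "y \<in> T'" for y
          using B[OF that] by (simp add: matrix_vector_mul_assoc)
      qed (rule detJ)
    qed
  qed
  then show ?thesis unfolding smooth_on_def T'_def g_def by blast
qed

end

end

lemma tangent_chain: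
  fixes M :: "('a, real^'n) manifold"
  assumes M: "smooth_manifold M" and p: "p \<in> topspace (mtop M)" and v: "v \<in> tangent_space M p"
    and f: "smooth_near M p f" and h: "smooth_on UNIV h" "(h has_real_derivative h') (at (f p))"
  shows "v (\<lambda>q. h (f q)) = h' * v f"
proof -
  interpret smooth_mfld M by standard (rule M)
  obtain U \<phi> where c: "(U, \<phi>) \<in> atlas M" "p \<in> U" using ex_chart[OF p] .
  let ?f = "\<lambda>x. f (inv_into U \<phi> x)"
  obtain O' where O': "open O'" "\<phi> p \<in> O'" "O' \<subseteq> \<phi> ` U" "smooth_on O' ?f"
    using smooth_near_chartD[OF c f] .
  have d: "(?f has_derivative frechet_derivative ?f (at (\<phi> p))) (at (\<phi> p))"
    by (rule smooth_on_has_derivative[OF O'(4,2)])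
  have "(h has_derivative (*) h') (at (?f (\<phi> p)))"
    using h(2) chart_inv[OF c] by (simp add: has_field_derivative_def)
  from frechet_derivative_at[OF has_derivative_compose[OF d this], symmetric]
  show ?thesis
    unfolding tangent_coord[OF M c v f] tangent_coord[OF M c v smooth_near_compose[OF h(1) f]]
    by (simp add: sum_distrib_left mult_ac)
qed

text \<open>\<open>smooth_map_compose\<close> would ask for \<open>prod_manifold M M\<close> to be a
  smooth manifold. Instead the work is done in charts, where inserting \<open>a\<close> as first
  factor is the affine map from \<open>x\<close> to \<open>(\<phi>0 a, x)\<close>.\<close>

lemma left_translation_smooth:
  fixes M :: "('a, 'e::euclidean_space) manifold"
  assumes G: "lie_group G M" and a: "a \<in> carrier G"
  shows "smooth_map M M (\<lambda>q. a \<otimes>\<^bsub>G\<^esub> q)"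
proof -
  have M: "smooth_manifold M" and carr: "carrier G = topspace (mtop M)"
    and mult: "smooth_map (prod_manifold M M) M (\<lambda>(x, y). x \<otimes>\<^bsub>G\<^esub> y)"
    using G unfolding lie_group_def by auto
  interpret smooth_mfld M by standard (rule M)
  have cm: "continuous_map (prod_topology (mtop M) (mtop M)) (mtop M) (\<lambda>(x, y). x \<otimes>\<^bsub>G\<^esub> y)"
    using mult unfolding smooth_map_def prod_manifold_def by simp
  have "continuous_map (mtop M) (prod_topology (mtop M) (mtop M)) (\<lambda>q. (a, q))"
    using a carr by (auto intro!: continuous_map_pairedI)
  from continuous_map_compose[OF this cm]
  have cont: "continuous_map (mtop M) (mtop M) (\<lambda>q. a \<otimes>\<^bsub>G\<^esub> q)" by (simp add: o_def)
  obtain U0 \<phi>0 where c0: "(U0, \<phi>0) \<in> atlas M" "a \<in> U0" using ex_chart a carr by blast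
  have "Ck_on n (\<lambda>x. \<psi> (a \<otimes>\<^bsub>G\<^esub> inv_into U \<phi> x)) (\<phi> ` {p \<in> U. a \<otimes>\<^bsub>G\<^esub> p \<in> V})"
    if c: "(U, \<phi>) \<in> atlas M" and d: "(V, \<psi>) \<in> atlas M" for U \<phi> V \<psi> n
  proof -
    let ?\<Phi> = "map_prod \<phi>0 \<phi>" and ?S = "\<phi> ` {p \<in> U. a \<otimes>\<^bsub>G\<^esub> p \<in> V}"
    have e: "{p \<in> U. a \<otimes>\<^bsub>G\<^esub> p \<in> V} = U \<inter> {p \<in> topspace (mtop M). a \<otimes>\<^bsub>G\<^esub> p \<in> V}"
      using chart_subset[OF c] by auto
    have S: "open ?S" unfolding e
      by (intro chart_image_open[OF c] openin_continuous_map_preimage[OF cont] chart_openin[OF d])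
    have "(U0 \<times> U, ?\<Phi>) \<in> atlas (prod_manifold M M)"
      using c c0 unfolding prod_manifold_def by auto
    then have "smooth_on (?\<Phi> ` {z \<in> U0 \<times> U. (case z of (x, y) \<Rightarrow> x \<otimes>\<^bsub>G\<^esub> y) \<in> V})
        (\<lambda>z. \<psi> (case inv_into (U0 \<times> U) ?\<Phi> z of (x, y) \<Rightarrow> x \<otimes>\<^bsub>G\<^esub> y))"
      using mult d unfolding smooth_map_def by fast
    note sm = smooth_onD[OF this, of n]
    have "bounded_linear (\<lambda>x. (0 :: 'e, x :: 'e))"
      by (intro bounded_linear_Pair bounded_linear_zero bounded_linear_ident)
    then have "Ck_on n (\<lambda>x. (\<phi>0 a, 0) + (0, x)) ?S"
      by (intro Ck_on_add S Ck_on_const Ck_on_bounded_linear_id)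
    then have g: "Ck_on n (\<lambda>x. (\<phi>0 a, x)) ?S" by simp
    have inj: "inj_on ?\<Phi> (U0 \<times> U)"
      using chart_inj[OF c] chart_inj[OF c0(1)] by (auto simp: inj_on_def)
    have iv: "inv_into (U0 \<times> U) ?\<Phi> (\<phi>0 a, \<phi> p) = (a, p)" if "p \<in> U" for p
      using inv_into_f_f[OF inj, of "(a, p)"] that c0 by simp
    have "Ck_on n (\<lambda>x. \<psi> (case inv_into (U0 \<times> U) ?\<Phi> (\<phi>0 a, x) of (x, y) \<Rightarrow> x \<otimes>\<^bsub>G\<^esub> y)) ?S"
    proof (rule Ck_on_compose[OF S _ sm g], safe)
      fix p assume "p \<in> U" "a \<otimes>\<^bsub>G\<^esub> p \<in> V"
      then show "(\<phi>0 a, \<phi> p) \<in> ?\<Phi> ` {z \<in> U0 \<times> U. (case z of (x, y) \<Rightarrow> x \<otimes>\<^bsub>G\<^esub> y) \<in> V}"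
        using c0 by (intro image_eqI[of _ _ "(a, p)"]) auto
    qed
    then show ?thesis
      by (rule Ck_on_cong[OF S, rotated]) (auto simp: iv chart_inv[OF c])
  qed
  then show ?thesis using cont unfolding smooth_map_def smooth_on_def by auto
qed


section \<open>Left invariant frames acting by spiral similarities\<close>

text \<open>\<open>ecos\<close> and \<open>esin\<close> are the real and imaginary parts of exp ((1
  + i \<beta>) s); the lemmas below are the laws of this complex exponential in real terms.\<close>

definition ecos :: "real \<Rightarrow> real \<Rightarrow> real" where "ecos \<beta> s = exp s * cos (\<beta> * s)"
definition esin :: "real \<Rightarrow> real \<Rightarrow> real" where "esin \<beta> s = exp s * sin (\<beta> * s)"

lemma ecos_add: "ecos \<beta> (s + t) = ecos \<beta> s * ecos \<beta> t - esin \<beta> s * esin \<beta> t"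
  and esin_add: "esin \<beta> (s + t) = esin \<beta> s * ecos \<beta> t + ecos \<beta> s * esin \<beta> t"
  by (simp_all add: ecos_def esin_def exp_add distrib_left cos_add sin_add algebra_simps)

lemma ecos_0 [simp]: "ecos \<beta> 0 = 1" and esin_0 [simp]: "esin \<beta> 0 = 0"
  by (simp_all add: ecos_def esin_def)

lemma ecos_esin_squares: "ecos \<beta> s * ecos \<beta> s + esin \<beta> s * esin \<beta> s = exp s * exp s"
  using sin_cos_squared_add3[of "\<beta> * s"] unfolding ecos_def esin_def by algebra

lemma smooth_on_ecos: "smooth_on UNIV (ecos \<beta>)" and smooth_on_esin: "smooth_on UNIV (esin \<beta>)"
proof -
  have l: "Ck_on n (\<lambda>s. \<beta> * s) UNIV" for n
    by (intro Ck_on_bounded_linear_id bounded_linear_mult_right open_UNIV)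
  show "smooth_on UNIV (ecos \<beta>)" "smooth_on UNIV (esin \<beta>)"
    unfolding smooth_on_def ecos_def[abs_def] esin_def[abs_def]
    by (intro allI Ck_on_mult[OF open_UNIV smooth_onD[OF smooth_on_exp]]
        Ck_on_compose[OF open_UNIV subset_UNIV smooth_onD l] smooth_on_sin_cos)+
qed

lemma ecos_derivative: "(ecos \<beta> has_real_derivative ecos \<beta> s - \<beta> * esin \<beta> s) (at s)"
  and esin_derivative: "(esin \<beta> has_real_derivative esin \<beta> s + \<beta> * ecos \<beta> s) (at s)"
  unfolding ecos_def esin_def by (auto intro!: derivative_eq_intros simp: algebra_simps)

text \<open>Multiplication in the semidirect product of the complex plane with the reals, where \<open>s\<close> acts on
  the plane as multiplication by \<open>exp ((1 + \<i> \<beta>) s)\<close>.\<close>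

definition model_mult :: "real \<Rightarrow> real^3 \<Rightarrow> real^3 \<Rightarrow> real^3" where
  "model_mult \<beta> a b = vector [a $ 1 + ecos \<beta> (a $ 3) * b $ 1 - esin \<beta> (a $ 3) * b $ 2,
     a $ 2 + esin \<beta> (a $ 3) * b $ 1 + ecos \<beta> (a $ 3) * b $ 2, a $ 3 + b $ 3]"

lemma model_mult_nth [simp]:
  "model_mult \<beta> a b $ 1 = a $ 1 + ecos \<beta> (a $ 3) * b $ 1 - esin \<beta> (a $ 3) * b $ 2"
  "model_mult \<beta> a b $ 2 = a $ 2 + esin \<beta> (a $ 3) * b $ 1 + ecos \<beta> (a $ 3) * b $ 2"
  "model_mult \<beta> a b $ 3 = a $ 3 + b $ 3"
  by (simp_all add: model_mult_def)

text \<open>With \<open>E 1\<close> read as 1 and \<open>E 2\<close> as i, the brackets say that the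
  plane is abelian and that \<open>E 3\<close> acts on it as multiplication by 1 + i
  \<beta>.\<close>

locale spiral_frame = frame M E for M :: "('a, real^3) manifold" and E +
  fixes G :: "'a monoid" and \<beta> :: real
  assumes lie: "lie_group G M" and simply_connected: "simply_connected_space (mtop M)"
    and invariant: "a \<in> carrier G \<Longrightarrow> p \<in> carrier G \<Longrightarrow>
      pushforward M (\<lambda>q. a \<otimes>\<^bsub>G\<^esub> q) p (E i p) = E i (a \<otimes>\<^bsub>G\<^esub> p)"
    and bracket12: "smooth_near M p f \<Longrightarrow> E 1 p (\<lambda>q. E 2 q f) - E 2 p (\<lambda>q. E 1 q f) = 0"
    and bracket31: "smooth_near M p f \<Longrightarrow>
      E 3 p (\<lambda>q. E 1 q f) - E 1 p (\<lambda>q. E 3 q f) = E 1 p f + \<beta> * E 2 p f"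
    and bracket32: "smooth_near M p f \<Longrightarrow>
      E 3 p (\<lambda>q. E 2 q f) - E 2 p (\<lambda>q. E 3 q f) = E 2 p f - \<beta> * E 1 p f"
begin

lemma carrier: "carrier G = topspace (mtop M)" and group: "group G"
  using lie unfolding lie_group_def by auto

sublocale group G by (rule group)

lemma one_top: "\<one>\<^bsub>G\<^esub> \<in> topspace (mtop M)" using one_closed carrier by simp

lemma connected: "connected_space (mtop M)"
  using simply_connected unfolding simply_connected_space_def
  by (simp add: path_connected_imp_connected_space)

lemma mult_continuous:
  "continuous_map (prod_topology (mtop M) (mtop M)) (mtop M) (\<lambda>(x, y). x \<otimes>\<^bsub>G\<^esub> y)"
  using lie unfolding lie_group_def smooth_map_def prod_manifold_def by simp

text \<open>\<open>global_primitive\<close> for the form with values \<open>a1\<close>,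
  \<open>a2\<close>, \<open>a3\<close> on the frame, normalized at the identity; \<open>c12\<close>,
  \<open>c31\<close> and \<open>c32\<close> express its closedness.\<close>

lemma primitive:
  assumes a: "\<And>p. p \<in> topspace (mtop M) \<Longrightarrow> smooth_near M p a1" "\<And>p. p \<in> topspace (mtop M) \<Longrightarrow> smooth_near M p a2"
      "\<And>p. p \<in> topspace (mtop M) \<Longrightarrow> smooth_near M p a3"
    and c12: "\<And>p. p \<in> topspace (mtop M) \<Longrightarrow> E 1 p a2 - E 2 p a1 = 0"
    and c31: "\<And>p. p \<in> topspace (mtop M) \<Longrightarrow> E 3 p a1 - E 1 p a3 = a1 p + \<beta> * a2 p"
    and c32: "\<And>p. p \<in> topspace (mtop M) \<Longrightarrow> E 3 p a2 - E 2 p a3 = a2 p - \<beta> * a1 p"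
  shows "\<exists>F. F \<one>\<^bsub>G\<^esub> = 0 \<and> (\<forall>p\<in>topspace (mtop M).
    smooth_near M p F \<and> E 1 p F = a1 p \<and> E 2 p F = a2 p \<and> E 3 p F = a3 p)"
proof -
  define a where "a i = (if i = 1 then a1 else if i = 2 then a2 else a3)" for i :: 3
  \<comment> \<open>\<open>D\<close> records each nonzero bracket once, and \<open>C\<close>
    completes it antisymmetrically.\<close>
  define D :: "3 \<Rightarrow> 3 \<Rightarrow> real^3" where
    "D i j = (if i = 3 \<and> j = 1 then vector [1, \<beta>, 0] else if i = 3 \<and> j = 2 then vector [- \<beta>, 1, 0] else 0)" for i j
  define C where "C i j k = D i j $ k - D j i $ k" for i j k
  have br: "E i p (\<lambda>q. E j q f) - E j p (\<lambda>q. E i q f) = (\<Sum>k\<in>UNIV. C i j k * E k p f)"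
    if "smooth_near M p f" for p f i j
    using bracket12[OF that] bracket31[OF that] bracket32[OF that] exhaust_3[of i] exhaust_3[of j]
    by (auto simp: C_def D_def sum_3)
  have cl: "E i p (a j) - E j p (a i) = (\<Sum>k\<in>UNIV. C i j k * a k p)"
    if "p \<in> topspace (mtop M)" for p i j
    using c12[OF that] c31[OF that] c32[OF that] exhaust_3[of i] exhaust_3[of j]
    by (auto simp: C_def D_def sum_3 a_def)
  have sm: "smooth_near M p (a i)" if "p \<in> topspace (mtop M)" for p i
    using assms(1-3)[OF that] by (simp add: a_def)
  obtain F where F: "\<And>p. p \<in> topspace (mtop M) \<Longrightarrow> smooth_near M p F"
    "\<And>p i. p \<in> topspace (mtop M) \<Longrightarrow> E i p F = a i p"
    using global_primitive[OF br sm cl simply_connected] by blast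
  have "E i p (\<lambda>q. F q - F \<one>\<^bsub>G\<^esub>) = a i p" if p: "p \<in> topspace (mtop M)" for p i
    using tangent_diff[OF E_tangent[OF p] F(1)[OF p] smooth_near_const[OF p]]
      tangent_const[OF p E_tangent[OF p]] F(2)[OF p] by simp
  moreover have "smooth_near M p (\<lambda>q. F q - F \<one>\<^bsub>G\<^esub>)" if p: "p \<in> topspace (mtop M)" for p
    by (rule smooth_near_diff[OF F(1)[OF p] smooth_near_const[OF p]])
  ultimately show ?thesis
    by (intro exI[of _ "\<lambda>q. F q - F \<one>\<^bsub>G\<^esub>"]) (simp add: a_def)
qed

lemma translate_smooth:
  assumes "a \<in> carrier G" "p \<in> topspace (mtop M)" "smooth_near M (a \<otimes>\<^bsub>G\<^esub> p) f"
  shows "smooth_near M p (\<lambda>q. f (a \<otimes>\<^bsub>G\<^esub> q))"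
  by (rule smooth_map_pullback[OF smooth smooth left_translation_smooth[OF lie assms(1)] assms(2,3)])

lemma translate_frame:
  assumes "a \<in> carrier G" "p \<in> topspace (mtop M)" "smooth_near M (a \<otimes>\<^bsub>G\<^esub> p) f"
  shows "E i p (\<lambda>q. f (a \<otimes>\<^bsub>G\<^esub> q)) = E i (a \<otimes>\<^bsub>G\<^esub> p) f"
  using fun_cong[OF invariant[OF assms(1), of p i], of f] assms carrier
  by (simp add: pushforward_def)

text \<open>The forms integrated here are the dual form of \<open>E 3\<close> and the real and
  imaginary parts of exp ((1 + i \<beta>) t) times the complex form dual to \<open>E 1\<close> and
  \<open>E 2\<close>. The exponential is the integrating factor that makes the latter
  closed.\<close>

lemma coordinates:
  obtains \<Phi> :: "'a \<Rightarrow> real^3" where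
    "\<And>p j. p \<in> topspace (mtop M) \<Longrightarrow> smooth_near M p (\<lambda>q. \<Phi> q $ j)"
    "\<And>p. p \<in> topspace (mtop M) \<Longrightarrow> coeff \<Phi> p =
       vector [vector [ecos \<beta> (\<Phi> p $ 3), esin \<beta> (\<Phi> p $ 3), 0],
               vector [- esin \<beta> (\<Phi> p $ 3), ecos \<beta> (\<Phi> p $ 3), 0], vector [0, 0, 1]]"
    "\<Phi> \<one>\<^bsub>G\<^esub> = 0"
    "\<And>a p. a \<in> carrier G \<Longrightarrow> p \<in> carrier G \<Longrightarrow> \<Phi> (a \<otimes>\<^bsub>G\<^esub> p) = model_mult \<beta> (\<Phi> a) (\<Phi> p)"
proof -
  have "\<exists>F. F \<one>\<^bsub>G\<^esub> = 0 \<and> (\<forall>p\<in>topspace (mtop M).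
      smooth_near M p F \<and> E 1 p F = 0 \<and> E 2 p F = 0 \<and> E 3 p F = 1)"
    by (rule primitive) (simp_all add: smooth_near_const tangent_const[OF _ E_tangent])
  then obtain t where t: "\<And>p. p \<in> topspace (mtop M) \<Longrightarrow> smooth_near M p t" "t \<one>\<^bsub>G\<^esub> = 0"
    "\<And>p. p \<in> topspace (mtop M) \<Longrightarrow> E 1 p t = 0" "\<And>p. p \<in> topspace (mtop M) \<Longrightarrow> E 2 p t = 0"
    "\<And>p. p \<in> topspace (mtop M) \<Longrightarrow> E 3 p t = 1"
    by blast
  have uw: "smooth_near M p (\<lambda>q. ecos \<beta> (t q))" "smooth_near M p (\<lambda>q. esin \<beta> (t q))"
    "smooth_near M p (\<lambda>q. - esin \<beta> (t q))"
    "E i p (\<lambda>q. ecos \<beta> (t q)) = (ecos \<beta> (t p) - \<beta> * esin \<beta> (t p)) * E i p t"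
    "E i p (\<lambda>q. esin \<beta> (t q)) = (esin \<beta> (t p) + \<beta> * ecos \<beta> (t p)) * E i p t"
    "E i p (\<lambda>q. - esin \<beta> (t q)) = - (esin \<beta> (t p) + \<beta> * ecos \<beta> (t p)) * E i p t"
    if p: "p \<in> topspace (mtop M)" for p i
  proof -
    show c: "smooth_near M p (\<lambda>q. ecos \<beta> (t q))" and s: "smooth_near M p (\<lambda>q. esin \<beta> (t q))"
      by (rule smooth_near_compose[OF smooth_on_ecos t(1)[OF p]])
         (rule smooth_near_compose[OF smooth_on_esin t(1)[OF p]])
    show "smooth_near M p (\<lambda>q. - esin \<beta> (t q))" using smooth_near_cmult[OF s, of "-1"] by simp
    show "E i p (\<lambda>q. ecos \<beta> (t q)) = (ecos \<beta> (t p) - \<beta> * esin \<beta> (t p)) * E i p t"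
      by (rule tangent_chain[OF smooth p E_tangent[OF p] t(1)[OF p] smooth_on_ecos ecos_derivative])
    show *: "E i p (\<lambda>q. esin \<beta> (t q)) = (esin \<beta> (t p) + \<beta> * ecos \<beta> (t p)) * E i p t"
      by (rule tangent_chain[OF smooth p E_tangent[OF p] t(1)[OF p] smooth_on_esin esin_derivative])
    show "E i p (\<lambda>q. - esin \<beta> (t q)) = - (esin \<beta> (t p) + \<beta> * ecos \<beta> (t p)) * E i p t"
      using tangent_cmult[OF E_tangent[OF p] s, of i "-1"] * by (simp add: algebra_simps)
  qed
  have "\<exists>F. F \<one>\<^bsub>G\<^esub> = 0 \<and> (\<forall>p\<in>topspace (mtop M).
      smooth_near M p F \<and> E 1 p F = ecos \<beta> (t p) \<and> E 2 p F = - esin \<beta> (t p) \<and> E 3 p F = 0)"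
    by (rule primitive) (simp_all add: smooth_near_const tangent_const[OF _ E_tangent] uw t algebra_simps)
  then obtain x where x: "\<And>p. p \<in> topspace (mtop M) \<Longrightarrow> smooth_near M p x" "x \<one>\<^bsub>G\<^esub> = 0"
    "\<And>p. p \<in> topspace (mtop M) \<Longrightarrow> E 1 p x = ecos \<beta> (t p)" "\<And>p. p \<in> topspace (mtop M) \<Longrightarrow> E 2 p x = - esin \<beta> (t p)"
    "\<And>p. p \<in> topspace (mtop M) \<Longrightarrow> E 3 p x = 0"
    by blast
  have "\<exists>F. F \<one>\<^bsub>G\<^esub> = 0 \<and> (\<forall>p\<in>topspace (mtop M).
      smooth_near M p F \<and> E 1 p F = esin \<beta> (t p) \<and> E 2 p F = ecos \<beta> (t p) \<and> E 3 p F = 0)"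
    by (rule primitive) (simp_all add: smooth_near_const tangent_const[OF _ E_tangent] uw t algebra_simps)
  then obtain y where y: "\<And>p. p \<in> topspace (mtop M) \<Longrightarrow> smooth_near M p y" "y \<one>\<^bsub>G\<^esub> = 0"
    "\<And>p. p \<in> topspace (mtop M) \<Longrightarrow> E 1 p y = esin \<beta> (t p)" "\<And>p. p \<in> topspace (mtop M) \<Longrightarrow> E 2 p y = ecos \<beta> (t p)"
    "\<And>p. p \<in> topspace (mtop M) \<Longrightarrow> E 3 p y = 0"
    by blast
  have const: "f p = f \<one>\<^bsub>G\<^esub>" if "\<And>q. q \<in> topspace (mtop M) \<Longrightarrow> smooth_near M q f"
    "\<And>q. q \<in> topspace (mtop M) \<Longrightarrow> E 1 q f = 0 \<and> E 2 q f = 0 \<and> E 3 q f = 0" "p \<in> topspace (mtop M)" for f p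
  proof (rule constant_if_frame_zero[OF connected that(1) _ one_top that(3)])
    show "E i q f = 0" if "q \<in> topspace (mtop M)" for q i
      using \<open>\<And>q. q \<in> topspace (mtop M) \<Longrightarrow> E 1 q f = 0 \<and> E 2 q f = 0 \<and> E 3 q f = 0\<close>[OF that] exhaust_3[of i]
      by auto
  qed
  have mult_top: "a \<otimes>\<^bsub>G\<^esub> p \<in> topspace (mtop M)" if "a \<in> carrier G" "p \<in> topspace (mtop M)" for a p
    using that m_closed carrier by auto
  have tr: "smooth_near M p (\<lambda>q. f (a \<otimes>\<^bsub>G\<^esub> q))" "E i p (\<lambda>q. f (a \<otimes>\<^bsub>G\<^esub> q)) = E i (a \<otimes>\<^bsub>G\<^esub> p) f"
    if "a \<in> carrier G" "p \<in> topspace (mtop M)" "\<And>q. q \<in> topspace (mtop M) \<Longrightarrow> smooth_near M q f" for a p f i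
    using translate_smooth translate_frame that mult_top by blast+
  have t_mult: "t (a \<otimes>\<^bsub>G\<^esub> p) = t a + t p" if a: "a \<in> carrier G" and p: "p \<in> topspace (mtop M)" for a p
  proof -
    have "t (a \<otimes>\<^bsub>G\<^esub> p) - t p = t (a \<otimes>\<^bsub>G\<^esub> \<one>\<^bsub>G\<^esub>) - t \<one>\<^bsub>G\<^esub>"
    proof (rule const[OF _ _ p, of "\<lambda>p. t (a \<otimes>\<^bsub>G\<^esub> p) - t p"])
      fix q assume q: "q \<in> topspace (mtop M)"
      note tq = tr[OF a q t(1)]
      show "smooth_near M q (\<lambda>q. t (a \<otimes>\<^bsub>G\<^esub> q) - t q)" by (rule smooth_near_diff[OF tq(1) t(1)[OF q]])
      have "E i q (\<lambda>q. t (a \<otimes>\<^bsub>G\<^esub> q) - t q) = E i (a \<otimes>\<^bsub>G\<^esub> q) t - E i q t" for i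
        using tangent_diff[OF E_tangent[OF q] tq(1) t(1)[OF q]] tq(2) by simp
      then show "E 1 q (\<lambda>q. t (a \<otimes>\<^bsub>G\<^esub> q) - t q) = 0 \<and> E 2 q (\<lambda>q. t (a \<otimes>\<^bsub>G\<^esub> q) - t q) = 0 \<and>
          E 3 q (\<lambda>q. t (a \<otimes>\<^bsub>G\<^esub> q) - t q) = 0"
        by (simp add: t(3-5) q mult_top[OF a q])
    qed
    then show ?thesis using a t(2) by simp
  qed
  \<comment> \<open>Left translation preserves the frame, so \<open>z\<close> composed with it has
    the frame derivatives of k x + l y. The difference is constant, with value \<open>z a\<close> at
    the identity.\<close>
  have comb: "z (a \<otimes>\<^bsub>G\<^esub> p) = z a + k * x p + l * y p"
    if z: "\<And>p. p \<in> topspace (mtop M) \<Longrightarrow> smooth_near M p z"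
      "\<And>p. p \<in> topspace (mtop M) \<Longrightarrow> E 1 (a \<otimes>\<^bsub>G\<^esub> p) z = k * ecos \<beta> (t p) + l * esin \<beta> (t p)"
      "\<And>p. p \<in> topspace (mtop M) \<Longrightarrow> E 2 (a \<otimes>\<^bsub>G\<^esub> p) z = - k * esin \<beta> (t p) + l * ecos \<beta> (t p)"
      "\<And>p. p \<in> topspace (mtop M) \<Longrightarrow> E 3 (a \<otimes>\<^bsub>G\<^esub> p) z = 0"
      and a: "a \<in> carrier G" and p: "p \<in> topspace (mtop M)" for a p z k l
  proof -
    let ?f = "\<lambda>p. z (a \<otimes>\<^bsub>G\<^esub> p) - (k * x p + l * y p)"
    have "?f p = ?f \<one>\<^bsub>G\<^esub>"
    proof (rule const[OF _ _ p, of ?f])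
      fix q assume q: "q \<in> topspace (mtop M)"
      note tq = tr[OF a q z(1)]
      note xy = smooth_near_lin[OF x(1)[OF q] y(1)[OF q], of k l]
      show "smooth_near M q ?f" by (rule smooth_near_diff[OF tq(1) xy])
      have "E i q ?f = E i (a \<otimes>\<^bsub>G\<^esub> q) z - (k * E i q x + l * E i q y)" for i
        using tangent_diff[OF E_tangent[OF q] tq(1) xy] tq(2)
          tangent_lin[OF E_tangent[OF q] x(1)[OF q] y(1)[OF q]] by simp
      then show "E 1 q ?f = 0 \<and> E 2 q ?f = 0 \<and> E 3 q ?f = 0"
        by (simp add: x(3-5) y(3-5) z(2-4) q)
    qed
    then show ?thesis using a x(2) y(2) by simp
  qed
  define \<Phi> :: "'a \<Rightarrow> real^3" where "\<Phi> p = vector [x p, y p, t p]" for p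
  have \<Phi>: "\<Phi> p $ 1 = x p" "\<Phi> p $ 2 = y p" "\<Phi> p $ 3 = t p" for p by (simp_all add: \<Phi>_def)
  show thesis
  proof (rule that[of \<Phi>])
    show "smooth_near M p (\<lambda>q. \<Phi> q $ j)" if "p \<in> topspace (mtop M)" for p j
      using exhaust_3[of j] x(1)[OF that] y(1)[OF that] t(1)[OF that] by (auto simp: \<Phi>)
    show "coeff \<Phi> p = vector [vector [ecos \<beta> (\<Phi> p $ 3), esin \<beta> (\<Phi> p $ 3), 0],
        vector [- esin \<beta> (\<Phi> p $ 3), ecos \<beta> (\<Phi> p $ 3), 0], vector [0, 0, 1]]"
      if "p \<in> topspace (mtop M)" for p
      by (simp add: vec_eq_iff forall_3 \<Phi> x(3-5)[OF that] y(3-5)[OF that] t(3-5)[OF that])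
    show "\<Phi> \<one>\<^bsub>G\<^esub> = 0" by (simp add: vec_eq_iff forall_3 \<Phi> x(2) t(2) y(2))
    fix a p assume ap: "a \<in> carrier G" "p \<in> carrier G"
    then have p: "p \<in> topspace (mtop M)" by (simp add: carrier)
    \<comment> \<open>As \<open>t\<close> is additive, the addition formulas split the frame
      derivatives at the translated point into constants depending on \<open>t a\<close> and the
      derivatives of \<open>x\<close> and \<open>y\<close> at \<open>p\<close>.\<close>
    have "x (a \<otimes>\<^bsub>G\<^esub> p) = x a + ecos \<beta> (t a) * x p + (- esin \<beta> (t a)) * y p"
      by (rule comb[OF x(1) _ _ _ ap(1) p])
         (simp_all add: x mult_top ap t_mult ecos_add esin_add algebra_simps)
    moreover have "y (a \<otimes>\<^bsub>G\<^esub> p) = y a + esin \<beta> (t a) * x p + ecos \<beta> (t a) * y p"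
      by (rule comb[OF y(1) _ _ _ ap(1) p])
         (simp_all add: y mult_top ap t_mult ecos_add esin_add algebra_simps)
    ultimately show "\<Phi> (a \<otimes>\<^bsub>G\<^esub> p) = model_mult \<beta> (\<Phi> a) (\<Phi> p)"
      using t_mult[OF ap(1) p] by (simp add: vec_eq_iff forall_3 \<Phi>)
  qed
qed

text \<open>A local section near 0 lifts \<theta> on a short interval. The lift at \<open>s\<close>
  is then prescribed as the square of the lift at \<open>s / 2\<close>, which doubles the interval
  at each stage and so reaches the whole line.\<close>

lemma one_parameter_section:
  fixes \<Phi> :: "'a \<Rightarrow> real^3" and \<theta> :: "real \<Rightarrow> real^3"
  assumes sm: "\<And>p j. p \<in> topspace (mtop M) \<Longrightarrow> smooth_near M p (\<lambda>q. \<Phi> q $ j)"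
    and det: "det (coeff \<Phi> \<one>\<^bsub>G\<^esub>) \<noteq> 0" and one: "\<Phi> \<one>\<^bsub>G\<^esub> = 0"
    and hom: "\<And>a p. a \<in> carrier G \<Longrightarrow> p \<in> carrier G \<Longrightarrow> \<Phi> (a \<otimes>\<^bsub>G\<^esub> p) = model_mult \<beta> (\<Phi> a) (\<Phi> p)"
    and \<theta>: "continuous_on UNIV \<theta>" "\<theta> 0 = 0" "\<And>s s'. model_mult \<beta> (\<theta> s) (\<theta> s') = \<theta> (s + s')"
  shows "\<exists>\<gamma>. continuous_map euclidean (mtop M) \<gamma> \<and> (\<forall>s. \<Phi> (\<gamma> s) = \<theta> s)"
proof -
  obtain U V \<sigma> where U: "openin (mtop M) U" "\<one>\<^bsub>G\<^esub> \<in> U" "inj_on \<Phi> U" and V: "open V" "\<Phi> \<one>\<^bsub>G\<^esub> \<in> V"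
    and \<sigma>: "continuous_map (top_of_set V) (mtop M) \<sigma>" "\<And>y. y \<in> V \<Longrightarrow> \<sigma> y \<in> U \<and> \<Phi> (\<sigma> y) = y"
    using local_section[OF sm one_top det] by blast
  have \<sigma>0: "\<sigma> 0 = \<one>\<^bsub>G\<^esub>"
    using inj_onD[OF U(3), of "\<sigma> 0" "\<one>\<^bsub>G\<^esub>"] \<sigma>(2)[of 0] V(2) U(2) one by simp
  \<comment> \<open>Neighbourhoods \<open>A\<close> and \<open>B\<close> of the identity with
    products in \<open>U\<close> are wanted: on the initial interval the doubled curve then stays
    where \<Phi> is injective and must equal the original one.\<close>
  have O: "openin (prod_topology (mtop M) (mtop M))
      {z \<in> topspace (prod_topology (mtop M) (mtop M)). (case z of (x, y) \<Rightarrow> x \<otimes>\<^bsub>G\<^esub> y) \<in> U}"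
    by (rule openin_continuous_map_preimage[OF mult_continuous U(1)])
  have "(\<one>\<^bsub>G\<^esub>, \<one>\<^bsub>G\<^esub>) \<in>
      {z \<in> topspace (prod_topology (mtop M) (mtop M)). (case z of (x, y) \<Rightarrow> x \<otimes>\<^bsub>G\<^esub> y) \<in> U}"
    using one_top U(2) by simp
  from openin_prod_topology_alt[THEN iffD1, rule_format, OF O this] obtain A B where AB: "openin (mtop M) A" "openin (mtop M) B" "\<one>\<^bsub>G\<^esub> \<in> A" "\<one>\<^bsub>G\<^esub> \<in> B"
    "A \<times> B \<subseteq> {z \<in> topspace (prod_topology (mtop M) (mtop M)). (case z of (x, y) \<Rightarrow> x \<otimes>\<^bsub>G\<^esub> y) \<in> U}"
    by (elim exE conjE)
  define \<tau> where "\<tau> s = \<sigma> (\<theta> s)" for s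
  have Vo: "open (\<theta> -` V)" using \<theta>(1) V(1) by (simp add: continuous_on_open_vimage)
  have "continuous_map (top_of_set (\<theta> -` V)) (top_of_set V) \<theta>"
    using \<theta>(1) by (auto simp: continuous_map_in_subtopology intro: continuous_on_subset)
  from continuous_map_compose[OF this \<sigma>(1)]
  have \<tau>c: "continuous_map (top_of_set (\<theta> -` V)) (mtop M) \<tau>" by (simp add: o_def \<tau>_def[abs_def])
  have "openin (mtop M) (A \<inter> B)" using AB by blast
  from continuous_map_near[OF \<tau>c this, of 0]
  obtain d1 where d1: "d1 > 0" "\<And>s. s \<in> \<theta> -` V \<Longrightarrow> dist s 0 < d1 \<Longrightarrow> \<tau> s \<in> A \<inter> B"
    using V(2) one \<theta>(2) AB \<sigma>0 by (auto simp: \<tau>_def)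
  obtain d2 where d2: "d2 > 0" "ball 0 d2 \<subseteq> \<theta> -` V"
    using openE[OF Vo, of 0] V(2) one \<theta>(2) by auto
  define d where "d = min d1 d2"
  have d: "d > 0" using d1 d2 by (simp add: d_def)
  define I where "I n = {- (2 ^ n * d)<..<2 ^ n * d}" for n :: nat
  have I0: "s \<in> \<theta> -` V" "\<tau> s \<in> A \<inter> B" if "s \<in> I 0" for s
  proof -
    have s: "dist s 0 < d1" "s \<in> ball 0 d2" using that by (auto simp: I_def d_def dist_real_def)
    show "s \<in> \<theta> -` V" using s(2) d2(2) by blast
    with s(1) d1(2) show "\<tau> s \<in> A \<inter> B" by blast
  qed
  \<comment> \<open>\<open>\<gamma> n\<close> is controlled on \<open>I n\<close>, whose length
    doubles with \<open>n\<close>; nothing is claimed outside.\<close>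
  define \<gamma> where "\<gamma> = rec_nat \<tau> (\<lambda>_ g s. g (s / 2) \<otimes>\<^bsub>G\<^esub> g (s / 2))"
  have \<gamma>_0: "\<gamma> 0 = \<tau>" and \<gamma>_Suc: "\<gamma> (Suc n) s = \<gamma> n (s / 2) \<otimes>\<^bsub>G\<^esub> \<gamma> n (s / 2)" for n s
    by (simp_all add: \<gamma>_def)
  have half: "s / 2 \<in> I n" if "s \<in> I (Suc n)" for s n using that by (auto simp: I_def)
  have cont: "continuous_map (top_of_set (I n)) (mtop M) (\<gamma> n)" for n
  proof (induction n)
    case 0
    show ?case unfolding \<gamma>_0
      by (rule continuous_map_from_subtopology_mono[OF \<tau>c]) (use I0 in blast)
  next
    case (Suc n)
    have "continuous_map (top_of_set (I (Suc n))) (top_of_set (I n)) (\<lambda>s. s / 2)"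
      using half by (auto simp: continuous_map_in_subtopology intro!: continuous_intros)
    from continuous_map_compose[OF this Suc]
    have "continuous_map (top_of_set (I (Suc n))) (prod_topology (mtop M) (mtop M)) (\<lambda>s. (\<gamma> n (s / 2), \<gamma> n (s / 2)))"
      by (auto intro!: continuous_map_pairedI simp: o_def)
    from continuous_map_compose[OF this mult_continuous] show ?case by (simp add: o_def \<gamma>_Suc[abs_def])
  qed
  have carr: "\<gamma> n s \<in> carrier G" if "s \<in> I n" for n s
    using cont[of n] that unfolding continuous_map_def carrier by auto
  have \<Phi>\<gamma>: "\<Phi> (\<gamma> n s) = \<theta> s" if "s \<in> I n" for n s
    using that
  proof (induction n arbitrary: s)
    case 0
    then show ?case using I0(1)[OF 0] \<sigma>(2) by (simp add: \<gamma>_0 \<tau>_def)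
  next
    case (Suc n)
    then show ?case
      using half[OF Suc.prems] by (simp add: \<gamma>_Suc hom carr \<theta>(3))
  qed
  \<comment> \<open>Injectivity of \<Phi> on \<open>U\<close> is used in the base case; the later
    cases follow by halving.\<close>
  have step: "\<gamma> (Suc n) s = \<gamma> n s" if "s \<in> I n" for n s
    using that
  proof (induction n arbitrary: s)
    case 0
    have h: "s / 2 \<in> I 0" using 0 d by (auto simp: I_def)
    have "(\<tau> (s / 2), \<tau> (s / 2)) \<in> A \<times> B" using I0(2)[OF h] by blast
    from subsetD[OF AB(5) this] have u: "\<gamma> (Suc 0) s \<in> U" unfolding \<gamma>_Suc \<gamma>_0 by simp
    have "s \<in> I (Suc 0)" using 0 d by (auto simp: I_def)
    then have "\<Phi> (\<gamma> (Suc 0) s) = \<Phi> (\<gamma> 0 s)" using \<Phi>\<gamma>[of s "Suc 0"] \<Phi>\<gamma>[of s 0] 0 by simp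
    then show ?case using inj_onD[OF U(3)] u \<sigma>(2) I0(1)[OF 0] by (simp add: \<gamma>_0 \<tau>_def)
  next
    case (Suc n)
    have "\<gamma> (Suc (Suc n)) s = \<gamma> (Suc n) (s / 2) \<otimes>\<^bsub>G\<^esub> \<gamma> (Suc n) (s / 2)" by (rule \<gamma>_Suc)
    also have "\<dots> = \<gamma> n (s / 2) \<otimes>\<^bsub>G\<^esub> \<gamma> n (s / 2)" unfolding Suc.IH[OF half[OF Suc.prems]] ..
    also have "\<dots> = \<gamma> (Suc n) s" by (rule \<gamma>_Suc[symmetric])
    finally show ?case .
  qed
  have I_mono: "I n \<subseteq> I m" if "n \<le> m" for n m
  proof -
    have "2 ^ n * d \<le> 2 ^ m * d" using that d by (intro mult_right_mono power_increasing) auto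
    then show ?thesis by (auto simp: I_def)
  qed
  have eq: "\<gamma> m s = \<gamma> n s" if "n \<le> m" "s \<in> I n" for n m s
    using that(1)
  proof (induction m rule: dec_induct)
    case (step m)
    then show ?case using \<open>\<And>n s. s \<in> I n \<Longrightarrow> \<gamma> (Suc n) s = \<gamma> n s\<close>[of s m] I_mono[OF step(1)] that(2) by auto
  qed simp
  have ex: "\<exists>n. s \<in> I n" for s
  proof -
    obtain n where "\<bar>s\<bar> / d < 2 ^ n" using real_arch_pow[of 2 "\<bar>s\<bar> / d"] by auto
    then have "\<bar>s\<bar> < 2 ^ n * d" using d by (simp add: field_simps)
    then show ?thesis by (intro exI[of _ n]) (auto simp: I_def)
  qed
  then obtain N where N: "\<And>s. s \<in> I (N s)" by metis
  define \<Gamma> where "\<Gamma> s = \<gamma> (N s) s" for s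
  have \<Gamma>: "\<Gamma> s = \<gamma> n s" if "s \<in> I n" for n s
    using eq[OF _ N, of s n] eq[OF _ that, of "N s"] unfolding \<Gamma>_def by (cases "n \<le> N s") auto
  have "continuous_map euclidean (mtop M) \<Gamma>"
    unfolding continuous_map
  proof (intro conjI allI impI)
    show "\<Gamma> ` topspace euclidean \<subseteq> topspace (mtop M)" using carr[OF N] unfolding \<Gamma>_def carrier by auto
    fix W assume W: "openin (mtop M) W"
    have "{s \<in> topspace euclidean. \<Gamma> s \<in> W} = (\<Union>n. {s \<in> topspace (top_of_set (I n)). \<gamma> n s \<in> W})"
      using \<Gamma> ex by fastforce
    moreover have "open {s \<in> topspace (top_of_set (I n)). \<gamma> n s \<in> W}" for n
      using openin_continuous_map_preimage[OF cont W, of n] openin_open_eq[of "I n"] by (simp add: I_def)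
    ultimately show "openin euclidean {s \<in> topspace euclidean. \<Gamma> s \<in> W}" by auto
  qed
  moreover have "\<Phi> (\<Gamma> s) = \<theta> s" for s using \<Phi>\<gamma>[OF N] by (simp add: \<Gamma>_def)
  ultimately show ?thesis by blast
qed

text \<open>The lifted coordinate subgroups multiply to a continuous section \<open>S\<close> of
  \<Phi>. The set where \<open>S\<close> undoes \<Phi> is closed in a Hausdorff space, open by local
  injectivity of \<Phi>, and contains \<open>S 0\<close>; connectedness makes it everything.\<close>

theorem model_coordinates:
  obtains \<Phi> :: "'a \<Rightarrow> real^3" and S where
    "\<And>p j. p \<in> topspace (mtop M) \<Longrightarrow> smooth_near M p (\<lambda>q. \<Phi> q $ j)"
    "\<And>p. p \<in> topspace (mtop M) \<Longrightarrow> coeff \<Phi> p =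
       vector [vector [ecos \<beta> (\<Phi> p $ 3), esin \<beta> (\<Phi> p $ 3), 0],
               vector [- esin \<beta> (\<Phi> p $ 3), ecos \<beta> (\<Phi> p $ 3), 0], vector [0, 0, 1]]"
    "\<And>a p. a \<in> carrier G \<Longrightarrow> p \<in> carrier G \<Longrightarrow> \<Phi> (a \<otimes>\<^bsub>G\<^esub> p) = model_mult \<beta> (\<Phi> a) (\<Phi> p)"
    "continuous_map (mtop M) euclidean \<Phi>" "continuous_map euclidean (mtop M) S"
    "\<And>w. \<Phi> (S w) = w" "\<And>p. p \<in> topspace (mtop M) \<Longrightarrow> S (\<Phi> p) = p"
proof -
  obtain \<Phi> :: "'a \<Rightarrow> real^3" where
    sm: "\<And>p j. p \<in> topspace (mtop M) \<Longrightarrow> smooth_near M p (\<lambda>q. \<Phi> q $ j)" and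
    co: "\<And>p. p \<in> topspace (mtop M) \<Longrightarrow> coeff \<Phi> p =
       vector [vector [ecos \<beta> (\<Phi> p $ 3), esin \<beta> (\<Phi> p $ 3), 0],
               vector [- esin \<beta> (\<Phi> p $ 3), ecos \<beta> (\<Phi> p $ 3), 0], vector [0, 0, 1]]" and
    one: "\<Phi> \<one>\<^bsub>G\<^esub> = 0" and
    hom: "\<And>a p. a \<in> carrier G \<Longrightarrow> p \<in> carrier G \<Longrightarrow> \<Phi> (a \<otimes>\<^bsub>G\<^esub> p) = model_mult \<beta> (\<Phi> a) (\<Phi> p)"
    using coordinates by blast
  have det: "det (coeff \<Phi> p) \<noteq> 0" if "p \<in> topspace (mtop M)" for p
    using ecos_esin_squares[of \<beta> "\<Phi> p $ 3"] unfolding co[OF that] det_3 by simp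
  note sec = one_parameter_section[OF sm det[OF one_top] one hom]
  \<comment> \<open>Each coordinate axis is a one-parameter subgroup of the model: elements of the
    first two axes act trivially on the plane, and those of the third have no plane
    component.\<close>
  have "\<exists>\<gamma>. continuous_map euclidean (mtop M) \<gamma> \<and> (\<forall>s. \<Phi> (\<gamma> s) = axis i s)" for i
  proof (rule sec)
    show "continuous_on UNIV (axis i :: real \<Rightarrow> real^3)"
      unfolding axis_def
    proof (intro continuous_on_vec_lambda)
      show "continuous_on UNIV (\<lambda>x. if j = i then x else 0 :: real)" for j by (cases "j = i") auto
    qed
    show "model_mult \<beta> (axis i s) (axis i s') = axis i (s + s')" for s s'
      using exhaust_3[of i] by (auto simp: vec_eq_iff forall_3 axis_def)
  qed (auto simp: axis_def vec_eq_iff)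
  then obtain \<gamma> where \<gamma>: "\<And>i. continuous_map euclidean (mtop M) (\<gamma> i)" "\<And>i s. \<Phi> (\<gamma> i s) = axis i s"
    by metis
  have \<gamma>_carrier: "\<gamma> i s \<in> carrier G" for i s
    using \<gamma>(1)[of i] unfolding continuous_map_def carrier by auto
  \<comment> \<open>The factor with nonzero third coordinate comes last; placed earlier it would
    spiral the plane coordinates of the factors after it.\<close>
  define S where "S w = (\<gamma> 1 (w $ 1) \<otimes>\<^bsub>G\<^esub> \<gamma> 2 (w $ 2)) \<otimes>\<^bsub>G\<^esub> \<gamma> 3 (w $ 3)" for w :: "real^3"
  have \<Phi>S: "\<Phi> (S w) = w" for w
    unfolding S_def by (simp add: hom \<gamma>_carrier \<gamma>(2) vec_eq_iff forall_3 axis_def)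
  have mult_cont: "continuous_map euclidean (mtop M) (\<lambda>w. f w \<otimes>\<^bsub>G\<^esub> g w)"
    if "continuous_map euclidean (mtop M) f" "continuous_map euclidean (mtop M) g" for f g :: "real^3 \<Rightarrow> 'a"
    using continuous_map_compose[OF continuous_map_pairedI[OF that] mult_continuous] by (simp add: o_def)
  have "continuous_map euclidean (mtop M) (\<lambda>w::real^3. \<gamma> i (w $ i))" for i
  proof -
    have "continuous_map euclidean euclidean (\<lambda>w::real^3. w $ i)" by (simp add: continuous_intros)
    from continuous_map_compose[OF this \<gamma>(1)] show ?thesis by (simp add: o_def)
  qed
  then have S: "continuous_map euclidean (mtop M) S" unfolding S_def[abs_def] by (intro mult_cont)
  have \<Phi>c: "continuous_map (mtop M) euclidean \<Phi>" by (rule continuous_map_smooth[OF sm])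
  have S\<Phi>c: "continuous_map (mtop M) (mtop M) (\<lambda>p. S (\<Phi> p))"
    using continuous_map_compose[OF \<Phi>c S] by (simp add: o_def)
  let ?K = "{p \<in> topspace (mtop M). S (\<Phi> p) = p}"
  have "Hausdorff_space (mtop M)" using smooth unfolding smooth_manifold_def by blast
  from closedin_continuous_maps_eq[OF this S\<Phi>c continuous_map_id]
  have "closedin (mtop M) ?K" by simp
  moreover have "openin (mtop M) ?K"
  proof (subst openin_subopen, intro ballI)
    fix p assume p: "p \<in> ?K"
    obtain U where U: "openin (mtop M) U" "p \<in> U" "inj_on \<Phi> U"
      using local_section[OF sm _ det, of p] p by blast
    define W where "W = U \<inter> {q \<in> topspace (mtop M). S (\<Phi> q) \<in> U}"
    have "openin (mtop M) W"
      unfolding W_def by (intro openin_Int U openin_continuous_map_preimage[OF S\<Phi>c])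
    moreover have "W \<subseteq> ?K"
      using inj_onD[OF U(3)] \<Phi>S by (auto simp: W_def)
    moreover have "p \<in> W" using p U by (simp add: W_def)
    ultimately show "\<exists>T. openin (mtop M) T \<and> p \<in> T \<and> T \<subseteq> ?K" by blast
  qed
  ultimately have "?K = {} \<or> ?K = topspace (mtop M)"
    using connected unfolding connected_space_clopen_in by blast
  moreover have "S 0 \<in> ?K" using S \<Phi>S unfolding continuous_map_def by auto
  ultimately have S\<Phi>: "S (\<Phi> p) = p" if "p \<in> topspace (mtop M)" for p using that by blast
  show thesis by (rule that[OF sm co hom \<Phi>c S \<Phi>S S\<Phi>])
qed

end


section \<open>Isometry with hyperbolic space\<close>

definition upper_half_space :: "(real^3) set" where "upper_half_space = {x. x $ 3 > 0}"

lemma open_upper_half_space: "open upper_half_space"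
  unfolding upper_half_space_def by (rule open_halfspace_component_gt_cart)

lemma hyperbolic_space_simps [simp]:
  "mtop hyperbolic_space = top_of_set upper_half_space"
  "atlas hyperbolic_space = {(upper_half_space, \<lambda>x. x)}"
  by (simp_all add: hyperbolic_space_def upper_half_space_def)

lemma inv_into_ident: "x \<in> A \<Longrightarrow> inv_into A (\<lambda>x. x) x = x"
  by (rule inv_into_f_f) simp_all

lemma second_countable_euclidean: "second_countable (euclidean :: 'a::second_countable_topology topology)"
proof -
  obtain B :: "'a set set" where B: "countable B" "topological_basis B" using ex_countable_basis by blast
  show ?thesis
    unfolding second_countable_def
    using B(1) topological_basis_open[OF B(2)] topological_basisE[OF B(2)] by (intro exI[of _ B]) (simp, metis)
qed

lemma smooth_manifold_hyperbolic_space: "smooth_manifold hyperbolic_space"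
proof -
  have "smooth_on upper_half_space (\<lambda>x. inv_into upper_half_space (\<lambda>x. x) x)"
    unfolding smooth_on_def
    by (intro allI Ck_on_cong[OF open_upper_half_space _ Ck_on_bounded_linear_id[OF open_upper_half_space bounded_linear_ident]])
       (simp add: inv_into_ident)
  moreover have "homeomorphic_map (top_of_set upper_half_space) (top_of_set upper_half_space) (\<lambda>x. x)"
    using homeomorphic_map_id[of "top_of_set upper_half_space" "top_of_set upper_half_space"] by (simp add: id_def)
  ultimately show ?thesis
    unfolding smooth_manifold_def
    by (simp add: Hausdorff_space_subtopology second_countable_subtopology second_countable_euclidean
        open_upper_half_space subtopology_subtopology)
qed

lemma smooth_near_hyperbolic_coordinate:
  assumes "x \<in> upper_half_space" shows "smooth_near hyperbolic_space x (\<lambda>y. y $ i)"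
proof -
  interpret smooth_mfld hyperbolic_space by standard (rule smooth_manifold_hyperbolic_space)
  show ?thesis using smooth_near_coord[of upper_half_space "\<lambda>x. x" x "\<lambda>y. y $ i"] assms
    by (simp add: bounded_linear_vec_nth)
qed

context spiral_frame
begin

text \<open>With z = sqrt \<nu> exp t the factor \<nu> / z^2 is exp (- 2 t), which undoes the
  stretching of the plane by exp t, and \<nu> (dz / z)^2 = \<nu> dt^2 gives \<open>E 3\<close> its
  square length.\<close>

theorem isometric_hyperbolic:
  assumes \<nu>: "\<nu> > 0" and g: "riemannian_metric M g"
    and gram: "\<And>p i j. p \<in> topspace (mtop M) \<Longrightarrow>
      g p (E i p) (E j p) = (if i = j then if i = 3 then \<nu> else 1 else 0)"
  shows "isometric M g hyperbolic_space (hyperbolic_metric (- 1 / \<nu>))"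
proof -
  obtain \<Phi> :: "'a \<Rightarrow> real^3" and S where
    sm: "\<And>p j. p \<in> topspace (mtop M) \<Longrightarrow> smooth_near M p (\<lambda>q. \<Phi> q $ j)" and
    co: "\<And>p. p \<in> topspace (mtop M) \<Longrightarrow> coeff \<Phi> p =
       vector [vector [ecos \<beta> (\<Phi> p $ 3), esin \<beta> (\<Phi> p $ 3), 0],
               vector [- esin \<beta> (\<Phi> p $ 3), ecos \<beta> (\<Phi> p $ 3), 0], vector [0, 0, 1]]" and
    "\<And>a p. a \<in> carrier G \<Longrightarrow> p \<in> carrier G \<Longrightarrow> \<Phi> (a \<otimes>\<^bsub>G\<^esub> p) = model_mult \<beta> (\<Phi> a) (\<Phi> p)" and
    "continuous_map (mtop M) euclidean \<Phi>" and S: "continuous_map euclidean (mtop M) S" and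
    inv: "\<And>w. \<Phi> (S w) = w" "\<And>p. p \<in> topspace (mtop M) \<Longrightarrow> S (\<Phi> p) = p"
    by (rule model_coordinates) (rule that; assumption)
  have E\<Phi>: "E i p (\<lambda>q. \<Phi> q $ j) = (vector [vector [ecos \<beta> (\<Phi> p $ 3), esin \<beta> (\<Phi> p $ 3), 0],
      vector [- esin \<beta> (\<Phi> p $ 3), ecos \<beta> (\<Phi> p $ 3), 0], vector [0, 0, 1]] :: real^3^3) $ i $ j"
    if "p \<in> topspace (mtop M)" for p i j
    using co[OF that] coeff_nth[of \<Phi> p i j] by simp
  define F :: "'a \<Rightarrow> real^3" where "F p = vector [\<Phi> p $ 1, \<Phi> p $ 2, sqrt \<nu> * exp (\<Phi> p $ 3)]" for p
  define K :: "real^3 \<Rightarrow> real^3" where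
    "K y = (\<chi> i. if i = 1 then y $ 1 else if i = 2 then y $ 2 else ln (y $ 3 / sqrt \<nu>))" for y
  have F: "F p $ 1 = \<Phi> p $ 1" "F p $ 2 = \<Phi> p $ 2" "F p $ 3 = sqrt \<nu> * exp (\<Phi> p $ 3)" for p
    by (simp_all add: F_def)
  have Fpos: "F p \<in> upper_half_space" for p using \<nu> by (simp add: upper_half_space_def F)
  have KF: "K (F p) = \<Phi> p" for p using \<nu> by (simp add: vec_eq_iff forall_3 K_def F)
  have FK: "F (S (K y)) = y" if "y \<in> upper_half_space" for y
    using that \<nu> by (simp add: vec_eq_iff forall_3 F inv K_def upper_half_space_def)
  have sexp: "smooth_near M p (\<lambda>q. exp (\<Phi> q $ 3))" if "p \<in> topspace (mtop M)" for p
    by (rule smooth_near_compose[OF smooth_on_exp sm[OF that]])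
  have Fsm: "smooth_near M p (\<lambda>q. F q $ j)" if "p \<in> topspace (mtop M)" for p j
    using exhaust_3[of j] sm[OF that] smooth_near_cmult[OF sexp[OF that]] by (auto simp: F)
  have E3: "E i p (\<lambda>q. F q $ 3) = (if i = 3 then F p $ 3 else 0)" if p: "p \<in> topspace (mtop M)" for p i
  proof -
    have "E i p (\<lambda>q. exp (\<Phi> q $ 3)) = exp (\<Phi> p $ 3) * E i p (\<lambda>q. \<Phi> q $ 3)"
      by (rule tangent_chain[OF smooth p E_tangent[OF p] sm[OF p] smooth_on_exp DERIV_exp])
    then show ?thesis
      using tangent_cmult[OF E_tangent[OF p] sexp[OF p], of i "sqrt \<nu>"] exhaust_3[of i]
      by (auto simp: F E\<Phi>[OF p])
  qed
  have coF: "coeff F p = vector [vector [ecos \<beta> (\<Phi> p $ 3), esin \<beta> (\<Phi> p $ 3), 0],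
               vector [- esin \<beta> (\<Phi> p $ 3), ecos \<beta> (\<Phi> p $ 3), 0], vector [0, 0, F p $ 3]]"
    if p: "p \<in> topspace (mtop M)" for p
    using E3[OF p] by (simp add: vec_eq_iff forall_3 F(1,2) E\<Phi>[OF p])
  have det: "det (coeff F p) \<noteq> 0" if "p \<in> topspace (mtop M)" for p
  proof -
    have "det (coeff F p) = F p $ 3 * (exp (\<Phi> p $ 3) * exp (\<Phi> p $ 3))"
      unfolding coF[OF that] det_3 ecos_esin_squares[of \<beta>, symmetric] by (simp add: algebra_simps)
    then show ?thesis using \<nu> by (simp add: F)
  qed
  have FM: "smooth_map M hyperbolic_space F"
  proof -
    have "{p \<in> U. F p \<in> upper_half_space} = U" for U using Fpos by auto
    then show ?thesis
      using continuous_map_smooth[OF Fsm] smooth_on_chart_map[OF Fsm] Fpos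
      unfolding smooth_map_def by (auto simp: continuous_map_in_subtopology)
  qed
  define F' where "F' y = S (K y)" for y
  have F'c: "continuous_map (top_of_set upper_half_space) (mtop M) F'"
  proof -
    have "continuous_on upper_half_space (\<lambda>y. if i = 1 then y $ 1 else if i = 2 then y $ 2 else ln (y $ 3 / sqrt \<nu>))" for i :: 3
      using exhaust_3[of i] \<nu> by (auto simp: upper_half_space_def intro!: continuous_intros)
    then have "continuous_map (top_of_set upper_half_space) euclidean K"
      unfolding K_def by (simp add: continuous_on_vec_lambda)
    from continuous_map_compose[OF this S] show ?thesis by (simp add: F'_def[abs_def] o_def)
  qed
  \<comment> \<open>\<open>S\<close> is known to be continuous only, so smoothness of the inverse
    comes from \<open>smooth_on_inverse\<close>.\<close>
  have F'M: "smooth_map hyperbolic_space M F'"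
  proof -
    have "smooth_on {y \<in> upper_half_space. F' y \<in> V} (\<lambda>x. \<psi> (F' (inv_into upper_half_space (\<lambda>x. x) x)))"
      if c: "(V, \<psi>) \<in> atlas M" for V \<psi>
      unfolding smooth_on_def
    proof
      fix n
      have "openin (top_of_set upper_half_space) {y \<in> topspace (top_of_set upper_half_space). F' y \<in> V}"
        by (rule openin_continuous_map_preimage[OF F'c chart_openin[OF c]])
      then have o: "open {y \<in> upper_half_space. F' y \<in> V}"
        using open_upper_half_space by (simp add: openin_open_eq)
      have k: "Ck_on n (\<lambda>y. \<psi> (F' y)) {y \<in> upper_half_space. F' y \<in> V}"
        by (rule smooth_onD[OF smooth_on_inverse[OF Fsm det open_upper_half_space F'c _ c]])
           (simp_all add: F'_def FK)
      show "Ck_on n (\<lambda>x. \<psi> (F' (inv_into upper_half_space (\<lambda>x. x) x))) {y \<in> upper_half_space. F' y \<in> V}"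
        by (rule Ck_on_cong[OF o _ k]) (simp add: inv_into_ident)
    qed
    then show ?thesis using F'c unfolding smooth_map_def by auto
  qed
  have "hyperbolic_metric (- 1 / \<nu>) (F p) (pushforward hyperbolic_space F p v) (pushforward hyperbolic_space F p w) = g p v w"
    if p: "p \<in> topspace (mtop M)" and v: "v \<in> tangent_space M p" and w: "w \<in> tangent_space M p" for p v w
  proof -
    obtain s :: "real^3" where s: "\<And>f. v f = (\<Sum>i\<in>UNIV. s $ i * E i p f)" using tangent_combination[OF p v] by blast
    obtain r :: "real^3" where r: "\<And>f. w f = (\<Sum>i\<in>UNIV. r $ i * E i p f)" using tangent_combination[OF p w] by blast
    have lin: "g p (\<lambda>f. a * u f + b * u' f) w = a * g p u w + b * g p u' w"
      and sym: "g p u w = g p w u"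
      if "u \<in> tangent_space M p" "u' \<in> tangent_space M p" "w \<in> tangent_space M p" for u u' w a b
      using g p that unfolding riemannian_metric_def by blast+
    note Et = E_tangent[OF p]
    have lin3: "g p (\<lambda>f. \<Sum>i\<in>UNIV. s $ i * E i p f) w = (\<Sum>i\<in>UNIV. s $ i * g p (E i p) w)"
      if w: "w \<in> tangent_space M p" for s :: "real^3" and w
    proof -
      have "(\<lambda>f. s $ 1 * E 1 p f + s $ 2 * E 2 p f) \<in> tangent_space M p" by (rule tangent_lincomb[OF Et Et])
      from lin[OF this Et w, of 1 "s $ 3" 3] lin[OF Et Et w, of "s $ 1" 1 "s $ 2" 2]
      show ?thesis by (simp add: sum_3)
    qed
    have veq: "v = (\<lambda>f. \<Sum>i\<in>UNIV. s $ i * E i p f)" and weq: "w = (\<lambda>f. \<Sum>i\<in>UNIV. r $ i * E i p f)"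
      using s r by auto
    have gE: "g p (E i p) w = r $ i * (if i = 3 then \<nu> else 1)" for i
    proof -
      have "g p (E i p) w = g p w (E i p)" by (rule sym[OF Et Et w])
      also have "\<dots> = (\<Sum>j\<in>UNIV. r $ j * g p (E j p) (E i p))" unfolding weq by (rule lin3[OF Et])
      also have "\<dots> = r $ i * (if i = 3 then \<nu> else 1)" using exhaust_3[of i] by (auto simp: gram[OF p] sum_3)
      finally show ?thesis .
    qed
    have "g p v w = (\<Sum>i\<in>UNIV. s $ i * g p (E i p) w)" unfolding veq by (rule lin3[OF w])
    then have gvw: "g p v w = s $ 1 * r $ 1 + s $ 2 * r $ 2 + \<nu> * (s $ 3 * r $ 3)" by (simp add: gE sum_3)
    \<comment> \<open>The rotation angle enters through \<open>C\<close> and \<open>D\<close> alone.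
      In the inner product the mixed terms cancel and C^2 + D^2 = e^2 remains, from which \<beta>
      has disappeared.\<close>
    define C where "C = ecos \<beta> (\<Phi> p $ 3)"
    define D where "D = esin \<beta> (\<Phi> p $ 3)"
    define e where "e = exp (\<Phi> p $ 3)"
    have CD: "C * C + D * D = e * e" unfolding C_def D_def e_def by (rule ecos_esin_squares)
    have push: "pushforward hyperbolic_space F p u (\<lambda>y. y $ i) = u (\<lambda>q. F q $ i)" for u i
      by (simp add: pushforward_def smooth_near_hyperbolic_coordinate[OF Fpos])
    have F3: "F p $ 3 = sqrt \<nu> * e" by (simp add: F e_def)
    have comp: "(\<Sum>i\<in>UNIV. s $ i * E i p (\<lambda>q. F q $ 1)) = s $ 1 * C - s $ 2 * D"
      "(\<Sum>i\<in>UNIV. s $ i * E i p (\<lambda>q. F q $ 2)) = s $ 1 * D + s $ 2 * C"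
      "(\<Sum>i\<in>UNIV. s $ i * E i p (\<lambda>q. F q $ 3)) = s $ 3 * (sqrt \<nu> * e)" for s :: "real^3"
      by (simp_all add: sum_3 F(1,2) E\<Phi>[OF p] E3[OF p] F3 C_def D_def)
    note vF = comp[of s, folded s] and wF = comp[of r, folded r]
    have sq: "sqrt \<nu> * sqrt \<nu> = \<nu>" using \<nu> by simp
    have "(\<Sum>i\<in>UNIV. v (\<lambda>q. F q $ i) * w (\<lambda>q. F q $ i)) =
        (C * C + D * D) * (s $ 1 * r $ 1 + s $ 2 * r $ 2) + (sqrt \<nu> * sqrt \<nu>) * (e * e) * (s $ 3 * r $ 3)"
      unfolding sum_3 vF wF by (simp only: algebra_simps)
    also have "\<dots> = e * e * g p v w" unfolding CD sq gvw by (simp only: algebra_simps)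
    finally have sum: "(\<Sum>i\<in>UNIV. v (\<lambda>q. F q $ i) * w (\<lambda>q. F q $ i)) = e * e * g p v w" .
    have "(F p $ 3)\<^sup>2 = \<nu> * (e * e)" using \<nu> by (simp add: F e_def power2_eq_square)
    moreover have "e > 0" by (simp add: e_def)
    ultimately show ?thesis using \<nu> unfolding hyperbolic_metric_def push sum by (simp add: field_simps)
  qed
  moreover have "F' (F p) = p" if "p \<in> topspace (mtop M)" for p by (simp add: F'_def KF inv that)
  moreover have "F (F' y) = y" if "y \<in> upper_half_space" for y by (simp add: F'_def FK that)
  ultimately have "riemannian_isometry M g hyperbolic_space (hyperbolic_metric (- 1 / \<nu>)) F"
    using FM F'M unfolding riemannian_isometry_def diffeomorphism_def by auto
  then show ?thesis unfolding isometric_def by blast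
qed

end

section \<open>Frames from bases of the Lie algebra\<close>

lemma lin_comb_3: "lin_comb [a, b, c] [X, Y, Z] = (\<lambda>p f. a * X p f + b * Y p f + c * Z p f)"
  by (simp add: lin_comb_def numeral_3_eq_3 fun_eq_iff)

lemma lie_algebraD:
  assumes "X \<in> lie_algebra G M"
  shows "smooth_vfield_on M (topspace (mtop M)) X"
    and "p \<notin> topspace (mtop M) \<Longrightarrow> X p f = 0"
    and "a \<in> carrier G \<Longrightarrow> p \<in> carrier G \<Longrightarrow> pushforward M (\<lambda>q. a \<otimes>\<^bsub>G\<^esub> q) p (X p) = X (a \<otimes>\<^bsub>G\<^esub> p)"
  using assms unfolding lie_algebra_def by auto

text \<open>Uniqueness of coordinates concerns fields on the whole group, so a relation at the point
  \<open>p\<close> is first carried to every \<open>q\<close> by left translation. Added to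
  \<open>X\<close>, it would give \<open>X\<close> a second coordinate list.\<close>

lemma basis_independent:
  assumes G: "lie_group G M" and basis: "lie_algebra_basis G M [X, Y, Z]"
    and p: "p \<in> topspace (mtop M)" and zero: "\<And>f. a * X p f + b * Y p f + c * Z p f = 0"
  shows "a = 0 \<and> b = 0 \<and> c = 0"
proof -
  interpret group G using G unfolding lie_group_def by blast
  have carr: "carrier G = topspace (mtop M)" using G unfolding lie_group_def by blast
  have L: "X \<in> lie_algebra G M" "Y \<in> lie_algebra G M" "Z \<in> lie_algebra G M"
    using basis unfolding lie_algebra_basis_def by auto
  have "a * X q f + b * Y q f + c * Z q f = 0" for q f
  proof (cases "q \<in> carrier G")
    case True
    define d where "d = q \<otimes>\<^bsub>G\<^esub> inv\<^bsub>G\<^esub> p"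
    have pc: "p \<in> carrier G" using p carr by simp
    have d: "d \<in> carrier G" "d \<otimes>\<^bsub>G\<^esub> p = q" using True pc by (simp_all add: d_def m_assoc)
    have e: "W q f = (if smooth_near M q f then W p (\<lambda>r. f (d \<otimes>\<^bsub>G\<^esub> r)) else 0)" if "W \<in> lie_algebra G M" for W
      using fun_cong[OF lie_algebraD(3)[OF that d(1) pc], of f] unfolding d(2) pushforward_def by simp
    show ?thesis using zero by (simp add: e[OF L(1)] e[OF L(2)] e[OF L(3)])
  next
    case False
    then show ?thesis using carr lie_algebraD(2)[OF L(1)] lie_algebraD(2)[OF L(2)] lie_algebraD(2)[OF L(3)] by simp
  qed
  then have "X = lin_comb [1 + a, b, c] [X, Y, Z]"
    by (simp add: lin_comb_3 fun_eq_iff distrib_right add.assoc)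
  moreover have "X = lin_comb [1, 0, 0] [X, Y, Z]" by (simp add: lin_comb_3)
  moreover have "\<exists>!as. length as = length [X, Y, Z] \<and> X = lin_comb as [X, Y, Z]"
    using basis L(1) unfolding lie_algebra_basis_def by blast
  moreover have "length [1 + a, b, c] = length [X, Y, Z]" "length [1 :: real, 0, 0] = length [X, Y, Z]" by simp_all
  ultimately have "[1 + a, b, c] = [1, 0, 0]" by metis
  then show ?thesis by simp
qed

lemma (in smooth_mfld) smooth_vfield_combination:
  assumes "smooth_vfield_on M W X" "smooth_vfield_on M W Y"
  shows "smooth_vfield_on M W (\<lambda>p f. a * X p f + b * Y p f)"
  using assms unfolding smooth_vfield_on_def
  by (auto intro!: tangent_lincomb) (auto simp: smooth_fun_on_iff intro!: smooth_near_lin)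

text \<open>Translation by \<open>p\<close> carries the values at the identity to those at
  \<open>p\<close>; thus \<open>gram_matrix\<close> controls the metric on invariant fields
  everywhere.\<close>

lemma left_invariant_gram:
  assumes G: "lie_group G M" and g: "left_invariant_metric G M g"
    and X: "X \<in> lie_algebra G M" and Y: "Y \<in> lie_algebra G M" and p: "p \<in> topspace (mtop M)"
  shows "g p (X p) (Y p) = g \<one>\<^bsub>G\<^esub> (X \<one>\<^bsub>G\<^esub>) (Y \<one>\<^bsub>G\<^esub>)"
proof -
  interpret group G using G unfolding lie_group_def by blast
  have carr: "carrier G = topspace (mtop M)" using G unfolding lie_group_def by blast
  have pc: "p \<in> carrier G" using p carr by simp
  have t: "X \<one>\<^bsub>G\<^esub> \<in> tangent_space M \<one>\<^bsub>G\<^esub>" "Y \<one>\<^bsub>G\<^esub> \<in> tangent_space M \<one>\<^bsub>G\<^esub>"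
    using lie_algebraD(1)[OF X] lie_algebraD(1)[OF Y] one_closed unfolding carr smooth_vfield_on_def by blast+
  have "g (p \<otimes>\<^bsub>G\<^esub> \<one>\<^bsub>G\<^esub>) (pushforward M (\<lambda>q. p \<otimes>\<^bsub>G\<^esub> q) \<one>\<^bsub>G\<^esub> (X \<one>\<^bsub>G\<^esub>)) (pushforward M (\<lambda>q. p \<otimes>\<^bsub>G\<^esub> q) \<one>\<^bsub>G\<^esub> (Y \<one>\<^bsub>G\<^esub>))
      = g \<one>\<^bsub>G\<^esub> (X \<one>\<^bsub>G\<^esub>) (Y \<one>\<^bsub>G\<^esub>)"
    using g pc one_closed t unfolding left_invariant_metric_def by blast
  then show ?thesis using lie_algebraD(3)[OF X pc one_closed] lie_algebraD(3)[OF Y pc one_closed] pc by simp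
qed

lemma spiral_frameI:
  fixes M :: "('a, real^3) manifold"
  assumes "lie_group G M" "simply_connected_space (mtop M)"
    and field: "smooth_vfield_on M (topspace (mtop M)) X" "smooth_vfield_on M (topspace (mtop M)) Y"
      "smooth_vfield_on M (topspace (mtop M)) Z"
    and inv: "\<And>W a p. W = X \<or> W = Y \<or> W = Z \<Longrightarrow> a \<in> carrier G \<Longrightarrow> p \<in> carrier G \<Longrightarrow>
      pushforward M (\<lambda>q. a \<otimes>\<^bsub>G\<^esub> q) p (W p) = W (a \<otimes>\<^bsub>G\<^esub> p)"
    and indep: "\<And>p a b c. p \<in> topspace (mtop M) \<Longrightarrow> (\<And>f. a * X p f + b * Y p f + c * Z p f = 0) \<Longrightarrow>
      a = 0 \<and> b = 0 \<and> c = 0"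
    and br: "\<And>p f. smooth_near M p f \<Longrightarrow> X p (\<lambda>q. Y q f) - Y p (\<lambda>q. X q f) = 0"
      "\<And>p f. smooth_near M p f \<Longrightarrow> Z p (\<lambda>q. X q f) - X p (\<lambda>q. Z q f) = X p f + \<beta> * Y p f"
      "\<And>p f. smooth_near M p f \<Longrightarrow> Z p (\<lambda>q. Y q f) - Y p (\<lambda>q. Z q f) = Y p f - \<beta> * X p f"
  shows "spiral_frame M (\<lambda>i. if i = 1 then X else if i = 2 then Y else Z) G \<beta>"
proof unfold_locales
  show "smooth_manifold M" using assms(1) unfolding lie_group_def by blast
  show "s = 0" if p: "p \<in> topspace (mtop M)"
    and 0: "\<And>f. (\<Sum>i\<in>UNIV. s $ i * (if i = 1 then X else if i = 2 then Y else Z) p f) = 0"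
    for p and s :: "real^3"
    using indep[OF p, of "s $ 1" "s $ 2" "s $ 3"] 0 by (simp add: sum_3 vec_eq_iff forall_3)
  show "pushforward M (\<lambda>q. a \<otimes>\<^bsub>G\<^esub> q) p ((if i = 1 then X else if i = 2 then Y else Z) p) =
      (if i = 1 then X else if i = 2 then Y else Z) (a \<otimes>\<^bsub>G\<^esub> p)"
    if "a \<in> carrier G" "p \<in> carrier G" for a p and i :: 3
    using inv[OF _ that] by simp
qed (use assms in \<open>simp_all add: br\<close>)

section \<open>Non-isomorphism\<close>

text \<open>Cauchy's functional equation: additivity settles rational arguments, density and
  continuity the others.\<close>

lemma additive_continuous_scaleR:
  fixes k :: "real \<Rightarrow> 'v::real_normed_vector"
  assumes add: "\<And>x y. k (x + y) = k x + k y" and cont: "continuous_on UNIV k"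
  shows "k x = x *\<^sub>R k 1"
proof -
  interpret additive k by standard (rule add)
  have nat: "k (real n * x) = real n *\<^sub>R k x" for n x
    by (induction n) (simp_all add: zero add distrib_right scaleR_left_distrib)
  have int: "k (of_int m * x) = of_int m *\<^sub>R k x" for m x
  proof (cases m rule: int_cases2)
    case (nonneg n)
    then show ?thesis using nat[of n x] by simp
  next
    case (nonpos n)
    then show ?thesis using nat[of n x] minus[of "real n * x"] by simp
  qed
  have rat: "k x - x *\<^sub>R k 1 = 0" if "x \<in> \<rat>" for x
  proof -
    obtain m n where mn: "n > 0" "x = of_int m / of_int n" using \<open>x \<in> \<rat>\<close> by (rule Rats_cases')
    have "of_int n *\<^sub>R k x = of_int m *\<^sub>R k 1" using int[of n x] int[of m 1] mn by simp
    then have "(1 / of_int n) *\<^sub>R (of_int n *\<^sub>R k x) = (1 / of_int n) *\<^sub>R (of_int m *\<^sub>R k 1)" by simp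
    then show ?thesis using mn by simp
  qed
  have cl: "closure (\<rat> :: real set) = UNIV"
  proof -
    have "\<exists>y\<in>\<rat>. dist y x < e" if "e > 0" for x e :: real
      using Rats_dense_in_real[of x "x + e"] that by (force simp: dist_real_def)
    then show ?thesis by (auto simp: closure_approachable)
  qed
  have "continuous_on (closure \<rat>) (\<lambda>x. k x - x *\<^sub>R k 1)"
    unfolding cl by (intro continuous_intros cont)
  then have "k x - x *\<^sub>R k 1 = 0"
    by (rule continuous_constant_on_closure[where f="\<lambda>x. k x - x *\<^sub>R k 1" and S="\<rat>"]) (simp_all only: rat cl UNIV_I)
  then show ?thesis by simp
qed

text \<open>\<open>f\<close> is \<open>F\<close> read in model coordinates. It is enough to follow
  one line \<open>v x\<close> of the commutator plane: \<open>f\<close> maps it linearly into the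
  other plane, and conjugation by corresponding elements scales it by a positive factor in the
  source but, for a half-turn, by a negative one in the target.\<close>

lemma spiral_groups_not_isomorphic:
  fixes G :: "'a monoid" and H :: "'b monoid" and \<Phi> :: "'a \<Rightarrow> real^3" and \<Psi> :: "'b \<Rightarrow> real^3"
  assumes "group G" and S: "continuous_map euclidean X S" "\<And>w. S w \<in> carrier G" "\<And>w. \<Phi> (S w) = w"
      "\<And>p. p \<in> carrier G \<Longrightarrow> S (\<Phi> p) = p"
    and \<Phi>: "\<And>a p. a \<in> carrier G \<Longrightarrow> p \<in> carrier G \<Longrightarrow> \<Phi> (a \<otimes>\<^bsub>G\<^esub> p) = model_mult 0 (\<Phi> a) (\<Phi> p)"
    and "group H" and R: "\<And>w. R w \<in> carrier H" "\<And>w. \<Psi> (R w) = w" "\<And>p. p \<in> carrier H \<Longrightarrow> R (\<Psi> p) = p"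
    and \<Psi>: "continuous_map Y euclidean \<Psi>"
      "\<And>a p. a \<in> carrier H \<Longrightarrow> p \<in> carrier H \<Longrightarrow> \<Psi> (a \<otimes>\<^bsub>H\<^esub> p) = model_mult \<beta> (\<Psi> a) (\<Psi> p)"
    and \<beta>: "\<beta> > 0" and F: "F \<in> iso G H" "continuous_map X Y F"
  shows False
proof -
  interpret G: group G by (rule assms(1))
  have Fc: "F p \<in> carrier H" if "p \<in> carrier G" for p
    using F(1) that unfolding iso_def hom_def by auto
  have Fm: "F (p \<otimes>\<^bsub>G\<^esub> q) = F p \<otimes>\<^bsub>H\<^esub> F q" if "p \<in> carrier G" "q \<in> carrier G" for p q
    using F(1) that unfolding iso_def hom_def by auto
  have inj: "p = q" if "p \<in> carrier G" "q \<in> carrier G" "\<Psi> (F p) = \<Psi> (F q)" for p q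
  proof -
    have "F p = R (\<Psi> (F p))" by (rule R(3)[OF Fc[OF that(1)], symmetric])
    also have "\<dots> = F q" unfolding that(3) by (rule R(3)[OF Fc[OF that(2)]])
    finally have "F p = F q" .
    moreover have "inj_on F (carrier G)" using F(1) unfolding iso_def bij_betw_def by simp
    ultimately show ?thesis using that(1,2) by (simp add: inj_on_eq_iff)
  qed
  define f where "f w = \<Psi> (F (S w))" for w
  have f: "f (model_mult 0 w w') = model_mult \<beta> (f w) (f w')" for w w'
  proof -
    have "S (model_mult 0 w w') = S w \<otimes>\<^bsub>G\<^esub> S w'"
      using S(4)[OF G.m_closed[OF S(2) S(2)], of w w'] unfolding \<Phi>[OF S(2) S(2)] S(3) .
    then show ?thesis unfolding f_def by (simp add: Fm S(2) \<Psi>(2) Fc)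
  qed
  have "continuous_map euclidean euclidean f"
    using continuous_map_compose[OF continuous_map_compose[OF S(1) F(2)] \<Psi>(1)] by (simp add: f_def[abs_def] o_def)
  then have fc: "continuous_on UNIV f" by simp
  define v where "v x = (vector [x, 0, 0] :: real^3)" for x
  have v: "v x $ 1 = x" "v x $ 2 = 0" "v x $ 3 = 0" for x by (simp_all add: v_def)
  have e0: "ecos 0 s = exp s" "esin 0 s = 0" for s by (simp_all add: ecos_def esin_def)
  have conj: "f (model_mult 0 u (v x)) = f (model_mult 0 (v (exp (u $ 3) * x)) u)" for u x
    by (rule arg_cong[where f=f]) (simp add: vec_eq_iff forall_3 v e0)
  have f3: "f (v x) $ 3 = 0" for x
  proof -
    define u where "u = (vector [0, 0, 1] :: real^3)"
    \<comment> \<open>Conjugation by \<open>u\<close> multiplies \<open>v z\<close> by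
      \<open>exp 1\<close>, so this \<open>z\<close> makes \<open>v x\<close> the commutator of
      \<open>u\<close> and \<open>v z\<close>; the third coordinate is additive and vanishes on
      commutators.\<close>
    define z where "z = x / (exp 1 - 1)"
    have "exp (1::real) \<noteq> 1" by simp
    then have "(exp 1 - 1) * z = x" by (simp add: z_def)
    then have "exp 1 * z = x + z" by (simp add: algebra_simps)
    then have "f (model_mult 0 u (v z)) = f (model_mult 0 (v (x + z)) u)" using conj[of u z] by (simp add: u_def)
    also have "v (x + z) = model_mult 0 (v x) (v z)" by (simp add: vec_eq_iff forall_3 v)
    finally have "f (model_mult 0 u (v z)) $ 3 = f (model_mult 0 (model_mult 0 (v x) (v z)) u) $ 3" by simp
    then show ?thesis unfolding f by simp
  qed
  have add: "f (v (x + y)) = f (v x) + f (v y)" for x y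
  proof -
    have "v (x + y) = model_mult 0 (v x) (v y)" by (simp add: vec_eq_iff forall_3 v)
    then have "f (v (x + y)) = model_mult \<beta> (f (v x)) (f (v y))" by (simp only: f)
    then show ?thesis by (simp add: vec_eq_iff forall_3 f3)
  qed
  have "continuous_on UNIV (\<lambda>x. x *\<^sub>R v 1)" by (intro continuous_intros)
  then have "continuous_on UNIV v" by (rule continuous_on_eq) (simp add: vec_eq_iff forall_3 v)
  then have "continuous_on UNIV (\<lambda>x. f (v x))" by (rule continuous_on_compose2[OF fc]) simp
  from additive_continuous_scaleR[OF add this] have hom: "f (v x) = x *\<^sub>R f (v 1)" for x .
  \<comment> \<open>At time pi / \<beta> the rotation is a half-turn, so \<open>h\<close> acts on
    the plane as the negative scalar - exp (pi / \<beta>).\<close>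
  define h where "h = (vector [0, 0, pi / \<beta>] :: real^3)"
  have "F ` carrier G = carrier H" using F(1) unfolding iso_def bij_betw_def by simp
  then have "R h \<in> F ` carrier G" using R(1) by simp
  then obtain a where a: "a \<in> carrier G" "F a = R h" by auto
  define u where "u = \<Phi> a"
  have fu: "f u = h" using S(4)[OF a(1)] a(2) R(2) by (simp add: f_def u_def)
  define r where "r = exp (pi / \<beta>)"
  have eb: "ecos \<beta> (pi / \<beta>) = - r" "esin \<beta> (pi / \<beta>) = 0" using \<beta> by (simp_all add: ecos_def esin_def r_def)
  \<comment> \<open>The image under \<open>f\<close> of the conjugation relation for the preimage
    \<open>u\<close> of \<open>h\<close>: on \<open>f (v 1)\<close> it equates the scalars
    \<open>- r\<close> and \<open>exp (u $ 3)\<close>, which have opposite signs.\<close>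
  have "model_mult \<beta> h (f (v 1)) = model_mult \<beta> (f (v (exp (u $ 3)))) h"
    using conj[of u 1] unfolding f fu by simp
  then have "- r * f (v 1) $ i = exp (u $ 3) * f (v 1) $ i" if "i \<noteq> 3" for i
    using that exhaust_3[of i] unfolding hom[of "exp (u $ 3)"]
    by (auto simp: vec_eq_iff forall_3 h_def eb f3)
  moreover have "r > 0" "exp (u $ 3) > 0" by (simp_all add: r_def)
  then have "- r \<noteq> exp (u $ 3)" by linarith
  ultimately have "f (v 1) $ i = 0" if "i \<noteq> 3" for i using that by (metis mult_cancel_right)
  then have "f (v 1) = 0" using f3 by (simp add: vec_eq_iff forall_3)
  then have "f (v 1) = f (v 0)" using hom[of 0] by simp
  then have "S (v 1) = S (v 0)" unfolding f_def by (rule inj[OF S(2) S(2)])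
  then have "v 1 = v 0" using S(3) by metis
  then show False using v(1)[of 1] v(1)[of 0] by simp
qed

section \<open>The two groups\<close>

text \<open>The two groups are not constructed: the claim is made for all simply connected
  realizations of the two Lie algebras, on any carrier types.\<close>

theorem mainTheorem8:
  fixes \<nu> c :: real
    and G :: "'a monoid" and M :: "('a, real^3) manifold" and e0 e1 e2 :: "'a vfield"
    and H :: "'b monoid" and N :: "('b, real^3) manifold" and f0 f1 f2 :: "'b vfield"
    and g :: "'a metric_tensor" and h :: "'b metric_tensor"
  assumes "\<nu> > 0" and "c > 1"
    and "lie_group G M" and "simply_connected_space (mtop M)"
    and "lie_algebra_basis G M [e0, e1, e2]"
    and "lie_bracket M e0 e1 = lin_comb [0, 0, 0] [e0, e1, e2]"
    and "lie_bracket M e2 e0 = lin_comb [1, 0, 0] [e0, e1, e2]"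
    and "lie_bracket M e2 e1 = lin_comb [0, 1, 0] [e0, e1, e2]"
    and "lie_group H N" and "simply_connected_space (mtop N)"
    and "lie_algebra_basis H N [f0, f1, f2]"
    and "lie_bracket N f0 f1 = lin_comb [0, 0, 0] [f0, f1, f2]"
    and "lie_bracket N f2 f0 = lin_comb [0, 1, 0] [f0, f1, f2]"
    and "lie_bracket N f2 f1 = lin_comb [- c, 2, 0] [f0, f1, f2]"
    and "left_invariant_metric G M g"
    and "gram_matrix G g [e0, e1, e2] = [[1, 0, 0], [0, 1, 0], [0, 0, \<nu>]]"
    and "left_invariant_metric H N h"
    and "gram_matrix H h [f0, f1, f2] = [[1, 1, 0], [1, c, 0], [0, 0, \<nu>]]"
  shows "isometric M g hyperbolic_space (hyperbolic_metric (- 1 / \<nu>)) \<and>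
         isometric N h hyperbolic_space (hyperbolic_metric (- 1 / \<nu>)) \<and>
         isometric M g N h \<and>
         \<not> lie_group_isomorphic G M H N"
proof -
  let ?X = "topspace (mtop M)" and ?Y = "topspace (mtop N)"
  note G = assms(3) and scG = assms(4) and bG = assms(5) and H = assms(9) and scH = assms(10) and bH = assms(11)
  have mM: "smooth_manifold M" and mN: "smooth_manifold N" and cG: "carrier G = ?X" and cH: "carrier H = ?Y"
    and grG: "group G" and grH: "group H"
    using G H unfolding lie_group_def by auto
  interpret M: smooth_mfld M by standard (rule mM)
  interpret N: smooth_mfld N by standard (rule mN)
  have e: "e0 \<in> lie_algebra G M" "e1 \<in> lie_algebra G M" "e2 \<in> lie_algebra G M"
    and f: "f0 \<in> lie_algebra H N" "f1 \<in> lie_algebra H N" "f2 \<in> lie_algebra H N"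
    using bG bH unfolding lie_algebra_basis_def by auto
  have gm: "riemannian_metric M g" and hm: "riemannian_metric N h"
    using assms(15,17) unfolding left_invariant_metric_def by auto
  have brM: "A p (\<lambda>q. B q u) - B p (\<lambda>q. A q u) = C p u"
    if "lie_bracket M A B = C" "smooth_near M p u" for A B C :: "'a vfield" and p u
    using fun_cong[OF fun_cong[OF that(1)], of p u] that(2) M.smooth_near_topspace[OF that(2)]
    by (simp add: lie_bracket_def)
  have brN: "A p (\<lambda>q. B q u) - B p (\<lambda>q. A q u) = C p u"
    if "lie_bracket N A B = C" "smooth_near N p u" for A B C :: "'b vfield" and p u
    using fun_cong[OF fun_cong[OF that(1)], of p u] that(2) N.smooth_near_topspace[OF that(2)]
    by (simp add: lie_bracket_def)

  define \<beta> where "\<beta> = sqrt (c - 1)"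
  have \<beta>: "\<beta> > 0" "\<beta> * \<beta> = c - 1" using \<open>c > 1\<close> by (simp_all add: \<beta>_def)
  \<comment> \<open>Gram-Schmidt applied to \<open>f0\<close> and \<open>f1\<close>: the projection
    of \<open>f1\<close> on \<open>f0\<close> is \<open>f0\<close> itself, and what is left has
    length \<beta>.\<close>
  define f1' where "f1' = (\<lambda>p u. (- 1 / \<beta>) * f0 p u + (1 / \<beta>) * f1 p u)"

  interpret GF: spiral_frame M "\<lambda>i. if i = 1 then e0 else if i = 2 then e1 else e2" G 0
  proof (rule spiral_frameI[OF G scG])
    show "pushforward M (\<lambda>q. a \<otimes>\<^bsub>G\<^esub> q) p (W p) = W (a \<otimes>\<^bsub>G\<^esub> p)"
      if "W = e0 \<or> W = e1 \<or> W = e2" "a \<in> carrier G" "p \<in> carrier G" for W a p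
      using lie_algebraD(3)[OF _ that(2,3)] e that(1) by blast
    show "a = 0 \<and> b = 0 \<and> c = 0" if "p \<in> ?X" "\<And>f. a * e0 p f + b * e1 p f + c * e2 p f = 0" for p a b c
      by (rule basis_independent[OF G bG that])
    show "e0 p (\<lambda>q. e1 q u) - e1 p (\<lambda>q. e0 q u) = 0" if "smooth_near M p u" for p u
      using brM[OF assms(6) that] by (simp add: lin_comb_3)
    show "e2 p (\<lambda>q. e0 q u) - e0 p (\<lambda>q. e2 q u) = e0 p u + 0 * e1 p u" if "smooth_near M p u" for p u
      using brM[OF assms(7) that] by (simp add: lin_comb_3)
    show "e2 p (\<lambda>q. e1 q u) - e1 p (\<lambda>q. e2 q u) = e1 p u - 0 * e0 p u" if "smooth_near M p u" for p u
      using brM[OF assms(8) that] by (simp add: lin_comb_3)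
  qed (use e lie_algebraD(1) in blast)+

  have fT: "f0 p \<in> tangent_space N p" "f1 p \<in> tangent_space N p" "f2 p \<in> tangent_space N p"
    and fS: "smooth_near N p u \<Longrightarrow> smooth_near N p (\<lambda>q. f0 q u)" "smooth_near N p u \<Longrightarrow> smooth_near N p (\<lambda>q. f1 q u)"
    if "p \<in> ?Y" for p u
  proof -
    show "f0 p \<in> tangent_space N p" "f1 p \<in> tangent_space N p" "f2 p \<in> tangent_space N p"
      using lie_algebraD(1)[OF f(1)] lie_algebraD(1)[OF f(2)] lie_algebraD(1)[OF f(3)] that
      unfolding smooth_vfield_on_def by blast+
    have "smooth_near N p (\<lambda>q. A q u)" if u: "smooth_near N p u" and A: "A \<in> lie_algebra H N" for A
    proof -
      obtain W where W: "p \<in> W" "smooth_fun_on N W u" using u unfolding smooth_near_def by blast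
      have "W \<subseteq> ?Y" by (rule openin_subset[OF N.smooth_fun_on_openin[OF W(2)]])
      then have "smooth_fun_on N W (\<lambda>q. A q u)"
        using lie_algebraD(1)[OF A] W(2) unfolding smooth_vfield_on_def by blast
      then show ?thesis using W(1) unfolding smooth_near_def by blast
    qed
    then show "smooth_near N p u \<Longrightarrow> smooth_near N p (\<lambda>q. f0 q u)" "smooth_near N p u \<Longrightarrow> smooth_near N p (\<lambda>q. f1 q u)"
      using f by blast+
  qed

  interpret HF: spiral_frame N "\<lambda>i. if i = 1 then f0 else if i = 2 then f1' else f2" H \<beta>
  proof (rule spiral_frameI[OF H scH])
    show "smooth_vfield_on N ?Y f1'"
      unfolding f1'_def by (intro N.smooth_vfield_combination lie_algebraD(1)[OF f(1)] lie_algebraD(1)[OF f(2)])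
    show "pushforward N (\<lambda>q. a \<otimes>\<^bsub>H\<^esub> q) p (W p) = W (a \<otimes>\<^bsub>H\<^esub> p)"
      if W: "W = f0 \<or> W = f1' \<or> W = f2" and ap: "a \<in> carrier H" "p \<in> carrier H" for W a p
    proof -
      note i = lie_algebraD(3)[OF f(1) ap] lie_algebraD(3)[OF f(2) ap] lie_algebraD(3)[OF f(3) ap]
      have "pushforward N (\<lambda>q. a \<otimes>\<^bsub>H\<^esub> q) p (f1' p) = f1' (a \<otimes>\<^bsub>H\<^esub> p)"
        unfolding f1'_def i(1,2)[symmetric] by (simp add: pushforward_def fun_eq_iff)
      with i W show ?thesis by blast
    qed
    show "a = 0 \<and> b = 0 \<and> k = 0"
      if "p \<in> ?Y" "\<And>u. a * f0 p u + b * f1' p u + k * f2 p u = 0" for p a b k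
    proof -
      have "(a - b / \<beta>) * f0 p u + (b / \<beta>) * f1 p u + k * f2 p u = 0" for u
        using that(2)[of u] by (simp add: f1'_def algebra_simps)
      from basis_independent[OF H bH that(1) this] show ?thesis using \<beta>(1) by simp
    qed
    fix p u assume u: "smooth_near N p u"
    note p = N.smooth_near_topspace[OF u]
    have f1'p: "v (\<lambda>q. f1' q u) = (- 1 / \<beta>) * v (\<lambda>q. f0 q u) + (1 / \<beta>) * v (\<lambda>q. f1 q u)"
      if "v \<in> tangent_space N p" for v
      unfolding f1'_def by (rule N.tangent_lin[OF that fS(1)[OF p u] fS(2)[OF p u]])
    have b01: "f0 p (\<lambda>q. f1 q u) - f1 p (\<lambda>q. f0 q u) = 0"
      and b20: "f2 p (\<lambda>q. f0 q u) - f0 p (\<lambda>q. f2 q u) = f1 p u"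
      and b21: "f2 p (\<lambda>q. f1 q u) - f1 p (\<lambda>q. f2 q u) = - c * f0 p u + 2 * f1 p u"
      using brN[OF assms(12) u] brN[OF assms(13) u] brN[OF assms(14) u] by (simp_all add: lin_comb_3)
    have f1'd: "f1' p z = (- 1 / \<beta>) * f0 p z + (1 / \<beta>) * f1 p z" for z by (simp add: f1'_def)
    show "f0 p (\<lambda>q. f1' q u) - f1' p (\<lambda>q. f0 q u) = 0"
      using b01 unfolding f1'p[OF fT(1)[OF p]] f1'd by simp
    show "f2 p (\<lambda>q. f0 q u) - f0 p (\<lambda>q. f2 q u) = f0 p u + \<beta> * f1' p u"
      using b20 \<beta>(1) unfolding f1'd by (simp add: field_simps)
    \<comment> \<open>In bracket notation, [f2, f1 - f0] = f1 - c f0 = (f1 - f0) - \<beta>^2 f0,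
      divided by \<beta>.\<close>
    have "f2 p (\<lambda>q. f1' q u) - f1' p (\<lambda>q. f2 q u) =
        (1 / \<beta>) * ((f2 p (\<lambda>q. f1 q u) - f1 p (\<lambda>q. f2 q u)) - (f2 p (\<lambda>q. f0 q u) - f0 p (\<lambda>q. f2 q u)))"
      unfolding f1'p[OF fT(3)[OF p]] f1'd by (simp add: algebra_simps)
    also have "\<dots> = (1 / \<beta>) * (f1 p u - f0 p u - (\<beta> * \<beta>) * f0 p u)"
      unfolding b20 b21 \<beta>(2) by (simp add: algebra_simps)
    also have "\<dots> = f1' p u - \<beta> * f0 p u" using \<beta>(1) unfolding f1'd by (simp add: field_simps)
    finally show "f2 p (\<lambda>q. f1' q u) - f1' p (\<lambda>q. f2 q u) = f1' p u - \<beta> * f0 p u" .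
  qed (use f lie_algebraD(1) in blast)+

  have isoG: "isometric M g hyperbolic_space (hyperbolic_metric (- 1 / \<nu>))"
  proof (rule GF.isometric_hyperbolic[OF \<open>\<nu> > 0\<close> gm])
    fix p and i j :: 3 assume p: "p \<in> ?X"
    note * = left_invariant_gram[OF G assms(15) _ _ p]
    show "g p ((if i = 1 then e0 else if i = 2 then e1 else e2) p) ((if j = 1 then e0 else if j = 2 then e1 else e2) p) =
        (if i = j then if i = 3 then \<nu> else 1 else 0)"
      using assms(16) *[OF e(1) e(1)] *[OF e(1) e(2)] *[OF e(1) e(3)] *[OF e(2) e(1)] *[OF e(2) e(2)]
        *[OF e(2) e(3)] *[OF e(3) e(1)] *[OF e(3) e(2)] *[OF e(3) e(3)] exhaust_3[of i] exhaust_3[of j]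
      by (auto simp: gram_matrix_def)
  qed

  have isoH: "isometric N h hyperbolic_space (hyperbolic_metric (- 1 / \<nu>))"
  proof (rule HF.isometric_hyperbolic[OF \<open>\<nu> > 0\<close> hm])
    fix p and i j :: 3 assume p: "p \<in> ?Y"
    note * = left_invariant_gram[OF H assms(17) _ _ p]
    have gr: "h p (f0 p) (f0 p) = 1" "h p (f0 p) (f1 p) = 1" "h p (f0 p) (f2 p) = 0" "h p (f1 p) (f0 p) = 1"
      "h p (f1 p) (f1 p) = c" "h p (f1 p) (f2 p) = 0" "h p (f2 p) (f2 p) = \<nu>"
      using assms(18) *[OF f(1) f(1)] *[OF f(1) f(2)] *[OF f(1) f(3)] *[OF f(2) f(1)] *[OF f(2) f(2)]
        *[OF f(2) f(3)] *[OF f(3) f(3)]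
      by (simp_all add: gram_matrix_def)
    have lin: "h p (\<lambda>z. a * u z + b * u' z) w = a * h p u w + b * h p u' w"
      and sym: "h p u w = h p w u"
      if "u \<in> tangent_space N p" "u' \<in> tangent_space N p" "w \<in> tangent_space N p" for u u' w a b
      using hm p that unfolding riemannian_metric_def by blast+
    note T = fT[OF p]
    have T': "f1' p \<in> tangent_space N p" unfolding f1'_def by (rule N.tangent_lincomb[OF T(1,2)])
    have l: "h p (f1' p) w = (- 1 / \<beta>) * h p (f0 p) w + (1 / \<beta>) * h p (f1 p) w" if "w \<in> tangent_space N p" for w
      unfolding f1'_def by (rule lin[OF T(1,2) that])
    have "h p (f1' p) (f0 p) = 0" using l[OF T(1)] gr by simp
    moreover from this have "h p (f0 p) (f1' p) = 0" using sym[OF T(1) T(1) T'] by simp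
    moreover have "h p (f1' p) (f2 p) = 0" using l[OF T(3)] gr by simp
    moreover from this have "h p (f2 p) (f1' p) = 0" using sym[OF T(3) T(3) T'] by simp
    moreover have "h p (f2 p) (f0 p) = 0" using sym[OF T(3) T(3) T(1)] gr by simp
    moreover have "h p (f1' p) (f1' p) = 1"
    proof -
      have "h p (f1' p) (f1 p) = (c - 1) / \<beta>" using l[OF T(2)] gr by (simp add: diff_divide_distrib)
      then have "h p (f1 p) (f1' p) = \<beta> * \<beta> / \<beta>" using sym[OF T(2) T(2) T'] \<beta>(2) by simp
      then show ?thesis using l[OF T'] \<open>h p (f0 p) (f1' p) = 0\<close> \<beta>(1) by simp
    qed
    ultimately show "h p ((if i = 1 then f0 else if i = 2 then f1' else f2) p) ((if j = 1 then f0 else if j = 2 then f1' else f2) p) =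
        (if i = j then if i = 3 then \<nu> else 1 else 0)"
      using gr exhaust_3[of i] exhaust_3[of j] by auto
  qed

  have "isometric M g N h"
    by (rule isometric_trans[OF mM smooth_manifold_hyperbolic_space mN isoG
        isometric_sym[OF mN smooth_manifold_hyperbolic_space isoH]])
  moreover have "\<not> lie_group_isomorphic G M H N"
  proof
    assume "lie_group_isomorphic G M H N"
    \<comment> \<open>Already a continuous isomorphism of groups leads to a contradiction.\<close>
    then obtain F where F: "F \<in> iso G H" "continuous_map (mtop M) (mtop N) F"
      unfolding lie_group_isomorphic_def diffeomorphism_def smooth_map_def by blast
    show False
    proof (rule GF.model_coordinates, rule HF.model_coordinates)
      fix \<Phi> S \<Psi> R
      assume \<Phi>: "\<And>a p. a \<in> carrier G \<Longrightarrow> p \<in> carrier G \<Longrightarrow> \<Phi> (a \<otimes>\<^bsub>G\<^esub> p) = model_mult 0 (\<Phi> a) (\<Phi> p)"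
        and S: "continuous_map euclidean (mtop M) S" "\<And>w. \<Phi> (S w) = w" "\<And>p. p \<in> ?X \<Longrightarrow> S (\<Phi> p) = p"
        and \<Psi>: "\<And>a p. a \<in> carrier H \<Longrightarrow> p \<in> carrier H \<Longrightarrow> \<Psi> (a \<otimes>\<^bsub>H\<^esub> p) = model_mult \<beta> (\<Psi> a) (\<Psi> p)"
          "continuous_map (mtop N) euclidean \<Psi>"
        and R: "continuous_map euclidean (mtop N) R" "\<And>w. \<Psi> (R w) = w" "\<And>p. p \<in> ?Y \<Longrightarrow> R (\<Psi> p) = p"
      have "S w \<in> carrier G" "R w \<in> carrier H" for w
        using S(1) R(1) unfolding continuous_map_def cG cH by auto
      then show False
        using spiral_groups_not_isomorphic[OF grG S(1) _ S(2) S(3)[folded cG] \<Phi> grH _ R(2) R(3)[folded cH] \<Psi>(2,1) \<beta>(1) F]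
        by blast
    qed
  qed
  ultimately show ?thesis using isoG isoH by blast
qed

end
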